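(* Let $F:\mathbb{T}^2\to\mathbb{T}^2$ be a $C^1$ map of the torus, written as $F(z)=(Mz+G(z))\bmod 1$ as in the context, such that $DF(z)$ is invertible for every $z$. Assume: ($E_M$) the $2\times 2$ integer matrix $M$ has the two integer eigenvalues $1$ and $m$, with $|m|>1$; ($E_{\mathcal{P}\mathcal{R}}$) $F$ has a (hyperbolic) periodic saddle $\mathcal{P}$ and a (hyperbolic) periodic repeller $\mathcal{R}$; ($E_{cone}$) $F$ has a $(K,\alpha)$-cone system with respect to $w=v_m^R/|v_m^R|$ and $W=(v_m^L)^\perp$, where $v_m^R$ and $v_m^L$ are right and left eigenvectors of $M$ for the eigenvalue $m$; ($E_{QuasiP}$) there is a curve $\Gamma\subset\mathbb{T}^2$ and an integer $p\ge 1$ such that $F^p(\Gamma)=\Gamma$ and $F^p|_\Gamma$ is quasiperiodic. Then $\mathbb{T}^2$ is multi-chaotic for $F$.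
   Context: $\mathbb{T}^d=\mathbb{R}^d/\mathbb{Z}^d$, and $\bmod 1$ is applied coordinatewise. Every continuous $F:\mathbb{T}^d\to\mathbb{T}^d$ can be written uniquely as $F(z)=(Mz+G(z))\bmod 1$ with $M$ a $d\times d$ integer matrix and $G:\mathbb{R}^d\to\mathbb{R}^d$ continuous and $\mathbb{Z}^d$-periodic. A map on a circle or on a closed curve is quasiperiodic if it is topologically conjugate to a rotation $\theta\mapsto\theta+\rho\bmod 1$ with $\rho$ irrational. Cone system: let $w\in\mathbb{R}^d$ with $|w|=1$ and let $W$ be a $(d-1)$-dimensional subspace with $\mathbb{R}^d=\mathbb{R}w\oplus W$. Write each tangent vector as $v=aw+b=(a,b)$ with $b\in W$, and set $(a',b')=DF(z)v$. $F$ has a $(K,\alpha)$-cone system with respect to $w$ and $W$, with constants $K>1$ and $\alpha>0$, if for every $z$ and every $v=(a,b)$ with $|b|\le\alpha|a|$ one has (i) $|b'|<\alpha|a'|$ and (ii) $|a'|>K|a|$; and (iii) for every vector $u$ outside the cone, $\|DF(z)u\|<K\|u\|$. The cone at $z$ is the set $\{(a,b):|b|<\alpha|a|\}$. A saddle is a hyperbolic periodic point of period $n$ for which $DF^n$ has one eigenvalue of modulus $>1$ and one of modulus $<1$. A repeller is a hyperbolic periodic point all of whose eigenvalues for $DF^n$ have modulus $>1$. A set $X$ is transitive if it is uncountable, closed, satisfies $F(X)=X$, and contains a point whose forward orbit is dense in $X$. $X$ is chaotic if it is transitive and periodic points of $F$ are dense in $X$. $X$ is $k$-chaotic if it is chaotic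 and there is a dense subset of $X$ consisting of periodic points whose unstable manifolds intersected with $X$ have topological dimension $k$. $X$ is multi-chaotic if it is $k$-chaotic for at least two values of $k$. For $X=\mathbb{T}^2$ this means there is a dense orbit, periodic saddles are dense, and periodic repellers are dense. *)

theory Defs
  imports "HOL-Analysis.Analysis"
begin

text \<open>The torus T^2 = R^2 / Z^2 is modelled through lifts in real^2 together with
  the standard embedding of T^2 into C x C (which carries the correct topology).\<close>

definition torus_emb :: "real^2 \<Rightarrow> complex \<times> complex" where
  "torus_emb x = (cis (2 * pi * x$1), cis (2 * pi * x$2))"

definition torus :: "(complex \<times> complex) set" where
  "torus = range torus_emb"

definition int_vec :: "real^2 \<Rightarrow> bool" where
  "int_vec k \<longleftrightarrow> (\<forall>i. k$i \<in> \<int>)"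

definition int_mat :: "real^2^2 \<Rightarrow> bool" where
  "int_mat A \<longleftrightarrow> (\<forall>i j. A$i$j \<in> \<int>)"

definition torus_map :: "(real^2 \<Rightarrow> real^2) \<Rightarrow> complex \<times> complex \<Rightarrow> complex \<times> complex" where
  "torus_map f u = torus_emb (f (SOME x. torus_emb x = u))"

definition eigenvalue2 :: "real^2^2 \<Rightarrow> complex \<Rightarrow> bool" where
  "eigenvalue2 A l \<longleftrightarrow>
     det (((\<chi> i j. complex_of_real (A$i$j)) :: complex^2^2) - mat l) = 0"

definition periodic_pt :: "(real^2 \<Rightarrow> real^2) \<Rightarrow> nat \<Rightarrow> real^2 \<Rightarrow> bool" where
  "periodic_pt f n x \<longleftrightarrow> n \<ge> 1 \<and> int_vec ((f ^^ n) x - x)"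

definition saddle :: "(real^2 \<Rightarrow> real^2) \<Rightarrow> real^2 \<Rightarrow> bool" where
  "saddle f x \<longleftrightarrow> (\<exists>n L. periodic_pt f n x \<and> ((f ^^ n) has_derivative L) (at x) \<and>
      (\<forall>l. eigenvalue2 (matrix L) l \<longrightarrow> cmod l \<noteq> 1) \<and>
      (\<exists>l. eigenvalue2 (matrix L) l \<and> cmod l > 1) \<and>
      (\<exists>l. eigenvalue2 (matrix L) l \<and> cmod l < 1))"

definition repeller :: "(real^2 \<Rightarrow> real^2) \<Rightarrow> real^2 \<Rightarrow> bool" where
  "repeller f x \<longleftrightarrow> (\<exists>n L. periodic_pt f n x \<and> ((f ^^ n) has_derivative L) (at x) \<and>
      (\<forall>l. eigenvalue2 (matrix L) l \<longrightarrow> cmod l > 1))"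

text \<open>(K,alpha)-cone system w.r.t. w and W for the derivative field Df.
  Conditions (i),(ii) are required for nonzero vectors in the closed cone, and
  (iii) for nonzero vectors outside the open cone (for v = 0 they cannot hold).\<close>
definition cone_system ::
  "real \<Rightarrow> real \<Rightarrow> real^2 \<Rightarrow> (real^2) set \<Rightarrow> (real^2 \<Rightarrow> real^2 \<Rightarrow> real^2) \<Rightarrow> bool" where
  "cone_system K \<alpha> w W Df \<longleftrightarrow>
     K > 1 \<and> \<alpha> > 0 \<and> norm w = 1 \<and> subspace W \<and> dim W = 1 \<and> w \<notin> W \<and>
     (\<forall>z a b a' b'. b \<in> W \<and> b' \<in> W \<and> a *\<^sub>R w + b \<noteq> 0 \<and> norm b \<le> \<alpha> * \<bar>a\<bar> \<and>
         Df z (a *\<^sub>R w + b) = a' *\<^sub>R w + b' \<longrightarrow>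
         norm b' < \<alpha> * \<bar>a'\<bar> \<and> \<bar>a'\<bar> > K * \<bar>a\<bar>) \<and>
     (\<forall>z a b. b \<in> W \<and> a *\<^sub>R w + b \<noteq> 0 \<and> \<not> (norm b < \<alpha> * \<bar>a\<bar>) \<longrightarrow>
         norm (Df z (a *\<^sub>R w + b)) < K * norm (a *\<^sub>R w + b))"

definition quasiperiodic_on ::
  "(complex \<times> complex \<Rightarrow> complex \<times> complex) \<Rightarrow> (complex \<times> complex) set \<Rightarrow> bool" where
  "quasiperiodic_on T \<Gamma> \<longleftrightarrow> (\<exists>h k \<rho>. \<rho> \<notin> \<rat> \<and> homeomorphism \<Gamma> (sphere 0 1) h k \<and>
       (\<forall>y\<in>\<Gamma>. h (T y) = cis (2 * pi * \<rho>) * h y))"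

definition multi_chaotic_T2 :: "(real^2 \<Rightarrow> real^2) \<Rightarrow> bool" where
  "multi_chaotic_T2 f \<longleftrightarrow>
     torus_map f ` torus = torus \<and>
     (\<exists>x. closure (torus_emb ` range (\<lambda>n. (f ^^ n) x)) = torus) \<and>
     closure (torus_emb ` {x. saddle f x}) = torus \<and>
     closure (torus_emb ` {x. repeller f x}) = torus"

end

(* As m is an eigenvalue of M with an integer left eigenvector, a map H semiconjugates F to t -> m t
   on the circle, and by the cone condition the fibres of H are Lipschitz circles transverse to w.
   The quasiperiodic curve is a full fibre: H is constant on it since a rotation is equicontinuous
   while t -> m t is expansive. So the forward orbit of an open set meets this fibre, contains it by
   minimality, and covers the torus by expansion across the fibres. This gives transitivity. It also
   leads from any open U to a repeller R and from any neighbourhood of R back to U; closing up such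
   a loop with many turns near R yields a repeller in U by contraction of inverse branches.
   For a saddle P one needs a genuine homoclinic orbit through U: by (iii) the fibres are dominated
   by the cone direction, which makes the unstable curve of P dense in every fibre, and then the
   return maps along periodic fibres contract an interval. *)

theory Submission
  imports Defs
begin

section \<open>Integrating the cone conditions\<close>

text \<open>All dynamics takes place in the plane: iterates are composed with integer translations,
  so that a periodic point of the torus becomes a genuine fixed point. The fibres of
  \<open>H\<close> are only known to be Lipschitz, so no derivative can be taken along them. Its
  substitute is the gap \<open>K1 < K\<close>, which compactness extracts from condition (iii): over
  \<open>n\<close> steps distances along fibres grow at most by \<open>K1 ^ n\<close>, those in the
  cone at least like \<open>K ^ n\<close>. Hence all limits of secants of fibres at a periodic point
  are parallel, the fibre direction is an eigenvector there, and unstable curves exist and are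
  unique. That the quasiperiodic curve is a whole fibre is a one-dimensional fact: a compact piece
  of a fibre has the fixed point property, an irrational rotation has no fixed point. Inverse
  branches, which give repellers, fail for saddles because they expand the fibre direction. Since
  \<open>H\<close>-differences are multiplied exactly by powers of \<open>m\<close>, however, the
  fibre that carries the periodic orbit solves a linear equation, and only a contraction of an
  interval remains to be found.\<close>

lemma int_vec_simps [simp]:
  "int_vec 0" "int_vec x \<Longrightarrow> int_vec y \<Longrightarrow> int_vec (x + y)" "int_vec x \<Longrightarrow> int_vec y \<Longrightarrow> int_vec (x - y)"
  "int_vec x \<Longrightarrow> int_vec (- x)"
  by (auto simp: int_vec_def)

lemma int_vec_scaleR: "a \<in> \<int> \<Longrightarrow> int_vec x \<Longrightarrow> int_vec (a *\<^sub>R x)"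
  by (auto simp: int_vec_def)

lemma int_vec_mult: "int_mat A \<Longrightarrow> int_vec x \<Longrightarrow> int_vec (A *v x)"
  unfolding int_vec_def int_mat_def matrix_vector_mult_def by (auto intro!: Ints_sum Ints_mult)

text \<open>\<open>\<phi>\<close> and \<open>\<beta>\<close> are the coordinates along \<open>w\<close> and \<open>k1 \<in> W\<close>, with \<open>w\<close> rescaled to \<open>\<phi> w = 1\<close>. The gap
  \<open>K1 < K\<close> strengthens condition (iii) by compactness.\<close>

locale cone_map =
  fixes f :: "real^2 \<Rightarrow> real^2" and D :: "real^2 \<Rightarrow> ((real^2) \<Rightarrow>\<^sub>L (real^2))" and M :: "real^2^2"
    and \<phi> \<beta> :: "real^2 \<Rightarrow> real" and w k1 k2 :: "real^2" and m \<kappa> K K1 B :: real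
  assumes f_deriv: "\<And>x. (f has_derivative (D x)) (at x)"
    and D_cont: "continuous_on UNIV D"
    and D_inj: "\<And>x v. (D x) v = 0 \<Longrightarrow> v = 0"
    and M_int: "int_mat M"
    and f_shift: "\<And>x k. int_vec k \<Longrightarrow> f (x + k) = f x + M *v k"
    and \<phi>_lin: "bounded_linear \<phi>" and \<beta>_lin: "bounded_linear \<beta>"
    and \<phi>_int: "\<And>k. int_vec k \<Longrightarrow> \<phi> k \<in> \<int>"
    and \<phi>_M: "\<And>v. \<phi> (M *v v) = m * \<phi> v"
    and \<phi>_f: "\<And>x. \<bar>\<phi> (f x) - m * \<phi> x\<bar> \<le> B"
    and k1: "int_vec k1" "\<phi> k1 = 0" "\<beta> k1 = 1" "M *v k1 = k1"
    and k2: "int_vec k2" "\<phi> k2 = 1"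
    and kernel: "\<And>k. int_vec k \<Longrightarrow> \<phi> k = 0 \<Longrightarrow> \<beta> k \<in> \<int>"
    and w: "\<phi> w = 1" "\<beta> w = 0"
    and decomp: "\<And>x. x = \<phi> x *\<^sub>R w + \<beta> x *\<^sub>R k1"
    and m: "m \<in> \<int>" "2 \<le> \<bar>m\<bar>"
    and \<kappa>: "\<kappa> > 0" and K: "K > 1" and K1: "0 < K1" "K1 < K"
    and cone: "\<And>z v. v \<noteq> 0 \<Longrightarrow> \<bar>\<beta> v\<bar> \<le> \<kappa> * \<bar>\<phi> v\<bar> \<Longrightarrow>
        \<bar>\<beta> ((D z) v)\<bar> < \<kappa> * \<bar>\<phi> ((D z) v)\<bar> \<and>
        K * \<bar>\<phi> v\<bar> < \<bar>\<phi> ((D z) v)\<bar>"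
    and noncone: "\<And>z v. \<not> \<bar>\<beta> v\<bar> < \<kappa> * \<bar>\<phi> v\<bar> \<Longrightarrow> norm ((D z) v) \<le> K1 * norm v"
begin

sublocale \<phi>: bounded_linear \<phi> by (rule \<phi>_lin)
sublocale \<beta>: bounded_linear \<beta> by (rule \<beta>_lin)

lemmas \<phi>_simps = \<phi>.add \<phi>.diff \<phi>.scaleR \<phi>.neg \<phi>.zero
lemmas \<beta>_simps = \<beta>.add \<beta>.diff \<beta>.scaleR \<beta>.neg \<beta>.zero

lemma m_nz: "m \<noteq> 0" using m by auto

lemma m_pow: "m ^ n \<noteq> 0" "2 ^ n \<le> \<bar>m ^ n\<bar>" "m ^ n \<in> \<int>"
  using m power_mono[of 2 "\<bar>m\<bar>" n] by (auto simp: power_abs)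

lemma B_nonneg: "0 \<le> B"
  using \<phi>_f[of 0] by linarith

lemma f_cont: "continuous_on UNIV f"
  by (meson continuous_at_imp_continuous_on f_deriv has_derivative_continuous)

lemma \<phi>_cont: "continuous_on A \<phi>" and \<beta>_cont: "continuous_on A \<beta>"
  by (simp_all add: \<phi>.continuous_on \<beta>.continuous_on)

text \<open>Closed cone in the coordinates of the locale. It is applied to tangent vectors and, once
  the cone conditions are integrated, to differences of points.\<close>

definition CC :: "real^2 \<Rightarrow> bool" where
  "CC v \<longleftrightarrow> \<bar>\<beta> v\<bar> \<le> \<kappa> * \<bar>\<phi> v\<bar>"

lemma coord_eqI: "\<phi> x = \<phi> y \<Longrightarrow> \<beta> x = \<beta> y \<Longrightarrow> x = y"
  using decomp[of x] decomp[of y] by simp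

lemma CC_\<phi>_zero: "CC v \<Longrightarrow> \<phi> v = 0 \<Longrightarrow> v = 0"
  unfolding CC_def by (intro coord_eqI) (auto simp: \<phi>_simps \<beta>_simps)

lemma CC_0 [simp]: "CC 0" by (simp add: CC_def \<phi>_simps \<beta>_simps)

lemma CC_w: "\<beta> v = 0 \<Longrightarrow> CC v" using \<kappa> by (simp add: CC_def)

lemma norm_coord: "norm v \<le> \<bar>\<phi> v\<bar> * norm w + \<bar>\<beta> v\<bar> * norm k1"
  by (subst decomp[of v]) (metis norm_scaleR norm_triangle_ineq real_norm_def)

lemma CC_norm: "CC v \<Longrightarrow> norm v \<le> (norm w + \<kappa> * norm k1) * \<bar>\<phi> v\<bar>"
proof -
  assume "CC v"
  then have "\<bar>\<beta> v\<bar> * norm k1 \<le> \<kappa> * \<bar>\<phi> v\<bar> * norm k1"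
    unfolding CC_def by (intro mult_right_mono) auto
  then show ?thesis using norm_coord[of v] by (simp add: algebra_simps)
qed

lemma notCC_norm: "\<not> \<bar>\<beta> v\<bar> < \<kappa> * \<bar>\<phi> v\<bar> \<Longrightarrow> norm v \<le> (norm w / \<kappa> + norm k1) * \<bar>\<beta> v\<bar>"
proof -
  assume "\<not> \<bar>\<beta> v\<bar> < \<kappa> * \<bar>\<phi> v\<bar>"
  then have "\<bar>\<phi> v\<bar> \<le> \<bar>\<beta> v\<bar> / \<kappa>" using \<kappa> by (simp add: field_simps)
  then have "\<bar>\<phi> v\<bar> * norm w \<le> \<bar>\<beta> v\<bar> / \<kappa> * norm w" by (intro mult_right_mono) auto
  then show ?thesis using norm_coord[of v] by (simp add: algebra_simps)
qed

lemma line_deriv: "((\<lambda>t. f (y + t *\<^sub>R v)) has_vector_derivative (D (y + t *\<^sub>R v)) v) (at t within A)"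
proof -
  have "((\<lambda>t. y + t *\<^sub>R v) has_vector_derivative v) (at t within A)"
    by (auto intro!: derivative_eq_intros)
  then show ?thesis
    using vector_derivative_diff_chain_within[of "\<lambda>t. y + t *\<^sub>R v" v t A f "(D (y + t *\<^sub>R v))"]
      has_derivative_at_withinI[OF f_deriv] by (simp add: o_def)
qed

text \<open>The sign of \<open>\<phi>\<close> along the image of a segment in a cone direction cannot change, so the
  infinitesimal cone estimates integrate.\<close>

lemma cone_f:
  assumes "CC (x - y)"
  shows "CC (f x - f y)" "K * \<bar>\<phi> (x - y)\<bar> \<le> \<bar>\<phi> (f x - f y)\<bar>"
proof -
  have "CC (f x - f y) \<and> K * \<bar>\<phi> (x - y)\<bar> \<le> \<bar>\<phi> (f x - f y)\<bar>"
  proof (cases "x = y")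
    case True then show ?thesis by (simp add: \<phi>_simps)
  next
    case False
    define v where "v = x - y"
    have v: "v \<noteq> 0" "CC v" using False assms by (auto simp: v_def)
    define d where "d t = (D (y + t *\<^sub>R v)) v" for t
    have d: "\<bar>\<beta> (d t)\<bar> < \<kappa> * \<bar>\<phi> (d t)\<bar>" "K * \<bar>\<phi> v\<bar> < \<bar>\<phi> (d t)\<bar>" for t
      using cone[of v "y + t *\<^sub>R v"] v unfolding CC_def d_def by auto
    have cd: "continuous_on {0..1} (\<lambda>t. \<phi> (d t))"
      unfolding d_def
      by (intro continuous_intros \<phi>.continuous_on continuous_on_compose2[OF D_cont]) auto
    have nz: "\<phi> (d t) \<noteq> 0" for t using d(2)[of t] K by (smt (verit) mult_nonneg_nonneg)
    obtain s where s: "s = 1 \<or> s = (-1::real)" "\<And>t. t \<in> {0..1} \<Longrightarrow> s * \<phi> (d t) > 0"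
    proof -
      define s where "s = sgn (\<phi> (d 0))"
      have "s * \<phi> (d t) > 0" if t: "t \<in> {0..1}" for t
      proof (rule ccontr)
        assume c: "\<not> 0 < s * \<phi> (d t)"
        have "continuous_on {0..t} (\<lambda>t. s * \<phi> (d t))"
          using t by (intro continuous_intros continuous_on_subset[OF cd]) auto
        moreover have "s * \<phi> (d 0) > 0" using nz[of 0] by (auto simp: s_def sgn_real_def)
        ultimately obtain u where "s * \<phi> (d u) = 0"
          using IVT2'[of "\<lambda>t. s * \<phi> (d t)" t 0 0] c t by auto
        then show False using nz by (auto simp: s_def sgn_real_def split: if_splits)
      qed
      moreover have "s = 1 \<or> s = -1" using nz[of 0] by (auto simp: s_def sgn_real_def)
      ultimately show ?thesis using that by blast
    qed
    have gd: "((\<lambda>t. c1 * \<phi> (f (y + t *\<^sub>R v)) + c2 * \<beta> (f (y + t *\<^sub>R v))) has_real_derivative c1 * \<phi> (d t) + c2 * \<beta> (d t)) (at t)" for c1 c2 t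
      unfolding has_real_derivative_iff_has_vector_derivative d_def
      by (intro derivative_intros \<phi>.has_vector_derivative[OF line_deriv] \<beta>.has_vector_derivative[OF line_deriv] has_vector_derivative_mult_right)
    \<comment> \<open>Lying in the cone on the side \<open>s\<close> is a conjunction of linear
      inequalities, so the mean value theorem can be applied separately to \<open>\<phi>\<close>,
      \<open>s * \<kappa> * \<phi> + \<beta>\<close> and
      \<open>s * \<kappa> * \<phi> - \<beta>\<close>, each with its own intermediate time.\<close>
    have mv: "\<exists>t\<in>{0..1}. c1 * \<phi> (f x - f y) + c2 * \<beta> (f x - f y) = c1 * \<phi> (d t) + c2 * \<beta> (d t)" for c1 c2
    proof -
      obtain t where "0 < t" "t < 1" "(\<lambda>t. c1 * \<phi> (f (y + t *\<^sub>R v)) + c2 * \<beta> (f (y + t *\<^sub>R v))) 1 - (\<lambda>t. c1 * \<phi> (f (y + t *\<^sub>R v)) + c2 * \<beta> (f (y + t *\<^sub>R v))) 0 = (1 - 0) * (c1 * \<phi> (d t) + c2 * \<beta> (d t))"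
        using MVT2[of 0 1 "\<lambda>t. c1 * \<phi> (f (y + t *\<^sub>R v)) + c2 * \<beta> (f (y + t *\<^sub>R v))" "\<lambda>t. c1 * \<phi> (d t) + c2 * \<beta> (d t)"] gd by auto
      then show ?thesis
        by (intro bexI[of _ t]) (auto simp: v_def \<phi>_simps \<beta>_simps algebra_simps)
    qed
    obtain t1 where t1: "t1 \<in> {0..1}" "\<phi> (f x - f y) = \<phi> (d t1)" using mv[of 1 0] by auto
    obtain t2 where t2: "t2 \<in> {0..1}" "s * \<kappa> * \<phi> (f x - f y) + 1 * \<beta> (f x - f y) = s * \<kappa> * \<phi> (d t2) + 1 * \<beta> (d t2)" using mv[of "s * \<kappa>" 1] by blast
    obtain t3 where t3: "t3 \<in> {0..1}" "s * \<kappa> * \<phi> (f x - f y) + (-1) * \<beta> (f x - f y) = s * \<kappa> * \<phi> (d t3) + (-1) * \<beta> (d t3)" using mv[of "s * \<kappa>" "-1"] by blast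
    have sk: "s * \<kappa> * \<phi> (d t) = \<kappa> * \<bar>\<phi> (d t)\<bar>" if "t \<in> {0..1}" for t
      using s(1) s(2)[OF that] by auto
    have "\<bar>\<beta> (f x - f y)\<bar> < s * \<kappa> * \<phi> (f x - f y)"
    proof -
      have "- \<beta> (d t2) < \<kappa> * \<bar>\<phi> (d t2)\<bar>" "\<beta> (d t3) < \<kappa> * \<bar>\<phi> (d t3)\<bar>"
        using d(1)[of t2] d(1)[of t3] by auto
      then have "- \<beta> (f x - f y) < s * \<kappa> * \<phi> (f x - f y)" "\<beta> (f x - f y) < s * \<kappa> * \<phi> (f x - f y)"
        using t2(2) t3(2) unfolding sk[OF t2(1)] sk[OF t3(1)] by linarith+
      then show ?thesis by (simp add: abs_less_iff)
    qed
    also have "s * \<kappa> * \<phi> (f x - f y) = \<kappa> * \<bar>\<phi> (f x - f y)\<bar>"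
      using sk[OF t1(1)] t1(2) by simp
    finally show ?thesis using t1 d(2)[of t1] by (simp add: CC_def v_def)
  qed
  then show "CC (f x - f y)" "K * \<bar>\<phi> (x - y)\<bar> \<le> \<bar>\<phi> (f x - f y)\<bar>" by auto
qed

text \<open>The direction \<open>x - y\<close> is the same along the whole segment, so the rate
  \<open>K1\<close> bounds the speed of the image curve throughout.\<close>

lemma noncone_f:
  assumes "\<not> \<bar>\<beta> (x - y)\<bar> < \<kappa> * \<bar>\<phi> (x - y)\<bar>"
  shows "norm (f x - f y) \<le> K1 * norm (x - y)"
proof -
  have "norm (f (y + 1 *\<^sub>R (x - y)) - f (y + 0 *\<^sub>R (x - y))) \<le> 1 * (K1 * norm (x - y)) - 0 * (K1 * norm (x - y))"
  proof (rule differentiable_bound_general)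
    show "continuous_on {0..1} (\<lambda>t. f (y + t *\<^sub>R (x - y)))"
      by (intro continuous_on_compose2[OF f_cont] continuous_intros) auto
    show "((\<lambda>t. f (y + t *\<^sub>R (x - y))) has_vector_derivative (D (y + t *\<^sub>R (x - y))) (x - y)) (at t)" for t
      by (rule line_deriv)
    show "((\<lambda>t. t * (K1 * norm (x - y))) has_vector_derivative K1 * norm (x - y)) (at t)" for t
      by (auto intro!: derivative_eq_intros)
    show "norm ((D (y + t *\<^sub>R (x - y))) (x - y)) \<le> K1 * norm (x - y)" for t
      using noncone assms by blast
  qed (auto intro!: continuous_intros)
  then show ?thesis by simp
qed

text \<open>\<open>k'\<close> is \<open>M\<close> applied \<open>n\<close> times to
  \<open>k\<close>; what is recorded about it is its integrality and its
  \<open>\<phi>\<close>-value, which gains a factor \<open>m\<close> at each step.\<close>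

lemma fpow_shift:
  assumes "int_vec k"
  obtains k' where "int_vec k'" "\<And>x. (f ^^ n) (x + k) = (f ^^ n) x + k'" "\<phi> k' = m ^ n * \<phi> k"
proof -
  have "\<exists>k'. int_vec k' \<and> (\<forall>x. (f ^^ n) (x + k) = (f ^^ n) x + k') \<and> \<phi> k' = m ^ n * \<phi> k"
  proof (induction n)
    case 0 then show ?case using assms by (intro exI[of _ k]) auto
  next
    case (Suc n)
    then obtain k' where k': "int_vec k'" "\<And>x. (f ^^ n) (x + k) = (f ^^ n) x + k'" "\<phi> k' = m ^ n * \<phi> k" by blast
    show ?case
      by (rule exI[of _ "M *v k'"]) (use k' M_int in \<open>auto simp: f_shift \<phi>_M int_vec_mult\<close>)
  qed
  then show ?thesis using that by blast
qed

section \<open>The semiconjugacy to multiplication by m\<close>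


text \<open>\<open>H\<close> is to be the limit of \<open>\<phi> ((f ^^ n) x) / m ^ n\<close>.
  Summing increments makes the convergence uniform by a geometric majorant, since one step of
  \<open>f\<close> violates \<open>\<phi> (f x) = m * \<phi> x\<close> by at most
  \<open>B\<close>.\<close>

definition Hd :: "nat \<Rightarrow> real^2 \<Rightarrow> real" where
  "Hd n x = \<phi> ((f ^^ Suc n) x) / m ^ Suc n - \<phi> ((f ^^ n) x) / m ^ n"

definition H :: "real^2 \<Rightarrow> real" where
  "H x = \<phi> x + (\<Sum>n. Hd n x)"

lemma Hd_bound: "\<bar>Hd n x\<bar> \<le> B * (1/2) ^ Suc n"
proof -
  have "Hd n x = (\<phi> (f ((f ^^ n) x)) - m * \<phi> ((f ^^ n) x)) / m ^ Suc n"
    using m_nz by (simp add: Hd_def diff_divide_distrib)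
  then have "\<bar>Hd n x\<bar> = \<bar>\<phi> (f ((f ^^ n) x)) - m * \<phi> ((f ^^ n) x)\<bar> / \<bar>m ^ Suc n\<bar>" by (simp add: abs_divide)
  also have "\<dots> \<le> B / 2 ^ Suc n"
    by (intro frac_le \<phi>_f B_nonneg m_pow) auto
  finally show ?thesis by (simp add: field_simps)
qed

lemma Hd_summable: "summable (\<lambda>n. B * (1/2::real) ^ Suc n)"
  using summable_mult[OF summable_geometric[of "1/2::real"], of "B / 2"] by simp

lemma Hd_uniform: "uniform_limit UNIV (\<lambda>n x. \<Sum>i<n. Hd i x) (\<lambda>x. \<Sum>i. Hd i x) sequentially"
  by (rule Weierstrass_m_test[OF _ Hd_summable]) (simp add: Hd_bound del: power_Suc)

lemma Hd_sum: "(\<Sum>i<n. Hd i x) = \<phi> ((f ^^ n) x) / m ^ n - \<phi> x"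
  by (induction n) (auto simp: Hd_def)

lemma fpow_cont: "continuous_on UNIV (f ^^ n)"
  by (induction n) (auto simp: id_def intro!: continuous_on_compose2[OF f_cont])

lemma H_cont: "continuous_on A H"
proof -
  have "continuous_on UNIV (\<lambda>x. \<Sum>i. Hd i x)"
  proof (rule uniform_limit_theorem[OF _ Hd_uniform])
    show "\<forall>\<^sub>F n in sequentially. continuous_on UNIV (\<lambda>x. \<Sum>i<n. Hd i x)"
      unfolding Hd_sum
      by (intro always_eventually allI continuous_on_diff continuous_on_divide continuous_on_const
          \<phi>.continuous_on fpow_cont continuous_on_id) (simp add: m_nz)
  qed simp
  then show ?thesis unfolding H_def
    by (intro continuous_on_add \<phi>_cont) (auto intro: continuous_on_subset)
qed

lemma H_lim: "(\<lambda>n. \<phi> ((f ^^ n) x) / m ^ n) \<longlonglongrightarrow> H x"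
proof -
  have "(\<lambda>n. (\<Sum>i<n. Hd i x) + \<phi> x) \<longlonglongrightarrow> (\<Sum>i. Hd i x) + \<phi> x"
    by (intro tendsto_intros tendsto_uniform_limitI[OF Hd_uniform]) auto
  then show ?thesis by (simp add: Hd_sum H_def add.commute)
qed

lemma H_f: "H (f x) = m * H x"
proof (rule LIMSEQ_unique[OF H_lim])
  have "(\<lambda>n. m * (\<phi> ((f ^^ Suc n) x) / m ^ Suc n)) \<longlonglongrightarrow> m * H x"
    by (intro tendsto_intros LIMSEQ_Suc[OF H_lim])
  moreover have "m * (\<phi> ((f ^^ Suc n) x) / m ^ Suc n) = \<phi> ((f ^^ n) (f x)) / m ^ n" for n
    using m_nz by (simp add: funpow_swap1)
  ultimately show "(\<lambda>n. \<phi> ((f ^^ n) (f x)) / m ^ n) \<longlonglongrightarrow> m * H x" by simp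
qed

lemma H_bound: "\<bar>H x - \<phi> x\<bar> \<le> B"
proof (rule LIMSEQ_le_const2[where X="\<lambda>n. \<bar>\<phi> ((f ^^ n) x) / m ^ n - \<phi> x\<bar>"])
  show "(\<lambda>n. \<bar>\<phi> ((f ^^ n) x) / m ^ n - \<phi> x\<bar>) \<longlonglongrightarrow> \<bar>H x - \<phi> x\<bar>"
    by (intro tendsto_intros H_lim)
  have "\<bar>\<phi> ((f ^^ n) x) / m ^ n - \<phi> x\<bar> \<le> B" for n
  proof -
    have "\<bar>\<Sum>i<n. Hd i x\<bar> \<le> (\<Sum>i<n. B * (1/2) ^ Suc i)"
      by (rule sum_abs[THEN order_trans]) (intro sum_mono Hd_bound)
    also have "\<dots> = B * (1 - (1/2)^n)"
      by (induction n) (auto simp: algebra_simps)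
    also have "\<dots> \<le> B * 1" using B_nonneg by (intro mult_left_mono) auto
    finally show ?thesis by (simp add: Hd_sum)
  qed
  then show "\<exists>N. \<forall>n\<ge>N. \<bar>\<phi> ((f ^^ n) x) / m ^ n - \<phi> x\<bar> \<le> B" by blast
qed

lemma H_shift: "int_vec k \<Longrightarrow> H (x + k) = H x + \<phi> k"
proof -
  assume k: "int_vec k"
  show ?thesis
  proof (rule LIMSEQ_unique[OF H_lim])
    have "\<phi> ((f ^^ n) (x + k)) / m ^ n = \<phi> ((f ^^ n) x) / m ^ n + \<phi> k" for n
    proof -
      obtain k' where "int_vec k'" "\<And>x. (f ^^ n) (x + k) = (f ^^ n) x + k'" "\<phi> k' = m ^ n * \<phi> k"
        using fpow_shift[OF k] by blast
      then show ?thesis using m_nz by (simp add: \<phi>_simps add_divide_distrib)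
    qed
    then show "(\<lambda>n. \<phi> ((f ^^ n) (x + k)) / m ^ n) \<longlonglongrightarrow> H x + \<phi> k"
      using tendsto_add[OF H_lim tendsto_const] by simp
  qed
qed

section \<open>Deck maps and fibres\<close>


lemma H_fpow: "H ((f ^^ n) x) = m ^ n * H x"
  by (induction n) (auto simp: H_f)

lemma fpow_CC:
  assumes "CC (x - y)"
  shows "CC ((f ^^ n) x - (f ^^ n) y) \<and> K ^ n * \<bar>\<phi> (x - y)\<bar> \<le> \<bar>\<phi> ((f ^^ n) x - (f ^^ n) y)\<bar>"
proof (induction n)
  case 0 then show ?case using assms by simp
next
  case (Suc n)
  have "K * (K ^ n * \<bar>\<phi> (x - y)\<bar>) \<le> K * \<bar>\<phi> ((f ^^ n) x - (f ^^ n) y)\<bar>"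
    using Suc K by (intro mult_left_mono) auto
  then show ?case
    using cone_f[of "(f ^^ n) x" "(f ^^ n) y"] Suc by auto
qed

text \<open>Iterates of two points of one fibre stay on common fibres, where \<open>\<phi>\<close>
  differs by at most \<open>2 * B\<close>, whereas a nonzero cone difference is stretched by
  \<open>K ^ n\<close>. So each fibre is a Lipschitz graph over \<open>\<beta>\<close>.\<close>

lemma H_CC_eq:
  assumes "H x = H y" "CC (x - y)"
  shows "x = y"
proof (rule ccontr)
  assume "x \<noteq> y"
  then have pos: "\<bar>\<phi> (x - y)\<bar> > 0" using CC_\<phi>_zero[OF assms(2)] by auto
  obtain n where n: "2 * B / \<bar>\<phi> (x - y)\<bar> < K ^ n" using real_arch_pow[OF K] by blast
  have "\<bar>\<phi> ((f ^^ n) x - (f ^^ n) y)\<bar> \<le> 2 * B"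
    using H_bound[of "(f ^^ n) x"] H_bound[of "(f ^^ n) y"] assms(1) by (simp add: H_fpow \<phi>_simps)
  then have "K ^ n * \<bar>\<phi> (x - y)\<bar> \<le> 2 * B" using fpow_CC[OF assms(2), of n] by linarith
  then show False using n pos by (simp add: field_simps)
qed

text \<open>The lifts to the plane of the \<open>n\<close>-th iterate of the torus map. The number
  \<open>n\<close> is an argument because all growth estimates depend on it.\<close>

definition deck :: "nat \<Rightarrow> (real^2 \<Rightarrow> real^2) \<Rightarrow> bool" where
  "deck n S \<longleftrightarrow> (\<exists>k. int_vec k \<and> S = (\<lambda>x. (f ^^ n) x + k))"

lemma deckI: "int_vec k \<Longrightarrow> deck n (\<lambda>x. (f ^^ n) x + k)"
  unfolding deck_def by blast

lemma deck_id: "deck 0 id"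
  unfolding deck_def by (rule exI[of _ 0]) auto

lemma deck_comp: "deck n S \<Longrightarrow> deck n' S' \<Longrightarrow> deck (n + n') (S \<circ> S')"
proof -
  assume "deck n S" "deck n' S'"
  then obtain k k' where k: "int_vec k" "S = (\<lambda>x. (f ^^ n) x + k)" "int_vec k'" "S' = (\<lambda>x. (f ^^ n') x + k')"
    unfolding deck_def by blast
  obtain k'' where k'': "int_vec k''" "\<And>x. (f ^^ n) (x + k') = (f ^^ n) x + k''"
    using fpow_shift[OF k(3)] by metis
  show ?thesis unfolding deck_def
    by (rule exI[of _ "k'' + k"]) (use k k'' in \<open>auto simp: funpow_add fun_eq_iff\<close>)
qed

lemma deck_pow: "deck n S \<Longrightarrow> deck (n * i) (S ^^ i)"
proof (induction i)
  case 0 then show ?case using deck_id by (simp add: id_def)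
next
  case (Suc i) then show ?case using deck_comp[of n S "n * i" "S ^^ i"] by (simp add: o_def)
qed

lemma deck_H: "deck n S \<Longrightarrow> H (S x) - H (S y) = m ^ n * (H x - H y)"
  unfolding deck_def by (auto simp: H_shift H_fpow right_diff_distrib)

lemma deck_H': "deck n S \<Longrightarrow> S p = q \<Longrightarrow> H (S x) = H q + m ^ n * (H x - H p)"
  using deck_H[of n S x p] by simp

lemma deck_CC: "deck n S \<Longrightarrow> CC (x - y) \<Longrightarrow> CC (S x - S y) \<and> K ^ n * \<bar>\<phi> (x - y)\<bar> \<le> \<bar>\<phi> (S x - S y)\<bar>"
  unfolding deck_def using fpow_CC by fastforce

lemma deck_cont: "deck n S \<Longrightarrow> continuous_on A S"
  unfolding deck_def by (auto intro!: continuous_intros continuous_on_subset[OF fpow_cont])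

text \<open>Cones are forward invariant, so a difference outside the cone at time \<open>n\<close>
  has been outside at all earlier times, and each step costs at most a factor
  \<open>K1\<close>.\<close>

lemma fpow_notCC:
  assumes "\<not> CC ((f ^^ n) x - (f ^^ n) y)"
  shows "norm ((f ^^ n) x - (f ^^ n) y) \<le> K1 ^ n * norm (x - y)"
  using assms
proof (induction n)
  case 0 then show ?case by simp
next
  case (Suc n)
  have 1: "\<not> CC ((f ^^ n) x - (f ^^ n) y)" using Suc.prems cone_f(1) by auto
  have "norm ((f ^^ Suc n) x - (f ^^ Suc n) y) \<le> K1 * norm ((f ^^ n) x - (f ^^ n) y)"
    using noncone_f[of "(f ^^ n) x" "(f ^^ n) y"] 1 unfolding CC_def by simp
  also have "\<dots> \<le> K1 * (K1 ^ n * norm (x - y))" using Suc.IH[OF 1] K1 by (intro mult_left_mono) auto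
  finally show ?case by (simp add: mult.assoc)
qed

lemma deck_notCC:
  assumes "deck n S" "\<not> CC (S x - S y)"
  shows "norm (S x - S y) \<le> K1 ^ n * norm (x - y)"
  using assms fpow_notCC unfolding deck_def by fastforce

text \<open>Images of a fibre lie in a fibre, so the difference of the images is either zero or
  outside the cone, where the rate \<open>K1\<close> applies.\<close>

lemma deck_fibre:
  assumes "deck n S" "H x = H y"
  shows "norm (S x - S y) \<le> K1 ^ n * norm (x - y)"
proof (cases "CC (S x - S y)")
  case True
  have "S x = S y" using H_CC_eq[OF _ True] deck_H[OF assms(1), of x y] assms(2) by simp
  then show ?thesis using K1 by simp
qed (use deck_notCC assms in auto)

section \<open>Global coordinates \<open>(H, \<beta>)\<close> on the plane, and surjectivity\<close>

definition H\<beta> :: "real^2 \<Rightarrow> real \<times> real" where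
  "H\<beta> x = (H x, \<beta> x)"

definition X :: "real \<Rightarrow> real \<Rightarrow> real^2" where
  "X t b = inv H\<beta> (t, b)"

text \<open>Two points with equal \<open>\<beta>\<close> differ by a multiple of \<open>w\<close>, a
  cone vector, so \<open>H\<close> separates them. On a line in direction \<open>w\<close>,
  \<open>H\<close> stays within \<open>B\<close> of \<open>\<phi>\<close> and therefore takes every
  value.\<close>

lemma bij_H\<beta>: "bij H\<beta>"
proof (rule bijI)
  show "inj H\<beta>"
    by (rule injI) (auto simp: H\<beta>_def \<beta>_simps intro!: H_CC_eq CC_w)
  show "surj H\<beta>"
  proof (clarsimp simp: surj_def)
    fix t b :: real
    define c where "c s = b *\<^sub>R k1 + s *\<^sub>R w" for s
    have c: "\<phi> (c s) = s" "\<beta> (c s) = b" for s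
      by (auto simp: c_def \<phi>_simps \<beta>_simps k1 w)
    have "\<exists>s \<ge> t - B. s \<le> t + B \<and> H (c s) = t"
    proof (rule IVT')
      show "H (c (t - B)) \<le> t" "t \<le> H (c (t + B))"
        using H_bound[of "c (t - B)"] H_bound[of "c (t + B)"] by (auto simp: c abs_le_iff)
      show "continuous_on {t - B..t + B} (\<lambda>s. H (c s))"
        unfolding c_def by (intro continuous_on_compose2[OF H_cont[of UNIV]] continuous_intros) auto
    qed (use B_nonneg in auto)
    then obtain s where "H (c s) = t" by blast
    then show "\<exists>x. (t, b) = H\<beta> x" using c(2)[of s] by (auto simp: H\<beta>_def)
  qed
qed

lemma HX [simp]: "H (X t b) = t" and \<beta>X [simp]: "\<beta> (X t b) = b"
  using bij_H\<beta> surj_f_inv_f[of H\<beta> "(t, b)"] unfolding X_def by (auto simp: bij_def H\<beta>_def)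

lemma X_eq: "H x = t \<Longrightarrow> \<beta> x = b \<Longrightarrow> X t b = x"
  using bij_H\<beta> inv_f_f[of H\<beta> x] unfolding X_def by (auto simp: bij_def H\<beta>_def)

lemma H\<beta>_cont: "continuous_on A H\<beta>"
  unfolding H\<beta>_def by (intro continuous_on_Pair H_cont \<beta>_cont)

lemma inv_H\<beta>_cont: "continuous_on UNIV (inv H\<beta>)"
proof -
  obtain g where g: "homeomorphism UNIV (H\<beta> ` UNIV) H\<beta> g"
    using invariance_of_domain_homeomorphism[of UNIV H\<beta>] H\<beta>_cont bij_H\<beta>
    by (auto simp: bij_def)
  have "g = inv H\<beta>"
    proof (rule ext)
    fix y
    obtain x where "y = H\<beta> x" using bij_H\<beta> by (meson bij_def surjD)
    then show "g y = inv H\<beta> y"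
      using g bij_H\<beta> by (auto simp: homeomorphism_def bij_def)
  qed
  moreover have "H\<beta> ` UNIV = UNIV" using bij_H\<beta> by (auto simp: bij_def)
  ultimately show ?thesis using g by (simp add: homeomorphism_def)
qed

lemma X_cont:
  assumes "continuous_on A s" "continuous_on A t"
  shows "continuous_on A (\<lambda>x. X (s x) (t x))"
  unfolding X_def by (intro continuous_on_compose2[OF inv_H\<beta>_cont] continuous_on_Pair assms) auto

lemma X_tendsto: "(s \<longlongrightarrow> a) F \<Longrightarrow> (t \<longlongrightarrow> b) F \<Longrightarrow> ((\<lambda>x. X (s x) (t x)) \<longlongrightarrow> X a b) F"
  unfolding X_def
  by (rule continuous_on_tendsto_compose[OF inv_H\<beta>_cont, of _ "(a, b)"]) (auto intro: tendsto_Pair)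

lemma X_shift: "X t (b + real_of_int j) = X t b + real_of_int j *\<^sub>R k1"
  by (rule X_eq) (auto simp: \<beta>_simps H_shift int_vec_scaleR k1 \<phi>_simps)

lemma H_uniform: "\<exists>d>0. \<forall>x y. norm (x - y) < d \<longrightarrow> \<bar>H x - H y\<bar> < e" if "e > 0" for e
proof -
  \<comment> \<open>\<open>H x - H y\<close> does not change when both points move by the same
    integer vector. With \<open>x\<close> in the unit square and \<open>y\<close> within distance 1
    of it, the box from -2 to 2 contains both.\<close>
  have "uniformly_continuous_on {x :: real^2. x \<in> cbox (-2) 2} H"
    by (rule compact_uniformly_continuous[OF H_cont]) simp
  then obtain d where d: "d > 0" "\<And>x y. x \<in> cbox (-2) 2 \<Longrightarrow> y \<in> cbox (-2) 2 \<Longrightarrow> dist x y < d \<Longrightarrow> dist (H x) (H y) < e"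
    unfolding uniformly_continuous_on_def using \<open>e > 0\<close> by (metis (no_types, lifting) mem_Collect_eq dist_commute)
  show ?thesis
  proof (intro exI[of _ "min d 1"] conjI allI impI)
    show "0 < min d 1" using d by auto
    fix x y :: "real^2" assume xy: "norm (x - y) < min d 1"
    define k :: "real^2" where "k = (\<chi> i. - real_of_int \<lfloor>x $ i\<rfloor>)"
    have k: "int_vec k" by (auto simp: k_def int_vec_def)
    have bx: "0 \<le> (x + k) $ i" "(x + k) $ i \<le> 1" for i
      by (auto simp: k_def) linarith
    have by_: "\<bar>(x + k) $ i - (y + k) $ i\<bar> \<le> 1" for i
      using component_le_norm_cart[of "x - y" i] xy by auto
    have "x + k \<in> cbox (-2) 2" "y + k \<in> cbox (-2) 2"
      unfolding mem_box_cart using bx by_ by (auto, (smt (verit))+)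
    then have "dist (H (x + k)) (H (y + k)) < e"
      by (rule d(2)) (use xy in \<open>auto simp: dist_norm\<close>)
    then show "\<bar>H x - H y\<bar> < e" by (simp add: H_shift[OF k] dist_real_def)
  qed
qed

text \<open>On a fibre \<open>H = s\<close> the map commutes with the translation by \<^term>\<open>k1\<close>, so in the
  coordinate \<open>\<beta>\<close> it is a continuous map of the line of degree one.\<close>

lemma f_surj: "\<exists>x. f x = y"
proof -
  define s where "s = H y / m"
  define g where "g b = \<beta> (f (X s b))" for b
  have shift: "g (b + real_of_int j) = g b + real_of_int j" for b j
  proof -
    have "f (x + real_of_int j *\<^sub>R k1) = f x + real_of_int j *\<^sub>R k1" for x
      using f_shift[of "real_of_int j *\<^sub>R k1" x] k1
      by (simp add: int_vec_scaleR matrix_vector_mult_scaleR)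
    then show ?thesis by (simp add: g_def X_shift \<beta>_simps k1)
  qed
  have "\<exists>b \<ge> real_of_int \<lfloor>\<beta> y - g 0\<rfloor>. b \<le> real_of_int (\<lfloor>\<beta> y - g 0\<rfloor> + 1) \<and> g b = \<beta> y"
  proof (rule IVT')
    show "g (real_of_int \<lfloor>\<beta> y - g 0\<rfloor>) \<le> \<beta> y" "\<beta> y \<le> g (real_of_int (\<lfloor>\<beta> y - g 0\<rfloor> + 1))"
      using shift[of 0 "\<lfloor>\<beta> y - g 0\<rfloor>"] shift[of 0 "\<lfloor>\<beta> y - g 0\<rfloor> + 1"] by (simp_all, linarith+)
    show "continuous_on {real_of_int \<lfloor>\<beta> y - g 0\<rfloor>..real_of_int (\<lfloor>\<beta> y - g 0\<rfloor> + 1)} g"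
      unfolding g_def
      by (intro continuous_on_compose2[OF \<beta>_cont[of UNIV]] continuous_on_compose2[OF f_cont] X_cont continuous_intros) auto
  qed auto
  then obtain b where b: "g b = \<beta> y" by blast
  have "f (X s b) = y"
    using X_eq[of "f (X s b)" "H y" "\<beta> y"] X_eq[of y "H y" "\<beta> y"] b m_nz by (auto simp: g_def H_f s_def)
  then show ?thesis by blast
qed

lemma deck_surj: "deck n S \<Longrightarrow> \<exists>x. S x = y"
proof -
  assume "deck n S"
  then obtain k where k: "S = (\<lambda>x. (f ^^ n) x + k)" unfolding deck_def by blast
  have "\<exists>x. (f ^^ n) x = y" for y
  proof (induction n arbitrary: y)
    case (Suc n) then show ?case using f_surj[of y] by (metis comp_apply funpow.simps(2))
  qed auto
  then show ?thesis unfolding k by (metis diff_add_cancel)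
qed

end

section \<open>The torus\<close>

lemma torus_emb_cont: "continuous_on A torus_emb"
  unfolding torus_emb_def by (intro continuous_intros)

lemma cis_add_2pi_int: "cis (t + 2 * pi * of_int n) = cis t"
  by (metis cis_mult cis_multiple_2pi mult_1_right Ints_of_int)

lemma torus_emb_eq_iff: "torus_emb x = torus_emb y \<longleftrightarrow> int_vec (x - y)"
proof -
  have "cis (2 * pi * a) = cis (2 * pi * b) \<longleftrightarrow> a - b \<in> \<int>" for a b :: real
  proof
    assume "cis (2 * pi * a) = cis (2 * pi * b)"
    then have "cos (2 * pi * a) = cos (2 * pi * b)" "sin (2 * pi * a) = sin (2 * pi * b)"
      by (auto simp: complex_eq_iff)
    then obtain n :: int where "2 * pi * a = 2 * pi * b + 2 * pi * n"
      using sin_cos_eq_iff[of "2 * pi * a" "2 * pi * b"] by (auto simp: mult_ac)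
    then have "2 * pi * (a - b) = 2 * pi * n" by (simp add: algebra_simps)
    then show "a - b \<in> \<int>" by simp
  next
    assume "a - b \<in> \<int>"
    then obtain n where "a = b + of_int n" by (metis Ints_cases add.commute diff_add_cancel)
    then show "cis (2 * pi * a) = cis (2 * pi * b)" by (simp add: distrib_left cis_add_2pi_int)
  qed
  then show ?thesis unfolding torus_emb_def int_vec_def by (auto simp: forall_2)
qed

lemma torus_emb_shift: "int_vec k \<Longrightarrow> torus_emb (x + k) = torus_emb x"
  by (simp add: torus_emb_eq_iff)

lemma dist_cis: "dist (cis a) (cis b) = norm (cis (a - b) - 1)"
proof -
  have "cis a - cis b = cis b * (cis (a - b) - 1)" by (simp add: right_diff_distrib cis_mult)
  then show ?thesis by (simp add: dist_norm norm_mult)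
qed

text \<open>The covering of the circle by the line has local inverses with a modulus independent of
  the point. Fractional parts bring a sequence of counterexamples into the compact unit
  interval.\<close>

lemma cis_near:
  assumes "e > 0"
  shows "\<exists>d>0. \<forall>a. norm (cis (2 * pi * a) - 1) < d \<longrightarrow> (\<exists>j::int. \<bar>a - j\<bar> < e)"
proof (rule ccontr)
  assume "\<not> ?thesis"
  then have "\<forall>n. \<exists>a. norm (cis (2 * pi * a) - 1) < inverse (real (Suc n)) \<and> (\<forall>j::int. \<bar>a - j\<bar> \<ge> e)"
    by (meson inverse_positive_iff_positive not_less of_nat_0_less_iff zero_less_Suc)
  then obtain a where a: "\<And>n. norm (cis (2 * pi * a n) - 1) < inverse (real (Suc n))" "\<And>n j. \<bar>a n - real_of_int j\<bar> \<ge> e"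
    by metis
  define b where "b n = frac (a n)" for n
  have b: "cis (2 * pi * b n) = cis (2 * pi * a n)" "b n \<in> {0..1}" "\<And>j. \<bar>b n - real_of_int j\<bar> \<ge> e" for n
  proof -
    have "cis (2 * pi * a n) = cis (2 * pi * b n) * cis (2 * pi * of_int \<lfloor>a n\<rfloor>)"
      by (simp add: cis_mult b_def frac_def algebra_simps)
    then show "cis (2 * pi * b n) = cis (2 * pi * a n)" by (simp add: cis_multiple_2pi)
    show "b n \<in> {0..1}" using frac_lt_1[of "a n"] by (simp add: b_def less_imp_le)
    show "\<bar>b n - real_of_int j\<bar> \<ge> e" for j
      using a(2)[of n "\<lfloor>a n\<rfloor> + j"] by (simp add: b_def frac_def algebra_simps)
  qed
  obtain l r where lr: "l \<in> {0..1::real}" "strict_mono (r::nat\<Rightarrow>nat)" "(b \<circ> r) \<longlonglongrightarrow> l"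
    using compact_Icc[of "0::real" 1] b(2) unfolding compact_def by metis
  have "(\<lambda>n. cis (2 * pi * (b \<circ> r) n)) \<longlonglongrightarrow> cis (2 * pi * l)"
    by (intro tendsto_intros lr)
  moreover have "(\<lambda>n. cis (2 * pi * a n)) \<longlonglongrightarrow> 1"
    by (rule LIM_zero_cancel, rule tendsto_norm_zero_cancel, rule tendsto_sandwich[OF _ _ tendsto_const LIMSEQ_inverse_real_of_nat])
      (use a(1) in \<open>auto intro!: always_eventually less_imp_le\<close>)
  then have "((\<lambda>n. cis (2 * pi * a n)) \<circ> r) \<longlonglongrightarrow> 1" by (rule LIMSEQ_subseq_LIMSEQ[OF _ lr(2)])
  ultimately have "cis (2 * pi * l) = 1"
    using b(1) by (intro LIMSEQ_unique[of "\<lambda>n. cis (2 * pi * (b \<circ> r) n)"]) (auto simp: o_def)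
  then have "cos (2 * pi * l) = 1" by (simp add: complex_eq_iff)
  then obtain j :: int where "2 * pi * l = j * 2 * pi" using cos_one_2pi_int by auto
  then have "l = j" by simp
  moreover have "(\<lambda>n. \<bar>(b \<circ> r) n - real_of_int j\<bar>) \<longlonglongrightarrow> \<bar>l - j\<bar>" by (intro tendsto_intros lr)
  then have "e \<le> \<bar>l - j\<bar>" using b(3) by (intro LIMSEQ_le_const) auto
  ultimately show False using assms by simp
qed

lemma torus_emb_near:
  assumes "e > 0"
  shows "\<exists>d>0. \<forall>x y. dist (torus_emb x) (torus_emb y) < d \<longrightarrow> (\<exists>k. int_vec k \<and> norm (x + k - y) < e)"
proof -
  obtain d where d: "d > 0" "\<And>a. norm (cis (2 * pi * a) - 1) < d \<Longrightarrow> \<exists>j::int. \<bar>a - j\<bar> < e / 2"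
    using cis_near[of "e / 2"] assms by auto
  show ?thesis
  proof (intro exI[of _ d] conjI allI impI d(1))
    fix x y assume "dist (torus_emb x) (torus_emb y) < d"
    then have *: "dist (cis (2 * pi * x $ i)) (cis (2 * pi * y $ i)) < d" for i
      using exhaust_2[of i] dist_fst_le[of "torus_emb x" "torus_emb y"] dist_snd_le[of "torus_emb x" "torus_emb y"]
      by (auto simp: torus_emb_def)
    have "\<exists>j::int. \<bar>x $ i - y $ i - j\<bar> < e / 2" for i
      using d(2)[of "x $ i - y $ i"] *[of i] by (simp add: dist_cis right_diff_distrib)
    then obtain j where j: "\<And>i. \<bar>x $ i - y $ i - real_of_int (j i)\<bar> < e / 2" by metis
    define k :: "real^2" where "k = (\<chi> i. - real_of_int (j i))"
    have "norm (x + k - y) \<le> (\<Sum>i\<in>UNIV. \<bar>(x + k - y) $ i\<bar>)" by (rule norm_le_l1_cart)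
    also have "\<dots> = \<bar>x $ 1 - y $ 1 - real_of_int (j 1)\<bar> + \<bar>x $ 2 - y $ 2 - real_of_int (j 2)\<bar>"
      by (simp add: sum_2 k_def diff_diff_eq add.commute)
    also have "\<dots> < e" using j[of 1] j[of 2] by linarith
    finally show "\<exists>k. int_vec k \<and> norm (x + k - y) < e"
      by (intro exI[of _ k]) (auto simp: k_def int_vec_def)
  qed
qed

text \<open>Division by \<open>a\<close> reduces to the orbit of 1, whose angles are the fractional
  parts of multiples of \<open>\<rho>\<close>; Kronecker's theorem makes these dense.\<close>

lemma cis_orbit_near:
  assumes "\<rho> \<notin> \<rat>" "e > 0" "norm a = 1" "norm b = 1"
  shows "\<exists>i. norm (cis (2 * pi * \<rho>) ^ i * a - b) < e"
proof -
  obtain s where s: "b / a = cis s" using assms rcis_cmod_Arg[of "b / a"] by (metis div_by_1 norm_divide cis_rcis_eq)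
  define t where "t = frac (s / (2 * pi))"
  have st: "cis (2 * pi * t) = cis s"
  proof -
    have "s = 2 * pi * t + 2 * pi * of_int \<lfloor>s / (2 * pi)\<rfloor>" by (simp add: t_def frac_def algebra_simps)
    then have "cis s = cis (2 * pi * t) * cis (2 * pi * of_int \<lfloor>s / (2 * pi)\<rfloor>)" by (metis cis_mult)
    then show ?thesis by (simp add: cis_multiple_2pi)
  qed
  have "continuous_on UNIV (\<lambda>x. cis (2 * pi * x))" by (intro continuous_intros)
  then have "isCont (\<lambda>x. cis (2 * pi * x)) t" by (simp add: continuous_on_eq_continuous_at)
  then obtain d where d: "d > 0" "\<And>x. \<bar>x - t\<bar> < d \<Longrightarrow> dist (cis (2 * pi * x)) (cis (2 * pi * t)) < e"
    using assms(2) unfolding continuous_at_eps_delta dist_real_def by blast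
  obtain i where "\<bar>frac (real i * \<rho>) - t\<bar> < d"
    using Kronecker_approx_1_explicit[OF assms(1) _ _ d(1), of t] frac_lt_1[of "s / (2 * pi)"]
    by (auto simp: t_def less_imp_le)
  then have "dist (cis (2 * pi * frac (real i * \<rho>))) (cis (2 * pi * t)) < e" by (rule d(2))
  moreover have "cis (2 * pi * frac (real i * \<rho>)) = cis (2 * pi * \<rho>) ^ i"
  proof -
    have "real i * (2 * pi * \<rho>) = 2 * pi * frac (real i * \<rho>) + 2 * pi * of_int \<lfloor>real i * \<rho>\<rfloor>"
      by (simp add: frac_def algebra_simps)
    then have "cis (real i * (2 * pi * \<rho>)) = cis (2 * pi * frac (real i * \<rho>)) * cis (2 * pi * of_int \<lfloor>real i * \<rho>\<rfloor>)"
      by (metis cis_mult)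
    then show ?thesis by (simp only: cis_multiple_2pi[OF Ints_of_int] Complex.DeMoivre mult_1_right)
  qed
  ultimately have "norm (cis (2 * pi * \<rho>) ^ i - b / a) < e" by (simp add: st s dist_norm)
  moreover have "cis (2 * pi * \<rho>) ^ i * a - b = a * (cis (2 * pi * \<rho>) ^ i - b / a)"
    using assms(3) by (auto simp: field_simps)
  ultimately show ?thesis using assms(3) by (intro exI[of _ i]) (simp add: norm_mult)
qed

context cone_map begin

text \<open>The lift picked by the choice operator in \<open>torus_map\<close> differs from
  \<open>x\<close> by an integer vector, and \<open>f\<close> turns this into another integer vector
  because \<open>M\<close> is integral.\<close>

lemma torus_map_emb: "torus_map f (torus_emb x) = torus_emb (f x)"
proof -
  define y where "y = (SOME y. torus_emb y = torus_emb x)"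
  have "torus_emb y = torus_emb x" unfolding y_def by (rule someI) simp
  then have i: "int_vec (y - x)" by (simp add: torus_emb_eq_iff)
  have "f (x + (y - x)) = f x + M *v (y - x)" by (rule f_shift[OF i])
  then have "torus_emb (f y) = torus_emb (f x)"
    using int_vec_mult[OF M_int i] by (simp add: torus_emb_eq_iff)
  then show ?thesis unfolding torus_map_def y_def[symmetric] .
qed

lemma torus_map_pow_emb: "(torus_map f ^^ n) (torus_emb x) = torus_emb ((f ^^ n) x)"
  by (induction n) (auto simp: torus_map_emb)

lemma torus_map_surj: "torus_map f ` torus = torus"
proof
  show "torus_map f ` torus \<subseteq> torus" by (auto simp: torus_def torus_map_emb)
  show "torus \<subseteq> torus_map f ` torus"
  proof
    fix u assume "u \<in> torus"
    then obtain y where y: "u = torus_emb y" by (auto simp: torus_def)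
    obtain x where "f x = y" using f_surj by blast
    then have "u = torus_map f (torus_emb x)" by (simp add: y torus_map_emb)
    then show "u \<in> torus_map f ` torus" by (auto simp: torus_def)
  qed
qed

end

section \<open>The fibre of the quasiperiodic curve\<close>

text \<open>Expansivity of multiplication by \<open>a\<close> on the circle. An error below
  \<open>1 / (4 * \<bar>a\<bar>)\<close> is below \<open>1 / 4\<close> after one more
  multiplication, so the integer near the next iterate can only be \<open>a\<close> times the
  previous one. The orbit of \<open>r\<close> thus shadows that of the integer \<open>j0\<close>
  forever, which expansion permits only if they coincide.\<close>

lemma expanding_near_Ints:
  fixes a r :: real
  assumes a: "a \<in> \<int>" "2 \<le> \<bar>a\<bar>" and near: "\<And>i. \<exists>j::int. \<bar>a ^ i * r - j\<bar> < 1 / (4 * \<bar>a\<bar>)"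
  shows "r \<in> \<int>"
proof -
  obtain j0 :: int where j0: "\<bar>r - j0\<bar> < 1 / (4 * \<bar>a\<bar>)" using near[of 0] by auto
  have le: "1 / (4 * \<bar>a\<bar>) \<le> 1 / 4" using a by (simp add: field_simps)
  have small: "\<bar>a ^ i * (r - j0)\<bar> < 1 / (4 * \<bar>a\<bar>)" for i
  proof (induction i)
    case 0 then show ?case using j0 by simp
  next
    case (Suc i)
    obtain j1 :: int where j1: "\<bar>a ^ Suc i * r - j1\<bar> < 1 / (4 * \<bar>a\<bar>)" using near by blast
    obtain j2 :: int where j2: "a ^ Suc i * real_of_int j0 = j2"
      using a(1) by (metis Ints_cases Ints_mult Ints_of_int Ints_power)
    have "\<bar>a ^ Suc i * (r - j0)\<bar> = \<bar>a\<bar> * \<bar>a ^ i * (r - j0)\<bar>" by (simp add: abs_mult)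
    also have "\<dots> < \<bar>a\<bar> * (1 / (4 * \<bar>a\<bar>))" using Suc a by (intro mult_strict_left_mono) auto
    also have "\<dots> = 1 / 4" using a by auto
    finally have 1: "\<bar>a ^ Suc i * (r - j0)\<bar> < 1 / 4" .
    have 2: "a ^ Suc i * (r - j0) = a ^ Suc i * r - j2" using j2 by (simp add: right_diff_distrib)
    have "\<bar>real_of_int j1 - real_of_int j2\<bar> < 1" using 1 j1 le unfolding 2 by linarith
    then have "\<bar>real_of_int (j1 - j2)\<bar> < 1" by simp
    then have "j1 = j2" by linarith
    then show ?case using j1 2 by simp
  qed
  have "r = j0"
  proof (rule ccontr)
    assume "r \<noteq> j0"
    then have pos: "\<bar>r - j0\<bar> > 0" by simp
    obtain i where "1 / \<bar>r - j0\<bar> < \<bar>a\<bar> ^ i" using real_arch_pow[of "\<bar>a\<bar>"] a by auto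
    then have "1 < \<bar>a\<bar> ^ i * \<bar>r - j0\<bar>" using pos by (simp add: field_simps)
    then have "1 < \<bar>a ^ i * (r - j0)\<bar>" by (simp add: abs_mult power_abs)
    then show False using small[of i] le by linarith
  qed
  then show ?thesis by simp
qed

lemma Ints_add_iff: "d \<in> \<int> \<Longrightarrow> x + d \<in> \<int> \<longleftrightarrow> x \<in> (\<int> :: real set)"
  by (metis Ints_add Ints_diff add_diff_cancel_right')

context cone_map begin

text \<open>Transfers the rotation from the curve to lifts. The second conclusion is density of
  forward orbits in the fibre over \<open>c\<close>. In the third, \<open>y\<close> is hit exactly
  and the freedom lies in the starting point \<open>z\<close>, the form suited to forward images of
  open sets.\<close>

lemma quasiperiodic_fibre:
  assumes \<Gamma>: "\<Gamma> \<subseteq> torus" and p: "p \<ge> 1" and inv: "(torus_map f ^^ p) ` \<Gamma> = \<Gamma>"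
    and qp: "quasiperiodic_on (torus_map f ^^ p) \<Gamma>"
  obtains c where "\<exists>n G. n \<ge> 1 \<and> deck n G \<and> (\<forall>x. H x = c \<longrightarrow> H (G x) = c)"
    "\<And>x y e. H x = c \<Longrightarrow> H y = c \<Longrightarrow> e > 0 \<Longrightarrow> \<exists>n S. deck n S \<and> H (S x) = c \<and> norm (S x - y) < e"
    "\<And>x y e. H x = c \<Longrightarrow> H y = c \<Longrightarrow> e > 0 \<Longrightarrow> \<exists>n S z. deck n S \<and> H z = c \<and> norm (z - x) < e \<and> S z = y"
proof -
  define T where "T = torus_map f ^^ p"
  obtain h k \<rho> where \<rho>: "\<rho> \<notin> \<rat>" and hom: "homeomorphism \<Gamma> (sphere 0 1) h k"
    and conj: "\<And>y. y \<in> \<Gamma> \<Longrightarrow> h (T y) = cis (2 * pi * \<rho>) * h y"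
    using qp unfolding quasiperiodic_on_def T_def by blast
  have h\<Gamma>: "h y \<in> sphere 0 1" "k (h y) = y" if "y \<in> \<Gamma>" for y
    using hom that by (auto simp: homeomorphism_def)
  have kS: "k z \<in> \<Gamma>" "h (k z) = z" if "z \<in> sphere 0 1" for z
    using hom that by (auto simp: homeomorphism_def)
  have kcont: "continuous_on (sphere 0 1) k" and hcont: "continuous_on \<Gamma> h" using hom by (auto simp: homeomorphism_def)
  have T_pow: "(T ^^ i) (torus_emb x) = torus_emb ((f ^^ (p * i)) x)" for i x
    by (simp add: T_def funpow_mult torus_map_pow_emb mult.commute)
  have T_orb: "(T ^^ i) y \<in> \<Gamma> \<and> h ((T ^^ i) y) = cis (2 * pi * \<rho>) ^ i * h y" if "y \<in> \<Gamma>" for i y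
  proof (induction i)
    case (Suc i)
    then show ?case using conj[of "(T ^^ i) y"] inv by (auto simp: T_def)
  qed (use that in auto)
  have near: "\<exists>d>0. \<forall>x y. torus_emb x \<in> \<Gamma> \<longrightarrow> torus_emb y \<in> \<Gamma> \<longrightarrow> norm (h (torus_emb x) - h (torus_emb y)) < d \<longrightarrow>
       (\<exists>l. int_vec l \<and> norm (x + l - y) < e)" if "e > 0" for e
  proof -
    obtain d1 where d1: "d1 > 0" "\<And>x y. dist (torus_emb x) (torus_emb y) < d1 \<Longrightarrow> \<exists>l. int_vec l \<and> norm (x + l - y) < e"
      using torus_emb_near[OF \<open>e > 0\<close>] by blast
    have "uniformly_continuous_on (sphere 0 1) k" by (rule compact_uniformly_continuous[OF kcont]) simp
    then obtain d where d: "d > 0" "\<And>z z'. z \<in> sphere 0 1 \<Longrightarrow> z' \<in> sphere 0 1 \<Longrightarrow> dist z z' < d \<Longrightarrow> dist (k z) (k z') < d1"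
      unfolding uniformly_continuous_on_def using d1(1) by (metis dist_commute)
    show ?thesis
    proof (intro exI[of _ d] conjI allI impI d(1))
      fix x y assume "torus_emb x \<in> \<Gamma>" "torus_emb y \<in> \<Gamma>" "norm (h (torus_emb x) - h (torus_emb y)) < d"
      then show "\<exists>l. int_vec l \<and> norm (x + l - y) < e"
        using d(2)[of "h (torus_emb x)" "h (torus_emb y)"] h\<Gamma> d1(2)[of x y] by (simp add: dist_norm)
    qed
  qed
  \<comment> \<open>A rotation is an isometry, so points of the curve with close
    \<open>h\<close>-values stay close under all iterates of \<open>T\<close>. Hence
    \<open>H x - H y\<close> stays near integers under repeated multiplication by
    \<open>m ^ p\<close>.\<close>
  have "\<exists>d>0. \<forall>x y. torus_emb x \<in> \<Gamma> \<longrightarrow> torus_emb y \<in> \<Gamma> \<longrightarrow> norm (h (torus_emb x) - h (torus_emb y)) < d \<longrightarrow> H x - H y \<in> \<int>"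
  proof -
    define e0 where "e0 = 1 / (4 * \<bar>m ^ p\<bar>)"
    have e0: "e0 > 0" using m_nz by (simp add: e0_def)
    obtain d0 where d0: "d0 > 0" "\<And>x y. norm (x - y) < d0 \<Longrightarrow> \<bar>H x - H y\<bar> < e0" using H_uniform[OF e0] by blast
    obtain d where d: "d > 0" "\<And>x y. torus_emb x \<in> \<Gamma> \<Longrightarrow> torus_emb y \<in> \<Gamma> \<Longrightarrow> norm (h (torus_emb x) - h (torus_emb y)) < d \<Longrightarrow>
       \<exists>l. int_vec l \<and> norm (x + l - y) < d0" using near[OF d0(1)] by blast
    show ?thesis
    proof (intro exI[of _ d] conjI allI impI d(1))
      fix x y assume xy: "torus_emb x \<in> \<Gamma>" "torus_emb y \<in> \<Gamma>" "norm (h (torus_emb x) - h (torus_emb y)) < d"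
      show "H x - H y \<in> \<int>"
      proof (rule expanding_near_Ints[of "m ^ p"])
        show "m ^ p \<in> \<int>" by (rule m_pow)
        have "2 ^ 1 \<le> (2 ^ p :: real)" using p by (intro power_increasing) auto
        then show "2 \<le> \<bar>m ^ p\<bar>" using m_pow(2)[of p] by simp
        fix i
        let ?x = "(f ^^ (p * i)) x" and ?y = "(f ^^ (p * i)) y"
        have "torus_emb ?x \<in> \<Gamma>" "torus_emb ?y \<in> \<Gamma>"
          "h (torus_emb ?x) - h (torus_emb ?y) = cis (2 * pi * \<rho>) ^ i * (h (torus_emb x) - h (torus_emb y))"
          using T_orb[OF xy(1), of i] T_orb[OF xy(2), of i] by (simp_all add: T_pow right_diff_distrib)
        then obtain l where l: "int_vec l" "norm (?x + l - ?y) < d0"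
          using d(2)[of ?x ?y] xy(3) by (auto simp: norm_mult norm_power)
        obtain j :: int where j: "\<phi> l = j" using \<phi>_int[OF l(1)] by (auto elim: Ints_cases)
        have "\<bar>(m ^ p) ^ i * (H x - H y) - real_of_int (- j)\<bar> < e0"
        proof -
          have "H (?x + l) - H ?y = (m ^ p) ^ i * (H x - H y) + j"
            by (simp add: H_shift[OF l(1)] H_fpow j power_mult right_diff_distrib)
          then show ?thesis using d0(2)[OF l(2)] by simp
        qed
        then show "\<exists>j::int. \<bar>(m ^ p) ^ i * (H x - H y) - j\<bar> < 1 / (4 * \<bar>m ^ p\<bar>)"
          unfolding e0_def by blast
      qed
    qed
  qed
  then obtain d where d: "d > 0" "\<And>x y. torus_emb x \<in> \<Gamma> \<Longrightarrow> torus_emb y \<in> \<Gamma> \<Longrightarrow>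
      norm (h (torus_emb x) - h (torus_emb y)) < d \<Longrightarrow> H x - H y \<in> \<int>" by blast
  have "1 \<in> sphere (0::complex) 1" by simp
  then have "k 1 \<in> \<Gamma>" by (rule kS)
  then obtain x0 where x0: "torus_emb x0 \<in> \<Gamma>" using \<Gamma> by (auto simp: torus_def)
  define c where "c = H x0"
  \<comment> \<open>Modulo integers, \<open>H\<close> is locally constant along the curve, and the
    circle that parametrises it is connected. The argument runs on the circle through an arbitrary,
    possibly discontinuous lift \<open>L\<close> of \<open>k\<close>.\<close>
  have const: "H x - c \<in> \<int>" if x: "torus_emb x \<in> \<Gamma>" for x
  proof -
    define L where "L z = (SOME x. torus_emb x = k z)" for z
    have L: "torus_emb (L z) = k z" if "z \<in> sphere 0 1" for z
    proof -
      have "\<exists>x. torus_emb x = k z" using kS(1)[OF that] \<Gamma> by (metis imageE subsetD torus_def)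
      then show ?thesis unfolding L_def by (rule someI_ex)
    qed
    have "(H (L (h (torus_emb x))) - c \<in> \<int>) = (H (L (h (torus_emb x0))) - c \<in> \<int>)"
    proof (rule connected_local_const[of "sphere 0 1" "h (torus_emb x)" "h (torus_emb x0)" "\<lambda>z. H (L z) - c \<in> \<int>"])
      show "connected (sphere (0::complex) 1)" by (rule connected_sphere) simp
      show "\<forall>a\<in>sphere 0 1. \<forall>\<^sub>F b in at a within sphere 0 1. (H (L a) - c \<in> \<int>) = (H (L b) - c \<in> \<int>)"
      proof
        fix a :: complex assume a: "a \<in> sphere 0 1"
        show "\<forall>\<^sub>F b in at a within sphere 0 1. (H (L a) - c \<in> \<int>) = (H (L b) - c \<in> \<int>)"
          unfolding eventually_at
        proof (intro exI[of _ d] conjI ballI impI d(1))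
          fix b :: complex assume b: "b \<in> sphere 0 1" "b \<noteq> a \<and> dist b a < d"
          have "H (L a) - H (L b) \<in> \<int>"
            using d(2)[of "L a" "L b"] a b by (simp add: L kS dist_norm norm_minus_commute)
          then show "(H (L a) - c \<in> \<int>) = (H (L b) - c \<in> \<int>)"
            using Ints_add_iff[of "H (L a) - H (L b)" "H (L b) - c"] by simp
        qed
      qed
    qed (use h\<Gamma> x x0 in auto)
    moreover have "H y - H (L (h (torus_emb y))) \<in> \<int>" if "torus_emb y \<in> \<Gamma>" for y
    proof (rule d(2)[OF that])
      show "torus_emb (L (h (torus_emb y))) \<in> \<Gamma>" using h\<Gamma>[OF that] that by (simp add: L)
      show "norm (h (torus_emb y) - h (torus_emb (L (h (torus_emb y))))) < d"
        using h\<Gamma>[OF that] d(1) by (simp add: L)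
    qed
    from this[OF x] this[OF x0] have
      "(H x - c \<in> \<int>) = (H (L (h (torus_emb x))) - c \<in> \<int>)" "H (L (h (torus_emb x0))) - c \<in> \<int>"
      using Ints_add_iff[of "H x - H (L (h (torus_emb x)))" "H (L (h (torus_emb x))) - c"]
        Ints_minus[of "c - H (L (h (torus_emb x0)))"] by (auto simp: c_def)
    ultimately show ?thesis by simp
  qed
  \<comment> \<open>If the curve missed a point of the fibre, cutting the fibre there would make the
    curve homeomorphic to a compact interval \<open>A\<close>. Brouwer then yields a fixed point of
    \<open>T\<close>, which an irrational rotation does not have.\<close>
  have full: "torus_emb x \<in> \<Gamma>" if "H x = c" for x
  proof (rule ccontr)
    assume x_out: "torus_emb x \<notin> \<Gamma>"
    define b0 where "b0 = \<beta> x"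
    define E where "E b = torus_emb (X c b)" for b
    have E_int: "E (b + real_of_int j) = E b" for b j
      by (simp add: E_def X_shift torus_emb_shift int_vec_scaleR k1)
    have E_out: "E b0 \<notin> \<Gamma>" "E (b0 + 1) \<notin> \<Gamma>"
      using x_out E_int[of b0 1] X_eq[OF that refl] by (auto simp: E_def b0_def)
    \<comment> \<open>Points of one fibre that agree on the torus differ by an integer vector in the
      kernel of \<open>\<phi>\<close>, where \<open>\<beta>\<close> is integral.\<close>
    have E_eq: "b - b' \<in> \<int>" if "E b = E b'" for b b'
    proof -
      have i: "int_vec (X c b - X c b')" using that by (simp add: E_def torus_emb_eq_iff)
      have "\<phi> (X c b - X c b') = 0" using H_shift[OF i, of "X c b'"] by simp
      from kernel[OF i this] show ?thesis by (simp add: \<beta>_simps)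
    qed
    have E_cont: "continuous_on B E" for B
      unfolding E_def by (intro continuous_on_compose2[OF torus_emb_cont[of UNIV]] X_cont continuous_intros) auto
    have \<Gamma>k: "\<Gamma> = k ` sphere 0 1" using hom by (auto simp: homeomorphism_def)
    have "compact \<Gamma>" unfolding \<Gamma>k by (intro compact_continuous_image kcont) simp
    define A where "A = {b0..b0 + 1} \<inter> E -` \<Gamma>"
    have "closed A" unfolding A_def
      by (intro continuous_closed_preimage E_cont compact_imp_closed[OF \<open>compact \<Gamma>\<close>]) simp
    moreover have "bounded A" by (rule bounded_subset[of "{b0..b0 + 1}"]) (auto simp: A_def)
    ultimately have "compact A" by (simp add: compact_eq_bounded_closed)
    have "inj_on E A"
    proof (rule inj_onI)
      fix b b' assume b: "b \<in> A" "b' \<in> A" "E b = E b'"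
      then have "b - b' \<in> \<int>" by (intro E_eq)
      then obtain j :: int where j: "b - b' = j" by (auto elim: Ints_cases)
      have "b \<noteq> b0" "b \<noteq> b0 + 1" "b' \<noteq> b0" "b' \<noteq> b0 + 1" using b E_out by (auto simp: A_def)
      then have "\<bar>b - b'\<bar> < 1" using b(1,2) by (auto simp: A_def)
      then have "j = 0" unfolding j by linarith
      then show "b = b'" using j by simp
    qed
    have "E ` A = \<Gamma>"
    proof
      show "E ` A \<subseteq> \<Gamma>" by (auto simp: A_def)
      show "\<Gamma> \<subseteq> E ` A"
      proof
        fix y assume y: "y \<in> \<Gamma>"
        then obtain z where z: "y = torus_emb z" using \<Gamma> by (auto simp: torus_def)
        obtain j :: int where j: "H z - c = j" using const[of z] y z by (auto elim: Ints_cases)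
        define z' where "z' = z + (- real_of_int j) *\<^sub>R k2"
        have iv: "int_vec ((- real_of_int j) *\<^sub>R k2)" by (intro int_vec_scaleR k2) simp
        have z': "H z' = c" "torus_emb z' = y"
          unfolding z'_def H_shift[OF iv] torus_emb_shift[OF iv] \<phi>.scaleR k2 z using j by simp_all
        have Eb: "E (\<beta> z') = y" using X_eq[OF z'(1) refl] z'(2) by (simp add: E_def)
        define b where "b = b0 + frac (\<beta> z' - b0)"
        have "b = \<beta> z' + real_of_int (- \<lfloor>\<beta> z' - b0\<rfloor>)" by (simp add: b_def frac_def)
        then have "E b = y" using E_int Eb by metis
        moreover have "b \<in> {b0..b0 + 1}" using frac_lt_1[of "\<beta> z' - b0"] by (simp add: b_def less_imp_le)
        ultimately show "y \<in> E ` A" using y by (auto simp: A_def)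
      qed
    qed
    obtain q where q: "homeomorphism A \<Gamma> E q"
      using homeomorphism_compact[OF \<open>compact A\<close> E_cont \<open>E ` A = \<Gamma>\<close> \<open>inj_on E A\<close>] by blast
    then have qA: "q ` \<Gamma> = A" "continuous_on \<Gamma> q" "\<And>y. y \<in> \<Gamma> \<Longrightarrow> E (q y) = y" by (auto simp: homeomorphism_def)
    have "connected (k ` sphere 0 1)" by (intro connected_continuous_image kcont connected_sphere) simp
    then have "connected A"
      using connected_continuous_image[of \<Gamma> q] qA by (simp add: \<Gamma>k[symmetric])
    then have "convex A" by (simp add: is_interval_connected_1[symmetric] is_interval_convex_1[symmetric])
    have T_k: "T y = k (cis (2 * pi * \<rho>) * h y)" "T y \<in> \<Gamma>" if "y \<in> \<Gamma>" for y
    proof -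
      show "T y \<in> \<Gamma>" using inv that by (auto simp: T_def)
      from h\<Gamma>(2)[OF this] show "T y = k (cis (2 * pi * \<rho>) * h y)" using conj[OF that] by simp
    qed
    have "continuous_on \<Gamma> (\<lambda>y. k (cis (2 * pi * \<rho>) * h y))"
      by (intro continuous_on_compose2[OF kcont] continuous_intros hcont) (use h\<Gamma> in \<open>auto simp: norm_mult\<close>)
    then have T_cont: "continuous_on \<Gamma> T" using T_k(1) by (simp cong: continuous_on_cong)
    have T\<Gamma>: "T ` \<Gamma> \<subseteq> \<Gamma>" using T_k(2) by (intro image_subsetI)
    have "\<exists>b\<in>A. (q \<circ> T \<circ> E) b = b"
    proof (rule brouwer[OF \<open>compact A\<close> \<open>convex A\<close>])
      show "A \<noteq> {}" using \<open>E ` A = \<Gamma>\<close> x0 by auto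
      show "continuous_on A (q \<circ> T \<circ> E)"
        by (intro continuous_on_compose E_cont)
          (simp_all add: \<open>E ` A = \<Gamma>\<close> T_cont continuous_on_subset[OF qA(2) T\<Gamma>])
      show "q \<circ> T \<circ> E \<in> A \<rightarrow> A"
      proof
        fix b assume "b \<in> A"
        then have "T (E b) \<in> \<Gamma>" using \<open>E ` A = \<Gamma>\<close> T\<Gamma> by (metis imageI subsetD)
        then show "(q \<circ> T \<circ> E) b \<in> A" using qA(1) by (metis comp_apply imageI)
      qed
    qed blast
    then obtain b where b: "b \<in> A" "q (T (E b)) = b" by auto
    then have y: "E b \<in> \<Gamma>" using \<open>E ` A = \<Gamma>\<close> by auto
    then have "T (E b) = E b" using qA(3)[OF T_k(2)[OF y]] b(2) by simp
    then have "h (E b) = cis (2 * pi * \<rho>) * h (E b)" using conj[OF y] by simp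
    moreover have "h (E b) \<noteq> 0" using h\<Gamma>(1)[OF y] by auto
    ultimately have "cis (2 * pi * \<rho>) = 1" by simp
    then have "cos (2 * pi * \<rho>) = 1" by (simp add: complex_eq_iff)
    then obtain j :: int where "2 * pi * \<rho> = j * 2 * pi" using cos_one_2pi_int by auto
    then have "\<rho> = j" by simp
    then show False using \<rho> by simp
  qed
  \<comment> \<open>Within distance \<open>d1\<close> the values of \<open>H\<close> differ by less
    than 1, so an integer difference \<open>H z - c\<close> must vanish; this identifies the right
    lift in the approximations below.\<close>
  obtain d1 where d1: "d1 > 0" "\<And>x y. norm (x - y) < d1 \<Longrightarrow> \<bar>H x - H y\<bar> < 1" using H_uniform[of 1] by auto
  have near_c: "H z = c" if z: "torus_emb z \<in> \<Gamma>" "norm (z - x) < d1" and x: "H x = c" for x z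
  proof -
    obtain j :: int where j: "H z - c = j" using const[OF z(1)] by (auto elim: Ints_cases)
    then have "\<bar>real_of_int j\<bar> < 1" using d1(2)[OF z(2)] x by simp
    then have "j = 0" by linarith
    then show ?thesis using j by simp
  qed
  have orbit: "\<exists>i. norm (cis (2 * pi * \<rho>) ^ i * h (torus_emb x) - h (torus_emb y)) < d" if "H x = c" "H y = c" "d > 0" for x y d
    using cis_orbit_near[OF \<rho> \<open>d > 0\<close>, of "h (torus_emb x)" "h (torus_emb y)"] h\<Gamma>(1) full that by auto
  show ?thesis
  proof (rule that[of c])
    have "torus_emb ((f ^^ p) x0) \<in> \<Gamma>" using T_orb[OF x0, of 1] by (simp add: T_def torus_map_pow_emb)
    from const[OF this] have j: "m ^ p * c - c \<in> \<int>" by (simp add: H_fpow c_def)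
    define l where "l = (- (m ^ p * c - c)) *\<^sub>R k2"
    have l: "int_vec l" "\<phi> l = - (m ^ p * c - c)"
      using int_vec_scaleR[OF Ints_minus[OF j] k2(1)] by (simp_all add: l_def \<phi>_simps k2 \<phi>.scaleR)
    show "\<exists>n G. n \<ge> 1 \<and> deck n G \<and> (\<forall>x. H x = c \<longrightarrow> H (G x) = c)"
      by (rule exI[of _ p], rule exI[of _ "\<lambda>x. (f ^^ p) x + l"]) (use p in \<open>auto simp: deckI l H_shift H_fpow\<close>)
  next
    fix x y e assume xy: "H x = c" "H y = c" and e: "(e::real) > 0"
    obtain d2 where d2: "d2 > 0" "\<And>x y. torus_emb x \<in> \<Gamma> \<Longrightarrow> torus_emb y \<in> \<Gamma> \<Longrightarrow> norm (h (torus_emb x) - h (torus_emb y)) < d2 \<Longrightarrow>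
       \<exists>l. int_vec l \<and> norm (x + l - y) < min e d1" using near[of "min e d1"] e d1 by auto
    obtain i where i: "norm (cis (2 * pi * \<rho>) ^ i * h (torus_emb x) - h (torus_emb y)) < d2"
      using orbit[OF xy d2(1)] by blast
    have "torus_emb ((f ^^ (p * i)) x) \<in> \<Gamma>" and "h (torus_emb ((f ^^ (p * i)) x)) = cis (2 * pi * \<rho>) ^ i * h (torus_emb x)"
      using T_orb[OF full[OF xy(1)], of i] by (simp_all add: T_pow)
    then obtain l where l: "int_vec l" "norm ((f ^^ (p * i)) x + l - y) < min e d1"
      using d2(2)[of "(f ^^ (p * i)) x" y] i full[OF xy(2)] by auto
    show "\<exists>n S. deck n S \<and> H (S x) = c \<and> norm (S x - y) < e"
      using l near_c[of "(f ^^ (p * i)) x + l" y] xy(2) \<open>torus_emb ((f ^^ (p * i)) x) \<in> \<Gamma>\<close>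
      by (intro exI[of _ "p * i"] exI[of _ "\<lambda>x. (f ^^ (p * i)) x + l"]) (auto simp: deckI torus_emb_shift)
  next
    fix x y e assume xy: "H x = c" "H y = c" and e: "(e::real) > 0"
    obtain d2 where d2: "d2 > 0" "\<And>x y. torus_emb x \<in> \<Gamma> \<Longrightarrow> torus_emb y \<in> \<Gamma> \<Longrightarrow> norm (h (torus_emb x) - h (torus_emb y)) < d2 \<Longrightarrow>
       \<exists>l. int_vec l \<and> norm (x + l - y) < min e d1" using near[of "min e d1"] e d1 by auto
    obtain i where i: "norm (cis (2 * pi * \<rho>) ^ i * h (torus_emb x) - h (torus_emb y)) < d2"
      using orbit[OF xy d2(1)] by blast
    \<comment> \<open>The rotation is undone \<open>i\<close> times: the point over \<open>a\<close>
      lies near \<open>x\<close>, yet reaches \<open>y\<close> exactly after \<open>i\<close>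
      steps.\<close>
    define a where "a = h (torus_emb y) / cis (2 * pi * \<rho>) ^ i"
    have nz: "cis (2 * pi * \<rho>) ^ i \<noteq> 0" by simp
    have a: "a \<in> sphere 0 1" using h\<Gamma>(1)[OF full[OF xy(2)]] by (simp add: a_def norm_divide norm_power)
    obtain z0 where z0: "torus_emb z0 = k a" using kS(1)[OF a] \<Gamma> by (auto simp: torus_def)
    have "h (torus_emb x) - a = (cis (2 * pi * \<rho>) ^ i * h (torus_emb x) - h (torus_emb y)) / cis (2 * pi * \<rho>) ^ i"
      using nz by (simp add: a_def diff_divide_distrib)
    then have "norm (h (torus_emb x) - a) < d2" using i by (simp add: norm_divide norm_power)
    then obtain l where l: "int_vec l" "norm (z0 + l - x) < min e d1"
      using d2(2)[of z0 x] full[OF xy(1)] z0 kS[OF a] by (auto simp: norm_minus_commute)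
    define z where "z = z0 + l"
    have z: "torus_emb z = k a" "norm (z - x) < e" "norm (z - x) < d1" using l z0 by (auto simp: z_def torus_emb_shift)
    have "H z = c" using near_c[of z x] kS[OF a] z xy(1) by simp
    have "h ((T ^^ i) (torus_emb z)) = h (torus_emb y)" "(T ^^ i) (torus_emb z) \<in> \<Gamma>"
      using T_orb[of "torus_emb z" i] kS[OF a] z nz by (auto simp: a_def)
    then have "(T ^^ i) (torus_emb z) = torus_emb y" using h\<Gamma>(2) full[OF xy(2)] by metis
    then have "int_vec (y - (f ^^ (p * i)) z)" by (simp add: T_pow torus_emb_eq_iff[symmetric])
    then show "\<exists>n S z. deck n S \<and> H z = c \<and> norm (z - x) < e \<and> S z = y"
      using \<open>H z = c\<close> z(2)
      by (intro exI[of _ "p * i"] exI[of _ "\<lambda>x. (f ^^ (p * i)) x + (y - (f ^^ (p * i)) z)"] exI[of _ z]) (auto intro: deckI)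
  qed
qed

end

section \<open>Local inverses\<close>

text \<open>Strict differentiability of a C1 map, with both points free to vary: the mean value
  inequality for \<open>S\<close> minus its linear part at \<open>z\<close>.\<close>

lemma strict_derivative:
  fixes S :: "'a::euclidean_space \<Rightarrow> 'a"
  assumes der: "\<And>x. (S has_derivative blinfun_apply (S' x)) (at x)"
    and cont: "continuous_on UNIV S'" and "e > 0"
  shows "\<exists>d>0. (\<forall>x\<in>ball z d. norm (S' x - S' z) \<le> e) \<and>
     (\<forall>x\<in>ball z d. \<forall>y\<in>ball z d. norm (S x - S y - blinfun_apply (S' z) (x - y)) \<le> e * norm (x - y))"
proof -
  have "isCont S' z" using cont by (simp add: continuous_on_eq_continuous_at)
  then obtain d where d: "d > 0" "\<And>x. dist x z < d \<Longrightarrow> dist (S' x) (S' z) < e"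
    using \<open>e > 0\<close> unfolding continuous_at_eps_delta by metis
  have op: "norm (S' x - S' z) \<le> e" if "x \<in> ball z d" for x
    using d(2)[of x] that by (simp add: dist_norm norm_minus_commute)
  show ?thesis
  proof (intro exI[of _ d] conjI ballI d(1) op)
    fix x y assume xy: "x \<in> ball z d" "y \<in> ball z d"
    have "norm ((S x - blinfun_apply (S' z) x) - (S y - blinfun_apply (S' z) y)) \<le> e * norm (x - y)"
    proof (rule differentiable_bound[OF convex_ball _ _ xy])
      fix u assume "u \<in> ball z d"
      show "((\<lambda>x. S x - blinfun_apply (S' z) x) has_derivative blinfun_apply (S' u - S' z)) (at u within ball z d)"
        unfolding blinfun.diff_left
        by (intro has_derivative_diff has_derivative_at_withinI[OF der] bounded_linear.has_derivative[OF blinfun.bounded_linear_right] has_derivative_ident)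
      show "onorm (blinfun_apply (S' u - S' z)) \<le> e"
        using op[OF \<open>u \<in> ball z d\<close>] by (simp add: norm_blinfun.rep_eq)
    qed
    then show "norm (S x - S y - blinfun_apply (S' z) (x - y)) \<le> e * norm (x - y)"
      by (simp add: blinfun.diff_right algebra_simps)
  qed
qed

lemma strict_lower_bound:
  fixes S :: "'a::euclidean_space \<Rightarrow> 'a"
  assumes der: "\<And>x. (S has_derivative blinfun_apply (S' x)) (at x)"
    and cont: "continuous_on UNIV S'"
    and low: "\<And>v. a * norm v \<le> norm (blinfun_apply (S' z) v)" and a': "a' < a"
  shows "\<exists>d>0. (\<forall>x\<in>ball z d. \<forall>v. a' * norm v \<le> norm (blinfun_apply (S' x) v)) \<and>
     (\<forall>x\<in>ball z d. \<forall>y\<in>ball z d. a' * norm (x - y) \<le> norm (S x - S y))"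
proof -
  obtain d where d: "d > 0" "\<And>x. x \<in> ball z d \<Longrightarrow> norm (S' x - S' z) \<le> a - a'"
    "\<And>x y. x \<in> ball z d \<Longrightarrow> y \<in> ball z d \<Longrightarrow> norm (S x - S y - blinfun_apply (S' z) (x - y)) \<le> (a - a') * norm (x - y)"
    using strict_derivative[OF der cont, of "a - a'" z] a' by auto
  show ?thesis
  proof (intro exI[of _ d] conjI ballI allI d(1))
    fix x v assume x: "x \<in> ball z d"
    have "norm (blinfun_apply (S' z) v) - norm (blinfun_apply (S' x) v) \<le> norm (blinfun_apply (S' x - S' z) v)"
      using norm_triangle_ineq2[of "blinfun_apply (S' z) v" "blinfun_apply (S' x) v"]
      by (simp add: blinfun.diff_left norm_minus_commute)
    also have "\<dots> \<le> (a - a') * norm v"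
      by (rule order_trans[OF norm_blinfun]) (intro mult_right_mono d(2)[OF x] norm_ge_zero)
    finally show "a' * norm v \<le> norm (blinfun_apply (S' x) v)" using low[of v] by (simp add: left_diff_distrib)
  next
    fix x y assume xy: "x \<in> ball z d" "y \<in> ball z d"
    have "norm (blinfun_apply (S' z) (x - y)) - norm (S x - S y) \<le> (a - a') * norm (x - y)"
      using norm_triangle_ineq2[of "blinfun_apply (S' z) (x - y)" "S x - S y"] d(3)[OF xy]
      by (simp add: norm_minus_commute)
    then show "a' * norm (x - y) \<le> norm (S x - S y)" using low[of "x - y"] by (simp add: left_diff_distrib)
  qed
qed

text \<open>The lower bound makes \<open>S\<close> injective on the ball, invariance of domain makes
  the image open, and the bound read backwards is a Lipschitz constant for the inverse.\<close>

lemma expanding_local_inverse: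
  fixes S :: "'a::euclidean_space \<Rightarrow> 'a"
  assumes cont: "continuous_on UNIV S" and d: "0 < d" and a: "0 < a"
    and low: "\<And>x y. x \<in> ball z d \<Longrightarrow> y \<in> ball z d \<Longrightarrow> a * norm (x - y) \<le> norm (S x - S y)"
  shows "\<exists>e>0. \<exists>J. J (S z) = z \<and> (\<forall>y\<in>ball (S z) e. J y \<in> ball z d \<and> S (J y) = y) \<and>
     (\<forall>y\<in>ball (S z) e. \<forall>y'\<in>ball (S z) e. norm (J y - J y') \<le> norm (y - y') / a)"
proof -
  have inj: "inj_on S (ball z d)"
  proof (rule inj_onI)
    fix x y assume "x \<in> ball z d" "y \<in> ball z d" "S x = S y"
    then show "x = y" using low[of x y] a by (simp add: mult_le_0_iff)
  qed
  have "open (S ` ball z d)"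
    by (rule invariance_of_domain[OF continuous_on_subset[OF cont] open_ball inj]) simp
  then obtain e where e: "e > 0" "ball (S z) e \<subseteq> S ` ball z d"
    using d by (meson centre_in_ball imageI openE)
  define J where "J = inv_into (ball z d) S"
  have J: "J y \<in> ball z d" "S (J y) = y" if "y \<in> ball (S z) e" for y
    using subsetD[OF e(2) that] unfolding J_def by (rule inv_into_into, rule f_inv_into_f)
  show ?thesis
  proof (intro exI[of _ e] exI[of _ J] conjI ballI e(1))
    show "J (S z) = z" unfolding J_def using d by (intro inv_into_f_f inj) auto
    fix y y' assume y: "y \<in> ball (S z) e" "y' \<in> ball (S z) e"
    show "norm (J y - J y') \<le> norm (y - y') / a"
      using low[OF J(1)[OF y(1)] J(1)[OF y(2)]] J(2)[OF y(1)] J(2)[OF y(2)] a by (simp add: field_simps)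
  qed (use J in auto)
qed

context cone_map begin

text \<open>Product of the derivatives along the orbit, kept as a bounded linear map so that
  continuity in the base point can be stated. It serves every lift of the \<open>n\<close>-th
  iterate, as translations do not affect derivatives.\<close>

fun Dn :: "nat \<Rightarrow> real^2 \<Rightarrow> (real^2) \<Rightarrow>\<^sub>L (real^2)" where
  "Dn 0 x = id_blinfun"
| "Dn (Suc n) x = D ((f ^^ n) x) o\<^sub>L Dn n x"

abbreviation DL :: "nat \<Rightarrow> real^2 \<Rightarrow> real^2 \<Rightarrow> real^2" where
  "DL n x \<equiv> blinfun_apply (Dn n x)"

lemma fpow_deriv: "((f ^^ n) has_derivative (DL n x)) (at x)"
proof (induction n)
  case 0 then show ?case by (simp add: id_def)
next
  case (Suc n)
  show ?case using diff_chain_at[OF Suc f_deriv] by (simp add: o_def)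
qed

lemma deck_deriv: "deck n S \<Longrightarrow> (S has_derivative (DL n x)) (at x)"
  unfolding deck_def by (auto intro!: derivative_eq_intros fpow_deriv)

lemma Dn_cont: "continuous_on UNIV (Dn n)"
proof (induction n)
  case (Suc n)
  then show ?case
    by (auto intro!: bounded_bilinear.continuous_on[OF bounded_bilinear_blinfun_compose] continuous_on_compose2[OF D_cont fpow_cont])
qed auto

lemma Dn_inj: "(DL n x) v = 0 \<Longrightarrow> v = 0"
  by (induction n) (auto dest: D_inj)

lemma Dn_lower: obtains a where "a > 0" "\<And>v. a * norm v \<le> norm (DL n x v)"
proof -
  have lin: "linear (DL n x)"
    by (simp add: blinfun.bounded_linear_right bounded_linear.linear)
  moreover have "inj (DL n x)"
    unfolding linear_injective_0[OF lin] using Dn_inj by blast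
  ultimately obtain a where "a > 0" "\<And>v. a * norm v \<le> norm (DL n x v)"
    using linear_inj_bounded_below_pos by (metis mult.commute)
  then show ?thesis using that by blast
qed

lemma deck_local:
  assumes "deck n S"
  obtains a d where "a > 0" "d > 0"
    "\<And>x v. x \<in> ball z d \<Longrightarrow> a * norm v \<le> norm (DL n x v)"
    "\<And>x y. x \<in> ball z d \<Longrightarrow> y \<in> ball z d \<Longrightarrow> a * norm (x - y) \<le> norm (S x - S y)"
proof -
  obtain a where a: "a > 0" "\<And>v. a * norm v \<le> norm (DL n z v)" using Dn_lower[of n z] by blast
  have "a / 2 < a" using a by simp
  from strict_lower_bound[OF deck_deriv[OF assms] Dn_cont a(2) this] that[of "a / 2"] a(1)
  show ?thesis by (metis half_gt_zero)
qed

lemma deck_open: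
  assumes "deck n S" "open U"
  shows "open (S ` U)"
proof (rule openI)
  fix y assume "y \<in> S ` U"
  then obtain u where u: "u \<in> U" "y = S u" by auto
  obtain r where r: "r > 0" "ball u r \<subseteq> U" using openE[OF \<open>open U\<close> u(1)] by blast
  obtain a d where ad: "a > 0" "d > 0"
    "\<And>x y. x \<in> ball u d \<Longrightarrow> y \<in> ball u d \<Longrightarrow> a * norm (x - y) \<le> norm (S x - S y)"
    using deck_local[OF assms(1), of u] by metis
  obtain e J where "e > 0" "\<forall>y\<in>ball (S u) e. J y \<in> ball u (min r d) \<and> S (J y) = y"
    using expanding_local_inverse[OF deck_cont[OF assms(1)], of "min r d" a u] ad r by auto
  then have "ball y e \<subseteq> S ` U" using r(2) u(2) by force
  then show "\<exists>e>0. ball y e \<subseteq> S ` U" using \<open>e > 0\<close> by blast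
qed

end

section \<open>Transitivity\<close>

lemma closed_torus: "closed torus"
proof -
  have "torus = sphere 0 1 \<times> sphere 0 1"
  proof
    show "torus \<subseteq> sphere 0 1 \<times> sphere 0 1" by (auto simp: torus_def torus_emb_def)
    show "sphere 0 1 \<times> sphere 0 1 \<subseteq> torus"
    proof
      fix p :: "complex \<times> complex" assume "p \<in> sphere 0 1 \<times> sphere 0 1"
      then have *: "norm (fst p) = 1" "norm (snd p) = 1" by auto
      have "p = torus_emb (vector [Arg (fst p) / (2 * pi), Arg (snd p) / (2 * pi)])"
        using rcis_cmod_Arg[of "fst p"] rcis_cmod_Arg[of "snd p"] *
        by (simp add: torus_emb_def rcis_def prod_eq_iff)
      then show "p \<in> torus" by (simp add: torus_def)
    qed
  qed
  then show ?thesis by (metis closed_Times closed_sphere)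
qed

lemma closure_torus_emb:
  assumes "\<And>U. open U \<Longrightarrow> U \<noteq> {} \<Longrightarrow> \<exists>x\<in>A. \<exists>y\<in>U. int_vec (x - y)"
  shows "closure (torus_emb ` A) = torus"
proof
  show "closure (torus_emb ` A) \<subseteq> torus"
    by (intro closure_minimal closed_torus) (auto simp: torus_def)
  show "torus \<subseteq> closure (torus_emb ` A)"
  proof
    fix u assume "u \<in> torus"
    then obtain y where y: "u = torus_emb y" by (auto simp: torus_def)
    show "u \<in> closure (torus_emb ` A)" unfolding closure_iff_nhds_not_empty
    proof (intro allI impI)
      fix V S assume V: "S \<subseteq> V" "u \<in> S" "open S"
      have "open (torus_emb -` S)"
        using continuous_open_preimage[OF torus_emb_cont[of UNIV] open_UNIV V(3)] by simp
      moreover have "torus_emb -` S \<noteq> {}" using V y by auto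
      ultimately obtain a b where "a \<in> A" "b \<in> torus_emb -` S" "int_vec (a - b)" using assms by meson
      then have "torus_emb a \<in> V" using V torus_emb_eq_iff[of a b] by auto
      then show "torus_emb ` A \<inter> V \<noteq> {}" using \<open>a \<in> A\<close> by auto
    qed
  qed
qed

text \<open>What the later arguments retain of the quasiperiodic curve: the fibre over
  \<open>c\<close> returns to itself, and it is minimal in a forward and in a backward form.\<close>

locale cone_map_qp = cone_map +
  fixes c :: real
  assumes per: "\<exists>n G. n \<ge> 1 \<and> deck n G \<and> (\<forall>x. H x = c \<longrightarrow> H (G x) = c)"
    and fwd: "\<And>x y e. H x = c \<Longrightarrow> H y = c \<Longrightarrow> e > 0 \<Longrightarrow> \<exists>n S. deck n S \<and> H (S x) = c \<and> norm (S x - y) < e"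
    and bwd: "\<And>x y e. H x = c \<Longrightarrow> H y = c \<Longrightarrow> e > 0 \<Longrightarrow> \<exists>n S z. deck n S \<and> H z = c \<and> norm (z - x) < e \<and> S z = y"
begin

lemma G_ex: obtains n G where "n \<ge> 1" "deck n G" "\<And>x j. H ((G ^^ j) x) = c + m ^ (n * j) * (H x - c)"
proof -
  obtain n G where G: "n \<ge> 1" "deck n G" "\<And>x. H x = c \<Longrightarrow> H (G x) = c" using per by metis
  have "H ((G ^^ j) x) = c + m ^ (n * j) * (H x - c)" for j x
  proof -
    have "H ((G ^^ j) (X c 0)) = c" by (induction j) (auto simp: G)
    then show ?thesis using deck_H[OF deck_pow[OF G(2)], of j x "X c 0"] by simp
  qed
  then show ?thesis using that G by blast
qed

text \<open>\<open>H\<close> is not constant on a segment in the cone direction \<open>w\<close>.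
  Multiplication by \<open>m ^ n\<close> stretches its range beyond length 1, so the range meets
  \<open>t + j\<close> for some integer \<open>j\<close>, which a translation by a multiple of
  \<open>k2\<close> removes.\<close>

lemma open_meets_fibre:
  assumes "open U" "U \<noteq> {}"
  shows "\<exists>n S u. deck n S \<and> u \<in> U \<and> H (S u) = t"
proof -
  obtain x where x: "x \<in> U" using assms by auto
  have "open ((\<lambda>s. x + s *\<^sub>R w) -` U)"
    by (intro open_vimage \<open>open U\<close> continuous_intros)
  moreover have "0 \<in> (\<lambda>s. x + s *\<^sub>R w) -` U" using x by simp
  ultimately obtain r where r: "r > 0" "ball 0 r \<subseteq> (\<lambda>s. x + s *\<^sub>R w) -` U" by (rule openE)
  define y where "y = x + (r / 2) *\<^sub>R w"
  have U: "x + s *\<^sub>R w \<in> U" if "0 \<le> s" "s \<le> r / 2" for s using r that by (auto simp: subset_iff)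
  have "H x \<noteq> H y"
  proof
    assume "H x = H y"
    then have "x = y" by (rule H_CC_eq) (auto intro!: CC_w simp: y_def \<beta>_simps w)
    then show False using r by (auto simp: y_def) (metis \<phi>.zero w(1) zero_neq_one)
  qed
  then have pos: "\<bar>H y - H x\<bar> > 0" by auto
  obtain n where n: "1 / \<bar>H y - H x\<bar> < 2 ^ n" using real_arch_pow[of 2] by auto
  have "1 < 2 ^ n * \<bar>H y - H x\<bar>" using n pos by (simp add: field_simps)
  also have "\<dots> \<le> \<bar>m ^ n\<bar> * \<bar>H y - H x\<bar>" using m_pow by (intro mult_right_mono) auto
  finally have big: "1 < \<bar>m ^ n * H y - m ^ n * H x\<bar>" by (simp add: abs_mult[symmetric] right_diff_distrib)
  define g where "g s = H ((f ^^ n) (x + s *\<^sub>R w))" for s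
  have g: "g 0 = m ^ n * H x" "g (r / 2) = m ^ n * H y" by (auto simp: g_def H_fpow y_def)
  have g_cont: "continuous_on {0..r / 2} g"
    unfolding g_def by (intro continuous_on_compose2[OF H_cont[of UNIV]] continuous_on_compose2[OF fpow_cont] continuous_intros) auto
  define j where "j = \<lceil>min (g 0) (g (r / 2)) - t\<rceil>"
  have j: "min (g 0) (g (r / 2)) \<le> t + j" "t + j \<le> max (g 0) (g (r / 2))"
    using big unfolding j_def g by linarith+
  have "\<exists>s. 0 \<le> s \<and> s \<le> r / 2 \<and> g s = t + j"
  proof (cases "g 0 \<le> g (r / 2)")
    case True then show ?thesis using IVT'[OF _ _ _ g_cont, of "t + j"] j r by auto
  next
    case False then show ?thesis using IVT2'[OF _ _ _ g_cont, of "t + j"] j r by auto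
  qed
  then obtain s where s: "0 \<le> s" "s \<le> r / 2" "g s = t + j" by blast
  have k: "int_vec ((- real_of_int j) *\<^sub>R k2)" by (intro int_vec_scaleR k2) simp
  show ?thesis
  proof (intro exI conjI)
    show "deck n (\<lambda>x. (f ^^ n) x + (- real_of_int j) *\<^sub>R k2)" by (rule deckI[OF k])
    show "x + s *\<^sub>R w \<in> U" by (rule U) (use s in auto)
    show "H ((f ^^ n) (x + s *\<^sub>R w) + (- real_of_int j) *\<^sub>R k2) = t"
      unfolding H_shift[OF k] \<phi>.scaleR k2 using s(3) by (simp add: g_def)
  qed
qed

text \<open>The equality \<open>S u = x\<close>, stronger than density, lets an orbit start in
  \<open>U\<close> and land exactly on a saddle or repeller, or start near a repeller and land
  exactly on a chosen point of \<open>U\<close>.\<close>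

lemma cover:
  assumes U: "open U" "U \<noteq> {}"
  shows "\<exists>n S u. deck n S \<and> u \<in> U \<and> S u = x"
proof -
  define Orb where "Orb = {S u |n S u. deck n S \<and> u \<in> U}"
  have OrbI: "deck n S \<Longrightarrow> u \<in> U \<Longrightarrow> S u \<in> Orb" for n S u unfolding Orb_def by blast
  have OrbS: "S y \<in> Orb" if S: "deck n S" and y: "y \<in> Orb" for n S y
  proof -
    obtain n' S' u where "deck n' S'" "u \<in> U" "y = S' u" using y by (auto simp: Orb_def)
    then show ?thesis using OrbI[OF deck_comp[OF S]] by (metis comp_apply)
  qed
  have "Orb = \<Union>{S ` U |n S. deck n S}" by (auto simp: Orb_def)
  moreover have "open (\<Union>{S ` U |n S. deck n S})" by (intro open_Union) (auto intro: deck_open[OF _ U(1)])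
  ultimately have "open Orb" by simp
  obtain n0 S0 u0 where 0: "deck n0 S0" "u0 \<in> U" "H (S0 u0) = c" using open_meets_fibre[OF U] by blast
  obtain r where r: "r > 0" "ball (S0 u0) r \<subseteq> Orb" using openE[OF \<open>open Orb\<close> OrbI[OF 0(1,2)]] by blast
  have fibre: "y \<in> Orb" if y: "H y = c" for y
  proof -
    obtain n S z where "deck n S" "norm (z - S0 u0) < r" "S z = y" using bwd[OF 0(3) y r(1)] by blast
    then show ?thesis using r(2) OrbS[of n S z] by (auto simp: subset_iff dist_norm norm_minus_commute)
  qed
  \<comment> \<open>Tube argument: the fibre is compact modulo translation by \<open>k1\<close>,
    which preserves \<open>Orb\<close>. Otherwise points outside \<open>Orb\<close>, with
    \<open>\<beta>\<close> reduced to the unit interval, would accumulate at a point of the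
    fibre.\<close>
  have "\<exists>e>0. \<forall>y. \<bar>H y - c\<bar> < e \<longrightarrow> y \<in> Orb"
  proof (rule ccontr)
    assume "\<not> ?thesis"
    then have "\<forall>i. \<exists>y. \<bar>H y - c\<bar> < inverse (real (Suc i)) \<and> y \<notin> Orb"
      by (meson inverse_positive_iff_positive of_nat_0_less_iff zero_less_Suc)
    then obtain y where y: "\<And>i. \<bar>H (y i) - c\<bar> < inverse (real (Suc i))" "\<And>i. y i \<notin> Orb" by metis
    define z where "z i = X (H (y i)) (frac (\<beta> (y i)))" for i
    have z: "z i \<notin> Orb" for i
    proof
      assume "z i \<in> Orb"
      have "y i = X (H (y i)) (frac (\<beta> (y i)) + real_of_int \<lfloor>\<beta> (y i)\<rfloor>)"
        using X_eq[of "y i"] by (simp add: frac_def)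
      then have "y i = z i + real_of_int \<lfloor>\<beta> (y i)\<rfloor> *\<^sub>R k1" unfolding X_shift z_def .
      moreover have "deck 0 (\<lambda>x. (f ^^ 0) x + real_of_int \<lfloor>\<beta> (y i)\<rfloor> *\<^sub>R k1)"
        by (intro deckI int_vec_scaleR k1) simp
      from OrbS[OF this \<open>z i \<in> Orb\<close>] have "z i + real_of_int \<lfloor>\<beta> (y i)\<rfloor> *\<^sub>R k1 \<in> Orb" by simp
      ultimately show False using y(2)[of i] by simp
    qed
    have "frac (\<beta> (y i)) \<in> {0..1}" for i using frac_lt_1[of "\<beta> (y i)"] by (simp add: less_imp_le)
    then obtain l q where lq: "strict_mono (q :: nat \<Rightarrow> nat)" "((\<lambda>i. frac (\<beta> (y i))) \<circ> q) \<longlonglongrightarrow> l"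
      using compact_Icc[of "0::real" 1] unfolding compact_def by metis
    have "(\<lambda>i. H (y i) - c) \<longlonglongrightarrow> 0"
      by (rule tendsto_rabs_zero_cancel, rule tendsto_sandwich[OF _ _ tendsto_const LIMSEQ_inverse_real_of_nat])
        (use y(1) in \<open>auto intro!: always_eventually less_imp_le\<close>)
    then have "((\<lambda>i. H (y i)) \<circ> q) \<longlonglongrightarrow> c" by (rule LIMSEQ_subseq_LIMSEQ[OF LIM_zero_cancel lq(1)])
    then have "(\<lambda>i. z (q i)) \<longlonglongrightarrow> X c l" using lq(2) unfolding z_def o_def by (rule X_tendsto)
    moreover have "X c l \<in> Orb" by (rule fibre) simp
    ultimately have "\<forall>\<^sub>F i in sequentially. z (q i) \<in> Orb" using \<open>open Orb\<close> by (metis topological_tendstoD)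
    then show False using z by simp
  qed
  then obtain e where e: "e > 0" "\<And>y. \<bar>H y - c\<bar> < e \<Longrightarrow> y \<in> Orb" by blast
  \<comment> \<open>\<open>G\<close> preserves the fibre over \<open>c\<close> and multiplies
    \<open>H x - c\<close> by a power of \<open>m\<close>, so enough preimages under
    \<open>G\<close> bring any \<open>x\<close> into the tube.\<close>
  obtain n G where G: "n \<ge> 1" "deck n G" "\<And>x j. H ((G ^^ j) x) = c + m ^ (n * j) * (H x - c)" using G_ex by blast
  obtain j where j: "\<bar>H x - c\<bar> / e < 2 ^ j" using real_arch_pow[of 2] by auto
  obtain z where z: "(G ^^ j) z = x" using deck_surj[OF deck_pow[OF G(2)]] by blast
  have "(2::real) ^ j \<le> 2 ^ (n * j)" using G(1) by (intro power_increasing) auto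
  then have "2 ^ j \<le> \<bar>m ^ (n * j)\<bar>" using m_pow(2)[of "n * j"] by linarith
  then have "2 ^ j * \<bar>H z - c\<bar> \<le> \<bar>m ^ (n * j)\<bar> * \<bar>H z - c\<bar>"
    by (intro mult_right_mono) auto
  also have "\<dots> = \<bar>H x - c\<bar>" using G(3)[of j z] z by (simp add: abs_mult)
  also have "\<dots> < 2 ^ j * e" using j e by (simp add: field_simps)
  finally have "z \<in> Orb" by (intro e(2)) simp
  then have "x \<in> Orb" using OrbS[OF deck_pow[OF G(2)]] z by metis
  then show ?thesis unfolding Orb_def by blast
qed

text \<open>Baire category over a countable basis: the points whose orbit visits a basic open set
  modulo integers form an open set, which is dense by \<open>cover\<close>.\<close>

lemma dense_orbit: "\<exists>x. closure (torus_emb ` range (\<lambda>n. (f ^^ n) x)) = torus"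
proof -
  obtain \<B> :: "(real^2) set set" where B: "countable \<B>" "topological_basis \<B>"
    using ex_countable_basis by blast
  define O' where "O' V = {x. \<exists>n k. int_vec k \<and> (f ^^ n) x + k \<in> V}" for V
  define \<G> where "\<G> = O' ` (\<B> - {{}})"
  have 1: "open (O' V) \<and> UNIV \<subseteq> closure (O' V)" if V: "V \<in> \<B> - {{}}" for V
  proof
    have "open V" using B(2) V topological_basis_open by blast
    have eq: "O' V = \<Union>{S -` V |n S. deck n S}" by (auto simp: O'_def deck_def)
    show "open (O' V)" unfolding eq
    proof (intro open_Union ballI)
      fix W assume "W \<in> {S -` V |n S. deck n S}"
      then obtain n S where "deck n S" "W = S -` V" by blast
      then show "open W"
        using continuous_open_preimage[OF deck_cont[of n S UNIV] open_UNIV \<open>open V\<close>] by simp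
    qed
    show "UNIV \<subseteq> closure (O' V)"
    proof
      fix x :: "real^2"
      show "x \<in> closure (O' V)" unfolding closure_iff_nhds_not_empty
      proof (intro allI impI)
        fix W S assume W: "S \<subseteq> W" "x \<in> S" "open S"
        obtain v where v: "v \<in> V" using V by auto
        obtain n R u where "deck n R" "u \<in> S" "R u = v" using cover[of S v] W by auto
        then have "u \<in> O' V" "u \<in> W" using v W by (auto simp: O'_def deck_def)
        then show "O' V \<inter> W \<noteq> {}" by auto
      qed
    qed
  qed
  have "UNIV \<subseteq> closure (\<Inter>\<G>)"
    by (rule Baire) (use 1 B(1) in \<open>auto simp: \<G>_def\<close>)
  then have "\<Inter>\<G> \<noteq> {}" by (metis closure_empty UNIV_not_empty subset_empty)
  then obtain x where x: "\<And>V. V \<in> \<B> \<Longrightarrow> V \<noteq> {} \<Longrightarrow> x \<in> O' V" by (auto simp: \<G>_def)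
  have "closure (torus_emb ` range (\<lambda>n. (f ^^ n) x)) = torus"
  proof (rule closure_torus_emb)
    fix U :: "(real^2) set" assume "open U" "U \<noteq> {}"
    then obtain V where "V \<in> \<B>" "V \<noteq> {}" "V \<subseteq> U"
      using topological_basisE[OF B(2)] by (metis all_not_in_conv)
    then obtain n k where "int_vec k" "(f ^^ n) x + k \<in> U" using x[of V] by (auto simp: O'_def)
    then show "\<exists>a\<in>range (\<lambda>n. (f ^^ n) x). \<exists>b\<in>U. int_vec (a - b)"
      by (intro bexI[of _ "(f ^^ n) x"] bexI[of _ "(f ^^ n) x + k"]) auto
  qed
  then show ?thesis ..
qed

end

section \<open>The fibre direction at a periodic point\<close>

text \<open>The left eigenvector \<open>l\<close> annihilates the right eigenvector
  \<open>e\<close>, so the matrix is triangular in a basis beginning with \<open>e\<close>, with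
  \<open>\<mu>\<close> on that line and \<open>lam\<close> on the quotient. Trace and determinant
  can be read off.\<close>

lemma triangular_2:
  fixes a b c d :: real
  assumes e: "a * e1 + b * e2 = \<mu> * e1" "c * e1 + d * e2 = \<mu> * e2"
    and l: "l1 * a + l2 * c = lam * l1" "l1 * b + l2 * d = lam * l2"
    and "l1 * e1 + l2 * e2 = 0" "e1 \<noteq> 0 \<or> e2 \<noteq> 0" "l1 \<noteq> 0 \<or> l2 \<noteq> 0"
  shows "a + d = \<mu> + lam \<and> a * d - b * c = \<mu> * lam"
proof (cases "e1 = 0")
  case False
  define r where "r = e2 / e1"
  have e2: "e2 = r * e1" using False by (simp add: r_def)
  have l1: "l1 = - r * l2" using assms(5) False by (simp add: r_def field_simps)
  then have "l2 \<noteq> 0" using assms(7) by auto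
  have "e1 * (a + b * r) = e1 * \<mu>" "e1 * (c + d * r) = e1 * (\<mu> * r)" using e by (simp_all add: e2 algebra_simps)
  then have "a + b * r = \<mu>" "c + d * r = \<mu> * r" using False by simp_all
  moreover have "l2 * (d - r * b) = l2 * lam" using l by (simp add: l1 algebra_simps)
  then have "lam = d - r * b" using \<open>l2 \<noteq> 0\<close> by simp
  ultimately have "c = \<mu> * r - d * r" and a: "a = \<mu> - b * r" and d: "d = lam + r * b" by linarith+
  then have c: "c = \<mu> * r - (lam + r * b) * r" by simp
  show ?thesis unfolding a c d by (simp add: algebra_simps)
next
  case True
  then have "e2 \<noteq> 0" "l2 = 0" "l1 \<noteq> 0" using assms(5-7) by auto
  then have "b = 0" "d = \<mu>" "a = lam" using e l True by auto
  then show ?thesis by simp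
qed

lemma eigenvalue2_iff:
  assumes "A $ 1 $ 1 + A $ 2 $ 2 = \<mu> + lam" "A $ 1 $ 1 * A $ 2 $ 2 - A $ 1 $ 2 * A $ 2 $ 1 = \<mu> * lam"
  shows "eigenvalue2 A l \<longleftrightarrow> l = of_real \<mu> \<or> l = of_real lam"
proof -
  have "det (((\<chi> i j. of_real (A$i$j)) :: complex^2^2) - mat l) =
      of_real (A $ 1 $ 1 * A $ 2 $ 2 - A $ 1 $ 2 * A $ 2 $ 1) - of_real (A $ 1 $ 1 + A $ 2 $ 2) * l + l * l"
    by (simp add: det_2 mat_def algebra_simps)
  also have "\<dots> = (of_real \<mu> - l) * (of_real lam - l)"
    unfolding assms by (simp add: algebra_simps)
  finally show ?thesis unfolding eigenvalue2_def by auto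
qed

context cone_map begin

text \<open>The open cone. Its complement is closed, so lying outside it survives limits of secants,
  which lying outside \<open>CC\<close> need not.\<close>

definition OC :: "real^2 \<Rightarrow> bool" where
  "OC v \<longleftrightarrow> \<bar>\<beta> v\<bar> < \<kappa> * \<bar>\<phi> v\<bar>"

lemma D_CC: "CC v \<Longrightarrow> CC ((D z) v) \<and> K * \<bar>\<phi> v\<bar> \<le> \<bar>\<phi> ((D z) v)\<bar>"
  using cone[of v z] unfolding CC_def by (cases "v = 0") (auto simp: blinfun.zero_right \<phi>_simps \<beta>_simps)

lemma Dn_CC:
  assumes "CC v"
  shows "CC (DL n z v) \<and> K ^ n * \<bar>\<phi> v\<bar> \<le> \<bar>\<phi> (DL n z v)\<bar>"
proof (induction n)
  case 0 then show ?case using assms by simp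
next
  case (Suc n)
  have "K * (K ^ n * \<bar>\<phi> v\<bar>) \<le> K * \<bar>\<phi> (DL n z v)\<bar>"
    using Suc K by (intro mult_left_mono) auto
  then show ?case using D_CC[of "(DL n z) v" "(f ^^ n) z"] Suc by auto
qed

lemma D_OC: "CC v \<Longrightarrow> v \<noteq> 0 \<Longrightarrow> OC ((D z) v)"
  using cone[of v z] unfolding CC_def OC_def by auto

lemma Dn_notOC: "\<not> OC (DL n z v) \<Longrightarrow> norm (DL n z v) \<le> K1 ^ n * norm v"
proof (induction n)
  case 0 then show ?case by simp
next
  case (Suc n)
  let ?u = "(DL n z) v"
  have 1: "\<not> OC ?u"
  proof
    assume "OC ?u"
    then have "CC ?u" "?u \<noteq> 0" by (auto simp: OC_def CC_def \<phi>_simps \<beta>_simps)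
    then show False using D_OC Suc.prems by auto
  qed
  have "norm (DL (Suc n) z v) \<le> K1 * norm ?u"
    using noncone[of ?u] 1 unfolding OC_def by simp
  also have "\<dots> \<le> K1 * (K1 ^ n * norm v)" using Suc.IH[OF 1] K1 by (intro mult_left_mono) auto
  finally show ?case by (simp add: mult.assoc)
qed

lemma not_OC_\<beta>: "\<not> OC v \<Longrightarrow> v \<noteq> 0 \<Longrightarrow> \<beta> v \<noteq> 0"
  using \<kappa> coord_eqI[of v 0] unfolding OC_def
  by (auto simp: \<phi>_simps \<beta>_simps zero_less_mult_iff)

context
  fixes n S z
  assumes S: "deck n S" and n: "n \<ge> 1" and fix_z: "S z = z"
begin

abbreviation L where "L \<equiv> (DL n z)"

lemma L_pow: "L ^^ i = (DL (n * i) z)"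
proof -
  have "((S ^^ i) has_derivative (L ^^ i)) (at z)"
  proof (induction i)
    case 0 then show ?case by (simp add: id_def)
  next
    case (Suc i)
    have "(S ^^ i) z = z" by (induction i) (auto simp: fix_z)
    then show ?case using diff_chain_at[OF Suc, of S L] deck_deriv[OF S, of z] by (simp add: o_def)
  qed
  then show ?thesis using deck_deriv[OF deck_pow[OF S]] has_derivative_unique by blast
qed

lemma L_lin: "L (x + y) = L x + L y" "L (r *\<^sub>R x) = r *\<^sub>R L x"
  by (simp_all add: blinfun.add_right blinfun.scaleR_right)

lemma L_pow_lin: "(L ^^ i) (x + y) = (L ^^ i) x + (L ^^ i) y" "(L ^^ i) (r *\<^sub>R x) = r *\<^sub>R (L ^^ i) x"
  by (simp_all add: L_pow blinfun.add_right blinfun.scaleR_right)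

lemma K_ratio: "1 < K / K1" "K1 ^ i * (K / K1) ^ i = K ^ i"
  using K1 by (auto simp: power_divide)

text \<open>Outside the cones vectors grow at most like \<^term>\<open>K1 ^ (n * i)\<close>, while \<^term>\<open>w\<close> grows at
  least like \<^term>\<open>K ^ (n * i)\<close>; so the vectors that never enter a cone do not span the plane.\<close>

lemma never_cone_parallel:
  assumes "\<And>i. \<not> OC ((L ^^ i) e)" "\<And>i. \<not> OC ((L ^^ i) e')"
  shows "\<phi> e * \<beta> e' = \<phi> e' * \<beta> e"
proof (rule ccontr)
  assume ne: "\<phi> e * \<beta> e' \<noteq> \<phi> e' * \<beta> e"
  define d where "d = \<phi> e * \<beta> e' - \<phi> e' * \<beta> e"
  have d: "d \<noteq> 0" using ne by (simp add: d_def)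
  define x y where "x = \<beta> e' / d" and "y = - \<beta> e / d"
  have "w = x *\<^sub>R e + y *\<^sub>R e'"
  proof (rule coord_eqI)
    have "\<beta> e' * \<phi> e - \<beta> e * \<phi> e' = d" by (simp add: d_def mult.commute)
    then have "x * \<phi> e + y * \<phi> e' = d / d" by (simp add: x_def y_def diff_divide_distrib[symmetric])
    then show "\<phi> w = \<phi> (x *\<^sub>R e + y *\<^sub>R e')" using d by (simp add: \<phi>_simps w)
    show "\<beta> w = \<beta> (x *\<^sub>R e + y *\<^sub>R e')" by (simp add: \<beta>_simps w x_def y_def)
  qed
  define C where "C = \<bar>x\<bar> * norm e + \<bar>y\<bar> * norm e'"
  obtain C1 where C1: "C1 > 0" "\<And>v. \<bar>\<phi> v\<bar> \<le> norm v * C1" using \<phi>.pos_bounded by auto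
  have "(K / K1) ^ (n * i) \<le> C1 * C" for i
  proof -
    have "norm ((L ^^ i) e) \<le> K1 ^ (n * i) * norm e" "norm ((L ^^ i) e') \<le> K1 ^ (n * i) * norm e'"
      using Dn_notOC assms unfolding L_pow by auto
    then have "\<bar>x\<bar> * norm ((L ^^ i) e) + \<bar>y\<bar> * norm ((L ^^ i) e') \<le> \<bar>x\<bar> * (K1 ^ (n * i) * norm e) + \<bar>y\<bar> * (K1 ^ (n * i) * norm e')"
      by (intro add_mono mult_left_mono) auto
    moreover have "norm ((L ^^ i) w) \<le> \<bar>x\<bar> * norm ((L ^^ i) e) + \<bar>y\<bar> * norm ((L ^^ i) e')"
      unfolding \<open>w = _\<close> L_pow_lin by (metis norm_scaleR norm_triangle_ineq real_norm_def)
    ultimately have "norm ((L ^^ i) w) \<le> K1 ^ (n * i) * C" by (simp add: C_def algebra_simps)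
    moreover have "K ^ (n * i) \<le> \<bar>\<phi> ((L ^^ i) w)\<bar>"
      using Dn_CC[OF CC_w[OF w(2)], of "n * i" z] by (simp add: L_pow w)
    moreover have "\<bar>\<phi> ((L ^^ i) w)\<bar> \<le> norm ((L ^^ i) w) * C1" by (rule C1)
    moreover have "norm ((L ^^ i) w) * C1 \<le> K1 ^ (n * i) * C * C1"
      using calculation(1) C1 by (intro mult_right_mono) auto
    ultimately have "K1 ^ (n * i) * (K / K1) ^ (n * i) \<le> K1 ^ (n * i) * (C1 * C)"
      unfolding K_ratio by (simp add: mult_ac)
    then show ?thesis using K1 by simp
  qed
  moreover obtain i where "C1 * C < (K / K1) ^ i" using real_arch_pow[OF K_ratio(1)] by blast
  moreover have "(K / K1) ^ i \<le> (K / K1) ^ (n * i)" using n K_ratio(1) by (intro power_increasing) auto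
  ultimately show False by (meson not_less order_less_le_trans)
qed

text \<open>Stands in for a tangent of the fibre. Secants between points of a common fibre stay
  outside the cone under every iterate, hence so do their limits. Image secants are divided by the
  original lengths in order to converge to \<open>L u\<close>.\<close>

lemma fibre_direction:
  assumes lim: "x \<longlonglongrightarrow> z" "y \<longlonglongrightarrow> z" and H: "\<And>k. H (x k) = H (y k)" and ne: "\<And>k. x k \<noteq> y k"
  obtains u r where "strict_mono (r :: nat \<Rightarrow> nat)" "u \<noteq> 0" "\<And>i. \<not> OC ((L ^^ i) u)"
    "(\<lambda>k. (x (r k) - y (r k)) /\<^sub>R norm (x (r k) - y (r k))) \<longlonglongrightarrow> u"
    "(\<lambda>k. (S (x (r k)) - S (y (r k))) /\<^sub>R norm (x (r k) - y (r k))) \<longlonglongrightarrow> L u"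
proof -
  define v where "v k = (x k - y k) /\<^sub>R norm (x k - y k)" for k
  have "v k \<in> sphere 0 1" for k using ne by (simp add: v_def)
  then obtain u r where ur: "u \<in> sphere 0 1" "strict_mono (r :: nat \<Rightarrow> nat)" "(v \<circ> r) \<longlonglongrightarrow> u"
    using compact_sphere unfolding compact_def by metis
  \<comment> \<open>Both end points move with \<open>k\<close>, so differentiability at
    \<open>z\<close> alone would not do; the strict form is used.\<close>
  have lim_i: "(\<lambda>k. ((S ^^ i) (x (r k)) - (S ^^ i) (y (r k))) /\<^sub>R norm (x (r k) - y (r k))) \<longlonglongrightarrow> (L ^^ i) u" for i
  proof (rule Lim_transform2)
    show "(\<lambda>k. (L ^^ i) (v (r k))) \<longlonglongrightarrow> (L ^^ i) u"
      using ur(3) unfolding L_pow o_def by (intro tendsto_intros)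
    show "(\<lambda>k. (L ^^ i) (v (r k)) - ((S ^^ i) (x (r k)) - (S ^^ i) (y (r k))) /\<^sub>R norm (x (r k) - y (r k))) \<longlonglongrightarrow> 0"
    proof (rule tendsto_norm_zero_cancel, rule LIMSEQ_I)
      fix e :: real assume "e > 0"
      then obtain d where d: "d > 0" "\<And>a b. a \<in> ball z d \<Longrightarrow> b \<in> ball z d \<Longrightarrow>
          norm ((S ^^ i) a - (S ^^ i) b - (L ^^ i) (a - b)) \<le> e / 2 * norm (a - b)"
        using strict_derivative[OF deck_deriv[OF deck_pow[OF S, of i]] Dn_cont half_gt_zero[OF \<open>e > 0\<close>], of z]
        unfolding L_pow by blast
      have "\<forall>\<^sub>F k in sequentially. x (r k) \<in> ball z d \<and> y (r k) \<in> ball z d"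
        using topological_tendstoD[OF LIMSEQ_subseq_LIMSEQ[OF lim(1) ur(2)], of "ball z d"]
          topological_tendstoD[OF LIMSEQ_subseq_LIMSEQ[OF lim(2) ur(2)], of "ball z d"] d(1)
        by (auto intro: eventually_conj)
      then obtain k0 where k0: "\<And>k. k \<ge> k0 \<Longrightarrow> x (r k) \<in> ball z d \<and> y (r k) \<in> ball z d"
        unfolding eventually_sequentially by blast
      show "\<exists>k0. \<forall>k\<ge>k0. norm (norm ((L ^^ i) (v (r k)) - ((S ^^ i) (x (r k)) - (S ^^ i) (y (r k))) /\<^sub>R norm (x (r k) - y (r k))) - 0) < e"
      proof (intro exI allI impI)
        fix k assume "k \<ge> k0"
        let ?a = "x (r k)" and ?b = "y (r k)"
        have "(L ^^ i) (v (r k)) - ((S ^^ i) ?a - (S ^^ i) ?b) /\<^sub>R norm (?a - ?b)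
            = (- 1 / norm (?a - ?b)) *\<^sub>R ((S ^^ i) ?a - (S ^^ i) ?b - (L ^^ i) (?a - ?b))"
          unfolding v_def L_pow_lin by (simp add: scaleR_diff_right divide_inverse)
        then have "norm ((L ^^ i) (v (r k)) - ((S ^^ i) ?a - (S ^^ i) ?b) /\<^sub>R norm (?a - ?b))
            = norm ((S ^^ i) ?a - (S ^^ i) ?b - (L ^^ i) (?a - ?b)) / norm (?a - ?b)"
          by simp
        also have "\<dots> \<le> e / 2"
          using d(2)[of ?a ?b] k0[OF \<open>k \<ge> k0\<close>] ne[of "r k"] by (simp add: divide_le_eq)
        finally have "norm ((L ^^ i) (v (r k)) - ((S ^^ i) ?a - (S ^^ i) ?b) /\<^sub>R norm (?a - ?b)) < e"
          using \<open>e > 0\<close> by linarith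
        then show "norm (norm ((L ^^ i) (v (r k)) - ((S ^^ i) ?a - (S ^^ i) ?b) /\<^sub>R norm (?a - ?b)) - 0) < e"
          by (simp only: diff_zero real_norm_def abs_norm_cancel)
      qed
    qed
  qed
  show ?thesis
  proof (rule that[OF ur(2)])
    show "u \<noteq> 0" using ur(1) by auto
    show "(\<lambda>k. (x (r k) - y (r k)) /\<^sub>R norm (x (r k) - y (r k))) \<longlonglongrightarrow> u"
      using ur(3) by (simp add: o_def v_def)
    show "(\<lambda>k. (S (x (r k)) - S (y (r k))) /\<^sub>R norm (x (r k) - y (r k))) \<longlonglongrightarrow> L u"
      using lim_i[of 1] by simp
    fix i
    let ?s = "\<lambda>k. ((S ^^ i) (x (r k)) - (S ^^ i) (y (r k))) /\<^sub>R norm (x (r k) - y (r k))"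
    have "\<kappa> * \<bar>\<phi> (?s k)\<bar> \<le> \<bar>\<beta> (?s k)\<bar>" for k
    proof -
      have "H ((S ^^ i) (x (r k))) = H ((S ^^ i) (y (r k)))"
        using deck_H[OF deck_pow[OF S, of i], of "x (r k)" "y (r k)"] H by simp
      then have "\<kappa> * \<bar>\<phi> ((S ^^ i) (x (r k)) - (S ^^ i) (y (r k)))\<bar> \<le> \<bar>\<beta> ((S ^^ i) (x (r k)) - (S ^^ i) (y (r k)))\<bar>"
        using H_CC_eq unfolding CC_def by (metis abs_0 abs_ge_zero \<beta>.zero \<phi>.zero diff_self linear mult_zero_right)
      then have "inverse (norm (x (r k) - y (r k))) * (\<kappa> * \<bar>\<phi> ((S ^^ i) (x (r k)) - (S ^^ i) (y (r k)))\<bar>) \<le>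
          inverse (norm (x (r k) - y (r k))) * \<bar>\<beta> ((S ^^ i) (x (r k)) - (S ^^ i) (y (r k)))\<bar>"
        by (intro mult_left_mono) auto
      then show ?thesis unfolding \<phi>.scaleR \<beta>.scaleR real_scaleR_def abs_mult by (simp add: mult_ac)
    qed
    then have "\<kappa> * \<bar>\<phi> ((L ^^ i) u)\<bar> \<le> \<bar>\<beta> ((L ^^ i) u)\<bar>"
      by (intro LIMSEQ_le[of "\<lambda>k. \<kappa> * \<bar>\<phi> (?s k)\<bar>" _ "\<lambda>k. \<bar>\<beta> (?s k)\<bar>"] tendsto_intros \<phi>.tendsto \<beta>.tendsto lim_i) auto
    then show "\<not> OC ((L ^^ i) u)" by (simp add: OC_def)
  qed
qed

text \<open>By \<open>never_cone_parallel\<close> secant limits are unique up to scaling, and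
  \<open>L\<close> maps them to vectors of the same kind; so their direction \<open>e\<close> is an
  eigenvector, for \<open>\<mu>\<close>. The eigenvalue \<open>lam\<close> lives on the quotient by
  \<open>e\<close>. The last conclusion says that near \<open>z\<close>, along fibres and in the
  coordinate \<open>\<beta>\<close>, \<open>S\<close> acts almost like multiplication by
  \<open>\<mu>\<close>.\<close>

lemma periodic_splitting:
  obtains \<mu> lam e q where "\<beta> e \<noteq> 0" "L e = \<mu> *\<^sub>R e" "L w = lam *\<^sub>R w + q *\<^sub>R e" "1 < \<bar>lam\<bar>"
    "\<And>l. eigenvalue2 (matrix L) l \<longleftrightarrow> l = of_real \<mu> \<or> l = of_real lam"
    "\<And>r. r > 0 \<Longrightarrow> \<exists>d>0. \<forall>x\<in>ball z d. \<forall>y\<in>ball z d. H x = H y \<longrightarrow> \<bar>\<beta> (S x) - \<beta> (S y) - \<mu> * (\<beta> x - \<beta> y)\<bar> \<le> r * \<bar>\<beta> x - \<beta> y\<bar>"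
proof -
  obtain e where e0: "e \<noteq> 0" "\<And>i. \<not> OC ((L ^^ i) e)"
  proof (rule fibre_direction[of "\<lambda>k. X (H z) (\<beta> z + inverse (real (Suc k)))" "\<lambda>k. z"])
    have "(\<lambda>k. X (H z) (\<beta> z + inverse (real (Suc k)))) \<longlonglongrightarrow> X (H z) (\<beta> z + 0)"
      by (intro X_tendsto tendsto_intros LIMSEQ_inverse_real_of_nat)
    then show "(\<lambda>k. X (H z) (\<beta> z + inverse (real (Suc k)))) \<longlonglongrightarrow> z" using X_eq[of z] by simp
    show "X (H z) (\<beta> z + inverse (real (Suc k))) \<noteq> z" for k
    proof
      assume "X (H z) (\<beta> z + inverse (real (Suc k))) = z"
      then have "\<beta> z + inverse (real (Suc k)) = \<beta> z" by (metis \<beta>X)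
      then show False by simp
    qed
  qed auto
  have \<beta>e: "\<beta> e \<noteq> 0" using not_OC_\<beta>[of e] e0(1) e0(2)[of 0] by simp
  have parallel: "u = (\<beta> u / \<beta> e) *\<^sub>R e" if "\<And>i. \<not> OC ((L ^^ i) u)" for u
    by (rule coord_eqI) (use never_cone_parallel[OF e0(2) that] \<beta>e in \<open>auto simp: \<phi>_simps \<beta>_simps field_simps\<close>)
  define \<mu> where "\<mu> = \<beta> (L e) / \<beta> e"
  have "\<not> OC ((L ^^ i) (L e))" for i using e0(2)[of "Suc i"] by (simp add: funpow_swap1)
  then have Le: "L e = \<mu> *\<^sub>R e" unfolding \<mu>_def by (rule parallel)
  \<comment> \<open>The linear functional that vanishes on \<open>e\<close> and is 1 on
    \<open>w\<close>; it turns out to be a left eigenvector of \<open>L\<close> for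
    \<open>lam\<close>.\<close>
  define l where "l v = \<phi> v - \<phi> e / \<beta> e * \<beta> v" for v
  have l_lin: "l (x + y) = l x + l y" "l (r *\<^sub>R x) = r * l x" for x y r
    by (simp_all add: l_def \<phi>_simps \<beta>_simps algebra_simps add_divide_distrib)
  have lw: "l w = 1" "l e = 0" using \<beta>e by (simp_all add: l_def w)
  define lam where "lam = l (L w)"
  define q where "q = \<beta> (L w) / \<beta> e"
  have dec: "v = l v *\<^sub>R w + (\<beta> v / \<beta> e) *\<^sub>R e" for v
    by (rule coord_eqI) (use \<beta>e in \<open>auto simp: \<phi>_simps \<beta>_simps w l_def\<close>)
  have Lw: "L w = lam *\<^sub>R w + q *\<^sub>R e" unfolding lam_def q_def by (rule dec)
  have lL: "l (L v) = lam * l v" for v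
  proof -
    have "l (L v) = l (L (l v *\<^sub>R w + (\<beta> v / \<beta> e) *\<^sub>R e))" using dec[of v] by simp
    then show ?thesis by (simp add: L_lin l_lin Le lw lam_def)
  qed
  have "lam ^ i = l ((L ^^ i) w)" for i by (induction i) (auto simp: lw lL)
  then have lam_pow: "\<bar>lam\<bar> ^ i = \<bar>l ((L ^^ i) w)\<bar>" for i by (metis power_abs)
  have eigen: "eigenvalue2 (matrix L) t \<longleftrightarrow> t = of_real \<mu> \<or> t = of_real lam" for t
  proof -
    have lin: "linear L" by (simp add: blinfun.bounded_linear_right bounded_linear.linear)
    have A: "matrix L *v v = L v" for v by (rule matrix_works[OF lin[folded linear_matrix_vector_mul_eq]])
    have row: "matrix L $ i $ 1 * v $ 1 + matrix L $ i $ 2 * v $ 2 = L v $ i" for i v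
      using A[of v] by (auto simp: matrix_vector_mult_def sum_2 vec_eq_iff)
    define a where "a i = l (axis i 1)" for i
    have l_a: "l v = a 1 * v $ 1 + a 2 * v $ 2" for v :: "real^2"
    proof -
      have "v = v $ 1 *\<^sub>R axis 1 1 + v $ 2 *\<^sub>R axis 2 1"
        by (auto simp: vec_eq_iff forall_2 axis_def)
      then have "l v = l (v $ 1 *\<^sub>R axis 1 1 + v $ 2 *\<^sub>R axis 2 1)" by simp
      then show ?thesis by (simp only: l_lin a_def mult.commute)
    qed
    have col: "L (axis j 1) $ i = matrix L $ i $ j" for i j by (simp add: matrix_def)
    have left: "a 1 * matrix L $ 1 $ j + a 2 * matrix L $ 2 $ j = lam * a j" for j
      using lL[of "axis j 1"] unfolding l_a[of "L (axis j 1)"] col a_def .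
    have "matrix L $ 1 $ 1 + matrix L $ 2 $ 2 = \<mu> + lam \<and> matrix L $ 1 $ 1 * matrix L $ 2 $ 2 - matrix L $ 1 $ 2 * matrix L $ 2 $ 1 = \<mu> * lam"
    proof (rule triangular_2)
      show "matrix L $ 1 $ 1 * e $ 1 + matrix L $ 1 $ 2 * e $ 2 = \<mu> * e $ 1"
        "matrix L $ 2 $ 1 * e $ 1 + matrix L $ 2 $ 2 * e $ 2 = \<mu> * e $ 2" by (simp_all add: row Le)
      show "a 1 * matrix L $ 1 $ 1 + a 2 * matrix L $ 2 $ 1 = lam * a 1"
        "a 1 * matrix L $ 1 $ 2 + a 2 * matrix L $ 2 $ 2 = lam * a 2" by (rule left)+
      show "a 1 * e $ 1 + a 2 * e $ 2 = 0" using l_a[of e] lw by simp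
      show "e $ 1 \<noteq> 0 \<or> e $ 2 \<noteq> 0" using e0(1) by (auto simp: vec_eq_iff forall_2)
      show "a 1 \<noteq> 0 \<or> a 2 \<noteq> 0" using l_a[of w] lw by auto
    qed
    then show ?thesis by (intro eigenvalue2_iff) auto
  qed
  \<comment> \<open>Iterates of \<open>w\<close> stay in the cone, and their
    \<open>\<phi>\<close>-values grow like \<open>K ^ (n * i)\<close>. As \<open>e\<close> is
    outside the closed cone, \<open>\<bar>l\<bar>\<close> is at least \<open>s\<close> times
    \<open>\<bar>\<phi>\<bar>\<close> on the cone, so the powers of \<open>lam\<close> must grow
    too.\<close>
  have big: "1 < \<bar>lam\<bar>"
  proof (rule ccontr)
    assume "\<not> 1 < \<bar>lam\<bar>"
    then have le1: "\<bar>lam\<bar> ^ i \<le> 1" for i by (simp add: power_le_one)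
    have "\<not> CC e"
    proof
      assume c: "CC e"
      obtain j where j: "n = Suc j" using n by (cases n) auto
      have "CC (DL j z e)" "(DL j z) e \<noteq> 0"
        using Dn_CC[OF c] Dn_inj e0(1) by auto
      then have "OC (L e)" unfolding j using D_OC by simp
      then show False using e0(2)[of 1] by simp
    qed
    then have *: "\<kappa> * \<bar>\<phi> e / \<beta> e\<bar> < 1" using \<beta>e by (simp add: CC_def field_simps)
    define s where "s = 1 - \<kappa> * \<bar>\<phi> e / \<beta> e\<bar>"
    have s: "s > 0" using * by (simp add: s_def)
    have "s * K ^ (n * i) \<le> 1" for i
    proof -
      let ?u = "(L ^^ i) w"
      have u: "CC ?u" "K ^ (n * i) \<le> \<bar>\<phi> ?u\<bar>"
        using Dn_CC[OF CC_w[OF w(2)], of "n * i" z] by (auto simp: L_pow w)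
      have "\<bar>\<phi> e / \<beta> e * \<beta> ?u\<bar> \<le> \<bar>\<phi> e / \<beta> e\<bar> * (\<kappa> * \<bar>\<phi> ?u\<bar>)"
        using u(1) unfolding CC_def abs_mult by (intro mult_left_mono) auto
      moreover have "\<bar>\<phi> ?u\<bar> \<le> \<bar>l ?u\<bar> + \<bar>\<phi> e / \<beta> e * \<beta> ?u\<bar>" unfolding l_def by linarith
      moreover have "s * \<bar>\<phi> ?u\<bar> = \<bar>\<phi> ?u\<bar> - \<bar>\<phi> e / \<beta> e\<bar> * (\<kappa> * \<bar>\<phi> ?u\<bar>)" by (simp add: s_def algebra_simps)
      ultimately have "s * \<bar>\<phi> ?u\<bar> \<le> \<bar>l ?u\<bar>" by linarith
      moreover have "s * K ^ (n * i) \<le> s * \<bar>\<phi> ?u\<bar>" using s u by (intro mult_left_mono) auto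
      ultimately show ?thesis using lam_pow[of i] le1[of i] by linarith
    qed
    moreover obtain i where "1 / s < K ^ i" using real_arch_pow[OF K] by blast
    moreover have "K ^ i \<le> K ^ (n * i)" using n K by (intro power_increasing) auto
    ultimately have "1 / s < K ^ (n * i)" "s * K ^ (n * i) \<le> 1" by auto
    then show False using s by (simp add: field_simps)
  qed
  \<comment> \<open>Pairs violating the estimate arbitrarily near \<open>z\<close> have a secant
    limit \<open>u\<close>. It is parallel to \<open>e\<close>, so \<open>L\<close> multiplies it by
    \<open>\<mu>\<close>, but the violation persists in the limit.\<close>
  have ratio: "\<exists>d>0. \<forall>x\<in>ball z d. \<forall>y\<in>ball z d. H x = H y \<longrightarrow> \<bar>\<beta> (S x) - \<beta> (S y) - \<mu> * (\<beta> x - \<beta> y)\<bar> \<le> r * \<bar>\<beta> x - \<beta> y\<bar>" if "r > 0" for r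
  proof (rule ccontr)
    assume c: "\<not> ?thesis"
    have "\<exists>x y. x \<in> ball z (inverse (real (Suc k))) \<and> y \<in> ball z (inverse (real (Suc k))) \<and> H x = H y \<and>
        r * \<bar>\<beta> x - \<beta> y\<bar> < \<bar>\<beta> (S x) - \<beta> (S y) - \<mu> * (\<beta> x - \<beta> y)\<bar>" for k
      using c by (meson inverse_positive_iff_positive of_nat_0_less_iff zero_less_Suc not_less)
    then obtain x y where xy: "\<And>k. dist z (x k) < inverse (real (Suc k))" "\<And>k. dist z (y k) < inverse (real (Suc k))"
      "\<And>k. H (x k) = H (y k)" "\<And>k. r * \<bar>\<beta> (x k) - \<beta> (y k)\<bar> < \<bar>\<beta> (S (x k)) - \<beta> (S (y k)) - \<mu> * (\<beta> (x k) - \<beta> (y k))\<bar>"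
      unfolding mem_ball by metis
    have to_z: "s \<longlonglongrightarrow> z" if "\<And>k. dist z (s k) < inverse (real (Suc k))" for s
      by (rule tendsto_dist_iff[THEN iffD2], rule tendsto_sandwich[OF _ _ tendsto_const LIMSEQ_inverse_real_of_nat])
        (use that in \<open>auto intro!: always_eventually less_imp_le simp: dist_commute\<close>)
    have ne: "x k \<noteq> y k" for k using xy(4)[of k] by auto
    obtain u p where up: "strict_mono (p :: nat \<Rightarrow> nat)" "u \<noteq> 0" "\<And>i. \<not> OC ((L ^^ i) u)"
      "(\<lambda>k. (x (p k) - y (p k)) /\<^sub>R norm (x (p k) - y (p k))) \<longlonglongrightarrow> u"
      "(\<lambda>k. (S (x (p k)) - S (y (p k))) /\<^sub>R norm (x (p k) - y (p k))) \<longlonglongrightarrow> L u"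
      by (rule fibre_direction[OF to_z[OF xy(1)] to_z[OF xy(2)] xy(3) ne]) blast
    have "u = (\<beta> u / \<beta> e) *\<^sub>R e" using up(3) by (rule parallel)
    then have "L u = \<mu> *\<^sub>R u" using Le by (metis L_lin(2) scaleR_left_commute)
    have "r * \<bar>\<beta> u\<bar> \<le> \<bar>\<beta> (L u) - \<mu> * \<beta> u\<bar>"
    proof (rule LIMSEQ_le)
      let ?N = "\<lambda>k. norm (x (p k) - y (p k))"
      show "(\<lambda>k. r * \<bar>\<beta> ((x (p k) - y (p k)) /\<^sub>R ?N k)\<bar>) \<longlonglongrightarrow> r * \<bar>\<beta> u\<bar>"
        by (intro tendsto_intros \<beta>.tendsto up)
      show "(\<lambda>k. \<bar>\<beta> ((S (x (p k)) - S (y (p k))) /\<^sub>R ?N k) - \<mu> * \<beta> ((x (p k) - y (p k)) /\<^sub>R ?N k)\<bar>) \<longlonglongrightarrow> \<bar>\<beta> (L u) - \<mu> * \<beta> u\<bar>"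
        by (intro tendsto_intros \<beta>.tendsto up)
      have "r * \<bar>\<beta> ((x k - y k) /\<^sub>R norm (x k - y k))\<bar> \<le> \<bar>\<beta> ((S (x k) - S (y k)) /\<^sub>R norm (x k - y k)) - \<mu> * \<beta> ((x k - y k) /\<^sub>R norm (x k - y k))\<bar>" for k
      proof -
        define N where "N = inverse (norm (x k - y k))"
        have N: "N \<ge> 0" by (simp add: N_def)
        have "r * \<bar>N * (\<beta> (x k) - \<beta> (y k))\<bar> = N * (r * \<bar>\<beta> (x k) - \<beta> (y k)\<bar>)"
          using N by (simp add: abs_mult)
        also have "\<dots> \<le> N * \<bar>\<beta> (S (x k)) - \<beta> (S (y k)) - \<mu> * (\<beta> (x k) - \<beta> (y k))\<bar>"
          using xy(4)[of k] N by (intro mult_left_mono) auto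
        also have "\<dots> = \<bar>N * (\<beta> (S (x k)) - \<beta> (S (y k)) - \<mu> * (\<beta> (x k) - \<beta> (y k)))\<bar>"
          using N by (simp add: abs_mult)
        also have "N * (\<beta> (S (x k)) - \<beta> (S (y k)) - \<mu> * (\<beta> (x k) - \<beta> (y k))) =
            N * (\<beta> (S (x k)) - \<beta> (S (y k))) - \<mu> * (N * (\<beta> (x k) - \<beta> (y k)))"
          by (simp add: algebra_simps)
        finally show ?thesis unfolding N_def[symmetric] \<beta>.scaleR \<beta>.diff real_scaleR_def .
      qed
      then show "\<exists>N. \<forall>k\<ge>N. r * \<bar>\<beta> ((x (p k) - y (p k)) /\<^sub>R ?N k)\<bar> \<le> \<bar>\<beta> ((S (x (p k)) - S (y (p k))) /\<^sub>R ?N k) - \<mu> * \<beta> ((x (p k) - y (p k)) /\<^sub>R ?N k)\<bar>"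
        by blast
    qed
    then have "r * \<bar>\<beta> u\<bar> \<le> 0" unfolding \<open>L u = \<mu> *\<^sub>R u\<close> by (simp add: \<beta>_simps)
    moreover have "\<beta> u \<noteq> 0" using not_OC_\<beta>[of u] up(2) up(3)[of 0] by simp
    ultimately show False using \<open>r > 0\<close> by (simp add: mult_le_0_iff)
  qed
  show ?thesis by (rule that[OF \<beta>e Le Lw big eigen ratio])
qed

end

section \<open>Density of repellers\<close>


lemma periodic_deck: "periodic_pt f n z \<longleftrightarrow> n \<ge> 1 \<and> (\<exists>S. deck n S \<and> S z = z)"
proof
  assume p: "periodic_pt f n z"
  then have "int_vec (- ((f ^^ n) z - z))" by (simp add: periodic_pt_def del: minus_diff_eq)
  from deckI[OF this, of n] show "n \<ge> 1 \<and> (\<exists>S. deck n S \<and> S z = z)"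
    using p by (auto simp: periodic_pt_def intro!: exI[of _ "\<lambda>x. (f ^^ n) x + - ((f ^^ n) z - z)"])
next
  assume "n \<ge> 1 \<and> (\<exists>S. deck n S \<and> S z = z)"
  then obtain k where "n \<ge> 1" "int_vec k" "(f ^^ n) z + k = z" by (auto simp: deck_def)
  moreover from this(3) have "(f ^^ n) z - z = - k" by (simp add: eq_neg_iff_add_eq_0 diff_add_eq)
  ultimately show "periodic_pt f n z" by (simp add: periodic_pt_def)
qed

text \<open>The derivative quantified over in \<open>saddle\<close> and \<open>repeller\<close> is
  unique and thus equals \<open>DL n z\<close>; \<open>Q\<close> stands for either condition on the
  eigenvalues.\<close>

lemma periodic_DL:
  "(\<exists>n A. periodic_pt f n z \<and> ((f ^^ n) has_derivative A) (at z) \<and> Q A) \<longleftrightarrow>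
    (\<exists>n S. deck n S \<and> n \<ge> 1 \<and> S z = z \<and> Q (DL n z))"
proof -
  have "((f ^^ n) has_derivative A) (at z) \<longleftrightarrow> A = DL n z" for n A
    using fpow_deriv has_derivative_unique by blast
  then show ?thesis by (auto simp: periodic_deck)
qed

lemma saddleI:
  assumes "deck n S" "n \<ge> 1" "S z = z"
    and eig: "\<And>l. eigenvalue2 (matrix (DL n z)) l \<longleftrightarrow> l = of_real \<mu> \<or> l = of_real lam"
    and "\<bar>\<mu>\<bar> < 1" "1 < \<bar>lam\<bar>"
  shows "saddle f z"
proof -
  have "cmod (of_real \<mu>) < 1" "1 < cmod (of_real lam)" using assms(5,6) by auto
  then show ?thesis unfolding saddle_def periodic_DL using assms(1-3) eig by (metis less_irrefl)
qed

lemma repellerI: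
  assumes "deck n S" "n \<ge> 1" "S z = z"
    and eig: "\<And>l. eigenvalue2 (matrix (DL n z)) l \<longleftrightarrow> l = of_real \<mu> \<or> l = of_real lam"
    and "1 < \<bar>\<mu>\<bar>" "1 < \<bar>lam\<bar>"
  shows "repeller f z"
proof -
  have "1 < cmod (of_real \<mu>)" "1 < cmod (of_real lam)" using assms(5,6) by auto
  then show ?thesis unfolding repeller_def periodic_DL using assms(1-3) eig by metis
qed

lemma deck_chain:
  assumes "deck n S" "deck n' S'"
  shows "(DL (n + n') x) v = (DL n (S' x)) (DL n' x v)"
proof -
  have "((S \<circ> S') has_derivative (DL n (S' x)) \<circ> (DL n' x)) (at x)"
    by (rule diff_chain_at[OF deck_deriv[OF assms(2)] deck_deriv[OF assms(1)]])
  then have "(DL (n + n') x) = (DL n (S' x)) \<circ> (DL n' x)"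
    using has_derivative_unique[OF deck_deriv[OF deck_comp[OF assms]]] by blast
  then show ?thesis by simp
qed

text \<open>\<open>T\<close> is triangular in the basis \<open>w\<close>, \<open>e\<close> with
  diagonal entries larger than 1 in modulus, so it expands a weighted norm \<open>N\<close> by some
  \<open>\<theta> > 1\<close>. As \<open>N\<close> is equivalent to the norm, a high power expands
  by any prescribed \<open>a\<close>.\<close>

lemma expanding_power:
  assumes \<beta>e: "\<beta> e \<noteq> 0" and Le: "blinfun_apply T e = \<mu> *\<^sub>R e" and Lw: "blinfun_apply T w = lam *\<^sub>R w + q *\<^sub>R e"
    and \<mu>: "1 < \<bar>\<mu>\<bar>" and lam: "1 < \<bar>lam\<bar>"
  shows "\<exists>i. \<forall>v. a * norm v \<le> norm ((blinfun_apply T ^^ i) v)"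
proof -
  define x where "x v = \<beta> v / \<beta> e" for v
  define y where "y v = \<phi> v - \<phi> e * x v" for v
  have dec: "v = y v *\<^sub>R w + x v *\<^sub>R e" for v
    by (rule coord_eqI) (use \<beta>e in \<open>auto simp: \<phi>_simps \<beta>_simps w x_def y_def\<close>)
  have xw: "x w = 0" "y w = 1" "x e = 1" "y e = 0" using \<beta>e by (simp_all add: x_def y_def w)
  have lin: "x (u + v) = x u + x v" "x (r *\<^sub>R v) = r * x v" "y (u + v) = y u + y v" "y (r *\<^sub>R v) = r * y v" for u v r
    by (simp_all add: x_def y_def \<phi>_simps \<beta>_simps algebra_simps add_divide_distrib)
  have Lv: "x (blinfun_apply T v) = \<mu> * x v + q * y v" "y (blinfun_apply T v) = lam * y v" for v
  proof -
    have "blinfun_apply T v = blinfun_apply T (y v *\<^sub>R w + x v *\<^sub>R e)" using dec[of v] by simp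
    also have "\<dots> = y v *\<^sub>R (lam *\<^sub>R w + q *\<^sub>R e) + x v *\<^sub>R (\<mu> *\<^sub>R e)"
      by (simp only: blinfun.add_right blinfun.scaleR_right Le Lw)
    finally show "x (blinfun_apply T v) = \<mu> * x v + q * y v" "y (blinfun_apply T v) = lam * y v"
      by (simp_all add: lin xw)
  qed
  \<comment> \<open>With this weight the off-diagonal entry \<open>q\<close> costs at most half of
    the gain \<open>\<bar>lam\<bar> - 1\<close> in the \<open>w\<close>-component, which leaves the
    factor \<open>(1 + \<bar>lam\<bar>) / 2\<close> in \<open>\<theta>\<close>.\<close>
  define C where "C = 1 + 2 * \<bar>q\<bar> / (\<bar>lam\<bar> - 1)"
  have "C * (\<bar>lam\<bar> - 1) = (\<bar>lam\<bar> - 1) + 2 * \<bar>q\<bar>" using lam by (simp add: C_def distrib_right)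
  then have C: "C \<ge> 1" "\<bar>q\<bar> \<le> C * (\<bar>lam\<bar> - 1) / 2" using lam by (auto simp: C_def)
  define N where "N v = \<bar>x v\<bar> + C * \<bar>y v\<bar>" for v
  define \<theta> where "\<theta> = min \<bar>\<mu>\<bar> ((1 + \<bar>lam\<bar>) / 2)"
  have \<theta>: "1 < \<theta>" "\<theta> \<le> \<bar>\<mu>\<bar>" "\<theta> \<le> (1 + \<bar>lam\<bar>) / 2" using \<mu> lam by (auto simp: \<theta>_def min_def)
  have "\<theta> * N v \<le> N (blinfun_apply T v)" for v
  proof -
    have "\<theta> * \<bar>x v\<bar> \<le> \<bar>\<mu>\<bar> * \<bar>x v\<bar>" using \<theta> by (intro mult_right_mono) auto
    moreover have "C * \<bar>y v\<bar> * \<theta> \<le> C * \<bar>y v\<bar> * ((1 + \<bar>lam\<bar>) / 2)" using \<theta> C by (intro mult_left_mono) auto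
    moreover have "\<bar>q\<bar> * \<bar>y v\<bar> \<le> C * (\<bar>lam\<bar> - 1) / 2 * \<bar>y v\<bar>" using C by (intro mult_right_mono) auto
    moreover have "\<bar>\<mu> * x v + q * y v\<bar> \<ge> \<bar>\<mu>\<bar> * \<bar>x v\<bar> - \<bar>q\<bar> * \<bar>y v\<bar>"
      unfolding abs_mult[symmetric] by linarith
    ultimately show ?thesis unfolding N_def Lv abs_mult by (simp add: algebra_simps)
  qed
  moreover have N_nonneg: "0 \<le> N v" for v using C by (simp add: N_def)
  ultimately have pow: "\<theta> ^ i * N v \<le> N ((blinfun_apply T ^^ i) v)" for i v
  proof (induction i)
    case (Suc i)
    have "\<theta> * (\<theta> ^ i * N v) \<le> \<theta> * N ((blinfun_apply T ^^ i) v)" using Suc \<theta> by (intro mult_left_mono) auto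
    also have "\<dots> \<le> N (blinfun_apply T ((blinfun_apply T ^^ i) v))" by (rule Suc.prems)
    finally show ?case by simp
  qed auto
  obtain C1 where C1: "C1 > 0" "\<And>v. \<bar>\<phi> v\<bar> \<le> norm v * C1" using \<phi>.pos_bounded by auto
  obtain C2 where C2: "C2 > 0" "\<And>v. \<bar>\<beta> v\<bar> \<le> norm v * C2" using \<beta>.pos_bounded by auto
  define A where "A = C2 / \<bar>\<beta> e\<bar> + C * (C1 + \<bar>\<phi> e\<bar> * (C2 / \<bar>\<beta> e\<bar>))"
  have A: "A > 0" using C1 C2 C \<beta>e by (auto simp: A_def intro!: add_pos_nonneg)
  have NA: "N v \<le> A * norm v" for v
  proof -
    have 1: "\<bar>x v\<bar> \<le> C2 / \<bar>\<beta> e\<bar> * norm v"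
      using C2(2)[of v] \<beta>e by (simp add: x_def divide_right_mono mult.commute)
    have "\<bar>y v\<bar> \<le> \<bar>\<phi> v\<bar> + \<bar>\<phi> e\<bar> * \<bar>x v\<bar>" unfolding y_def abs_mult[symmetric] by linarith
    also have "\<dots> \<le> norm v * C1 + \<bar>\<phi> e\<bar> * (C2 / \<bar>\<beta> e\<bar> * norm v)"
      using 1 C1(2)[of v] by (intro add_mono mult_left_mono) auto
    finally have "C * \<bar>y v\<bar> \<le> C * (norm v * C1 + \<bar>\<phi> e\<bar> * (C2 / \<bar>\<beta> e\<bar> * norm v))" using C by (intro mult_left_mono) auto
    then show ?thesis using 1 unfolding N_def A_def by (simp add: algebra_simps)
  qed
  define E where "E = norm w + norm e"
  have E: "E > 0" using w(1) by (auto simp: E_def intro!: add_pos_nonneg)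
  have NE: "norm v \<le> E * N v" for v
  proof -
    have "norm v \<le> \<bar>y v\<bar> * norm w + \<bar>x v\<bar> * norm e"
      by (subst dec[of v]) (metis norm_scaleR norm_triangle_ineq real_norm_def)
    also have "\<dots> \<le> N v * norm w + N v * norm e"
      using C mult_right_mono[OF C(1), of "\<bar>y v\<bar>"] by (intro add_mono mult_right_mono) (auto simp: N_def)
    finally show ?thesis by (simp add: E_def algebra_simps)
  qed
  obtain i where i: "\<bar>a\<bar> * (A * E) < \<theta> ^ i" using real_arch_pow[OF \<theta>(1)] by blast
  show ?thesis
  proof (intro exI[of _ i] allI)
    fix v
    have "\<bar>a\<bar> * (A * E) * N v \<le> \<theta> ^ i * N v" using i N_nonneg by (intro mult_right_mono) auto
    also have "\<dots> \<le> A * norm ((blinfun_apply T ^^ i) v)" using pow NA order_trans by blast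
    finally have "A * (\<bar>a\<bar> * E * N v) \<le> A * norm ((blinfun_apply T ^^ i) v)" by (simp add: mult_ac)
    then have "\<bar>a\<bar> * E * N v \<le> norm ((blinfun_apply T ^^ i) v)" using A by simp
    moreover have "\<bar>a\<bar> * norm v \<le> \<bar>a\<bar> * (E * N v)" using NE by (intro mult_left_mono) auto
    moreover have "a * norm v \<le> \<bar>a\<bar> * norm v" by (intro mult_right_mono) auto
    ultimately show "a * norm v \<le> norm ((blinfun_apply T ^^ i) v)" by (simp add: mult.assoc)
  qed
qed

end

context cone_map_qp begin

lemma repellers_dense:
  assumes R: "repeller f R" and U: "open U" "U \<noteq> {}"
  shows "\<exists>x\<in>U. repeller f x"
proof -
  obtain n0 S0 where S0: "deck n0 S0" "n0 \<ge> 1" "S0 R = R"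
    "\<And>l. eigenvalue2 (matrix (DL n0 R)) l \<Longrightarrow> 1 < cmod l"
    using R unfolding repeller_def periodic_DL by blast
  obtain \<mu> lam e q where sp: "\<beta> e \<noteq> 0" "(DL n0 R) e = \<mu> *\<^sub>R e"
    "(DL n0 R) w = lam *\<^sub>R w + q *\<^sub>R e" "1 < \<bar>lam\<bar>"
    "\<And>l. eigenvalue2 (matrix (DL n0 R)) l \<longleftrightarrow> l = of_real \<mu> \<or> l = of_real lam"
    by (rule periodic_splitting[OF S0(1-3)]) blast
  have "1 < \<bar>\<mu>\<bar>" using S0(4)[of "of_real \<mu>"] sp(5) by auto
  \<comment> \<open>Expansion by 4 at \<open>R\<close> itself leaves expansion by 2 on a whole ball
    around \<open>R\<close>.\<close>
  then obtain i where i: "\<And>v. 4 * norm v \<le> norm (((DL n0 R) ^^ i) v)"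
    using expanding_power[OF sp(1-3) _ sp(4), of 4] by blast
  define n where "n = n0 * i"
  define F where "F = S0 ^^ i"
  have F: "deck n F" unfolding n_def F_def by (rule deck_pow[OF S0(1)])
  have FR: "F R = R" unfolding F_def by (induction i) (auto simp: S0(3))
  obtain d where d: "d > 0" "\<And>x v. x \<in> ball R d \<Longrightarrow> 2 * norm v \<le> norm (DL n x v)"
    "\<And>x y. x \<in> ball R d \<Longrightarrow> y \<in> ball R d \<Longrightarrow> 2 * norm (x - y) \<le> norm (F x - F y)"
    using strict_lower_bound[OF deck_deriv[OF F] Dn_cont, of 4 R 2] i
    unfolding L_pow[OF S0(1-3)] n_def by auto
  have "\<exists>e>0. \<exists>J. J (F R) = R \<and> (\<forall>y\<in>ball (F R) e. J y \<in> ball R d \<and> F (J y) = y) \<and>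
     (\<forall>y\<in>ball (F R) e. \<forall>y'\<in>ball (F R) e. norm (J y - J y') \<le> norm (y - y') / 2)"
    by (rule expanding_local_inverse[OF deck_cont[OF F] d(1) _ d(3)]) auto
  then obtain e0 J where "e0 > 0" and J0: "J R = R" "\<And>y. y \<in> ball R e0 \<Longrightarrow> J y \<in> ball R d \<and> F (J y) = y"
     "\<And>y y'. y \<in> ball R e0 \<Longrightarrow> y' \<in> ball R e0 \<Longrightarrow> norm (J y - J y') \<le> norm (y - y') / 2"
    unfolding FR by blast
  define r where "r = min d e0"
  have r: "r > 0" "r \<le> d" "r \<le> e0" using d(1) \<open>e0 > 0\<close> by (auto simp: r_def)
  have Jpow: "dist R ((J ^^ j) y) \<le> dist R y / 2 ^ j \<and> (J ^^ j) y \<in> ball R r \<and> (F ^^ j) ((J ^^ j) y) = y"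
    if y: "y \<in> ball R r" for j y
  proof (induction j)
    case 0 then show ?case using y by simp
  next
    case (Suc j)
    let ?p = "(J ^^ j) y"
    have p: "?p \<in> ball R e0" "R \<in> ball R e0" using Suc r by auto
    have "dist R (J ?p) \<le> dist R ?p / 2" using J0(3)[OF p(2,1)] J0(1) by (simp add: dist_norm)
    moreover have "dist R ?p / 2 \<le> dist R y / 2 ^ j / 2" using Suc by (intro divide_right_mono) auto
    moreover have "F (J ?p) = ?p" using J0(2)[OF p(1)] by simp
    then have "(F ^^ Suc j) ((J ^^ Suc j) y) = y" using Suc by (simp add: funpow_swap1)
    moreover have "dist R ?p / 2 < r" using Suc r(1) zero_le_dist[of R ?p] by (simp del: zero_le_dist)
    ultimately show ?case by (simp add: mult_ac)
  qed
  have Jlip: "norm ((J ^^ j) y - (J ^^ j) y') \<le> norm (y - y') / 2 ^ j" if y: "y \<in> ball R r" "y' \<in> ball R r" for j y y'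
  proof (induction j)
    case (Suc j)
    have "(J ^^ j) y \<in> ball R e0" "(J ^^ j) y' \<in> ball R e0" using Jpow[OF y(1), of j] Jpow[OF y(2), of j] r by auto
    from J0(3)[OF this] have "norm ((J ^^ Suc j) y - (J ^^ Suc j) y') \<le> norm ((J ^^ j) y - (J ^^ j) y') / 2" by simp
    also have "\<dots> \<le> norm (y - y') / 2 ^ j / 2" using Suc by (intro divide_right_mono) auto
    finally show ?case by (simp add: mult_ac)
  qed auto
  have Flow: "2 ^ j * norm v \<le> norm (DL (n * j) ((J ^^ j) y) v)" if y: "y \<in> ball R r" for j y v
  proof (induction j arbitrary: v)
    case (Suc j)
    let ?p = "(J ^^ Suc j) y"
    have p: "?p \<in> ball R d" "F ?p = (J ^^ j) y" using Jpow[OF y, of "Suc j"] Jpow[OF y, of j] J0(2)[of "(J ^^ j) y"] r by auto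
    have "2 ^ Suc j * norm v \<le> 2 ^ j * norm (DL n ?p v)"
      using d(2)[OF p(1), of v] by simp
    also have "\<dots> \<le> norm (DL (n * j) (F ?p) (DL n ?p v))"
      unfolding p(2) by (rule Suc.IH)
    also have "\<dots> = norm (DL (n * j + n) ?p v)"
      by (subst deck_chain[OF deck_pow[OF F] F]) simp
    finally show ?case by (simp add: add.commute)
  qed auto
  \<comment> \<open>The loop runs from \<open>u\<close> in \<open>U\<close> exactly onto
    \<open>R\<close>, and from \<open>p\<close> near \<open>R\<close> exactly onto \<open>u\<close>.
    The gap between \<open>R\<close> and \<open>p\<close> is bridged by turns of \<open>F\<close>,
    through its contracting inverse branch \<open>J\<close>.\<close>
  obtain n1 \<Psi>1 u where \<Psi>1: "deck n1 \<Psi>1" "u \<in> U" "\<Psi>1 u = R" using cover[OF U] by blast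
  obtain n2 \<Psi>2 p where \<Psi>2: "deck n2 \<Psi>2" "p \<in> ball R r" "\<Psi>2 p = u"
    using cover[OF open_ball, of R r u] r(1) by (metis ball_eq_empty not_le)
  obtain s where s: "s > 0" "ball u s \<subseteq> U" using openE[OF U(1) \<Psi>1(2)] by blast
  obtain a1 d1 where d1: "a1 > 0" "d1 > 0"
    "\<And>x v. x \<in> ball u d1 \<Longrightarrow> a1 * norm v \<le> norm (DL n1 x v)"
    "\<And>x y. x \<in> ball u d1 \<Longrightarrow> y \<in> ball u d1 \<Longrightarrow> a1 * norm (x - y) \<le> norm (\<Psi>1 x - \<Psi>1 y)"
    using deck_local[OF \<Psi>1(1), of u] by metis
  obtain a2 d2 where d2: "a2 > 0" "d2 > 0"
    "\<And>x v. x \<in> ball p d2 \<Longrightarrow> a2 * norm v \<le> norm (DL n2 x v)"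
    "\<And>x y. x \<in> ball p d2 \<Longrightarrow> y \<in> ball p d2 \<Longrightarrow> a2 * norm (x - y) \<le> norm (\<Psi>2 x - \<Psi>2 y)"
    using deck_local[OF \<Psi>2(1), of p] by metis
  have "\<exists>e>0. \<exists>J. J (\<Psi>1 u) = u \<and> (\<forall>y\<in>ball (\<Psi>1 u) e. J y \<in> ball u (min d1 s) \<and> \<Psi>1 (J y) = y) \<and>
     (\<forall>y\<in>ball (\<Psi>1 u) e. \<forall>y'\<in>ball (\<Psi>1 u) e. norm (J y - J y') \<le> norm (y - y') / a1)"
    by (rule expanding_local_inverse[OF deck_cont[OF \<Psi>1(1)] _ d1(1)]) (use d1 s in auto)
  then obtain e1 J1 where J1: "e1 > 0" "J1 R = u" "\<And>y. y \<in> ball R e1 \<Longrightarrow> J1 y \<in> ball u (min d1 s) \<and> \<Psi>1 (J1 y) = y"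
     "\<And>y y'. y \<in> ball R e1 \<Longrightarrow> y' \<in> ball R e1 \<Longrightarrow> norm (J1 y - J1 y') \<le> norm (y - y') / a1"
    unfolding \<Psi>1(3) by blast
  \<comment> \<open>The radius \<open>r - dist R p\<close> keeps the inverse branch
    \<open>J2\<close> inside \<open>ball R r\<close>, where the estimates on powers of
    \<open>J\<close> hold.\<close>
  have "\<exists>e>0. \<exists>J. J (\<Psi>2 p) = p \<and> (\<forall>y\<in>ball (\<Psi>2 p) e. J y \<in> ball p (min d2 (r - dist R p)) \<and> \<Psi>2 (J y) = y) \<and>
     (\<forall>y\<in>ball (\<Psi>2 p) e. \<forall>y'\<in>ball (\<Psi>2 p) e. norm (J y - J y') \<le> norm (y - y') / a2)"
    by (rule expanding_local_inverse[OF deck_cont[OF \<Psi>2(1)] _ d2(1)]) (use d2 \<Psi>2(2) in auto)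
  then obtain e2 J2 where J2: "e2 > 0" "\<And>y. y \<in> ball u e2 \<Longrightarrow> J2 y \<in> ball p (min d2 (r - dist R p)) \<and> \<Psi>2 (J2 y) = y"
     "\<And>y y'. y \<in> ball u e2 \<Longrightarrow> y' \<in> ball u e2 \<Longrightarrow> norm (J2 y - J2 y') \<le> norm (y - y') / a2"
    unfolding \<Psi>2(3) by blast
  have J2r: "J2 y \<in> ball R r" if "y \<in> ball u e2" for y
    using J2(2)[OF that] dist_triangle[of R "J2 y" p] by auto
  define \<delta> where "\<delta> = e2 / 2"
  have \<delta>: "\<delta> > 0" "cball u \<delta> \<subseteq> ball u e2" using J2(1) by (auto simp: \<delta>_def)
  \<comment> \<open>A sum of positive terms, so that one \<open>N\<close> meets three demands:
    landing in the domain of \<open>J1\<close>, mapping \<open>cball u \<delta>\<close> into itself,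
    and outweighing any contraction in the passages \<open>\<Psi>1\<close> and
    \<open>\<Psi>2\<close>.\<close>
  obtain N where N: "r / e1 + r / (a1 * \<delta>) + 2 / (a1 * a2) < 2 ^ N" using real_arch_pow[of 2] by auto
  have pos: "r / e1 > 0" "r / (a1 * \<delta>) > 0" "2 / (a1 * a2) > 0" using r J1(1) d1(1) d2(1) \<delta> by auto
  have N1: "r / e1 < 2 ^ N" "r / (a1 * \<delta>) < 2 ^ N" "2 / (a1 * a2) < 2 ^ N" using N pos by linarith+
  have N2: "r / 2 ^ N < e1" "r / 2 ^ N / a1 < \<delta>" "2 < a2 * 2 ^ N * a1"
    using N1 J1(1) d1(1) d2(1) \<delta>(1) by (auto simp: field_simps)
  \<comment> \<open>The inverse branch of the loop map \<open>T\<close> defined below; a fixed point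
    of \<open>I\<close> is one of \<open>T\<close>.\<close>
  define I where "I y = J1 ((J ^^ N) (J2 y))" for y
  have JN: "(J ^^ N) y \<in> ball R e1" "dist R ((J ^^ N) y) \<le> r / 2 ^ N" if y: "y \<in> ball R r" for y
  proof -
    have "dist R y / 2 ^ N \<le> r / 2 ^ N" using y by (intro divide_right_mono) auto
    then show "dist R ((J ^^ N) y) \<le> r / 2 ^ N" using Jpow[OF y, of N] by linarith
    then show "(J ^^ N) y \<in> ball R e1" using N2(1) by simp
  qed
  have "\<exists>!x\<in>cball u \<delta>. I x = x"
  proof (rule Banach_fix)
    show "complete (cball u \<delta>)" by (simp add: complete_eq_closed)
    show "cball u \<delta> \<noteq> {}" using \<delta> by simp
    show "0 \<le> (1 / 2 :: real)" "1 / 2 < (1 :: real)" by auto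
    show "I ` cball u \<delta> \<subseteq> cball u \<delta>"
    proof (rule image_subsetI)
      fix y assume "y \<in> cball u \<delta>"
      then have y: "J2 y \<in> ball R r" using \<delta>(2) J2r by blast
      have "norm (J1 R - I y) \<le> norm (R - (J ^^ N) (J2 y)) / a1"
        unfolding I_def by (rule J1(4)) (use JN[OF y] J1(1) in auto)
      also have "\<dots> \<le> r / 2 ^ N / a1" using JN(2)[OF y] d1(1) by (intro divide_right_mono) (auto simp: dist_norm)
      finally show "I y \<in> cball u \<delta>" using N2(2) J1(2) by (simp add: dist_norm)
    qed
    fix y y' assume "y \<in> cball u \<delta>" "y' \<in> cball u \<delta>"
    then have y: "y \<in> ball u e2" "y' \<in> ball u e2" using \<delta>(2) by auto
    have "norm (I y - I y') \<le> norm ((J ^^ N) (J2 y) - (J ^^ N) (J2 y')) / a1"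
      unfolding I_def by (rule J1(4)) (use JN J2r y in auto)
    also have "\<dots> \<le> norm (J2 y - J2 y') / 2 ^ N / a1"
      using Jlip[OF J2r[OF y(1)] J2r[OF y(2)], of N] d1(1) by (intro divide_right_mono) auto
    also have "\<dots> \<le> norm (y - y') / a2 / 2 ^ N / a1"
      using J2(3)[OF y] d1(1) by (intro divide_right_mono) auto
    also have "\<dots> = norm (y - y') * (1 / (a2 * 2 ^ N * a1))" by simp
    also have "\<dots> \<le> norm (y - y') * (1 / 2)"
      using N2(3) by (intro mult_left_mono divide_left_mono) auto
    finally show "dist (I y) (I y') \<le> 1 / 2 * dist y y'" by (simp add: dist_norm)
  qed
  then obtain z where z: "z \<in> cball u \<delta>" "I z = z" by blast
  then have "z \<in> ball u e2" using \<delta>(2) by blast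
  note j2 = J2(2)[OF this] and j2r = J2r[OF this]
  let ?p = "(J ^^ N) (J2 z)"
  have zp: "z = J1 ?p" using z(2) by (simp add: I_def)
  have z1: "z \<in> ball u (min d1 s)" "\<Psi>1 z = ?p" using J1(3)[OF JN(1)[OF j2r]] zp by metis+
  have Fp: "(F ^^ N) ?p = J2 z" using Jpow[OF j2r] by blast
  define T where "T = \<Psi>2 \<circ> ((F ^^ N) \<circ> \<Psi>1)"
  have mid: "deck (n * N + n1) ((F ^^ N) \<circ> \<Psi>1)" by (rule deck_comp[OF deck_pow[OF F] \<Psi>1(1)])
  have T: "deck (n2 + (n * N + n1)) T" unfolding T_def by (rule deck_comp[OF \<Psi>2(1) mid])
  have Tz: "T z = z" using z1(2) Fp j2 by (simp add: T_def)
  have low: "2 * norm v \<le> norm (DL (n2 + (n * N + n1)) z v)" for v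
  proof -
    have "2 * norm v \<le> a2 * 2 ^ N * a1 * norm v" using N2(3) by (intro mult_right_mono) auto
    also have "\<dots> = a2 * (2 ^ N * (a1 * norm v))" by simp
    also have "\<dots> \<le> a2 * (2 ^ N * norm (DL n1 z v))"
      using d1(3)[of z v] z1(1) d2(1) by (intro mult_left_mono) auto
    also have "\<dots> \<le> a2 * norm (DL (n * N) ?p (DL n1 z v))"
      using Flow[OF j2r, of N] d2(1) by (intro mult_left_mono) auto
    also have "\<dots> \<le> norm (DL n2 (J2 z) (DL (n * N) ?p (DL n1 z v)))"
      using d2(3)[of "J2 z"] j2 by auto
    also have "\<dots> = norm (DL (n2 + (n * N + n1)) z v)"
      unfolding deck_chain[OF \<Psi>2(1) mid] deck_chain[OF deck_pow[OF F] \<Psi>1(1)] by (simp add: z1(2) Fp)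
    finally show ?thesis .
  qed
  \<comment> \<open>A loop of length 0 would have the identity as derivative, which does not double
    lengths.\<close>
  have n_pos: "n2 + (n * N + n1) \<ge> 1"
  proof (rule ccontr)
    assume "\<not> ?thesis"
    then have 0: "n2 + (n * N + n1) = 0" by linarith
    have "w = 0" using low[of w] unfolding 0 by simp
    then show False using w(1) by (simp add: \<phi>.zero)
  qed
  obtain \<mu>' lam' e' where sp': "\<beta> e' \<noteq> 0" "(DL (n2 + (n * N + n1)) z) e' = \<mu>' *\<^sub>R e'" "1 < \<bar>lam'\<bar>"
    "\<And>l. eigenvalue2 (matrix (DL (n2 + (n * N + n1)) z)) l \<longleftrightarrow> l = of_real \<mu>' \<or> l = of_real lam'"
    by (rule periodic_splitting[OF T n_pos Tz]) blast
  have "e' \<noteq> 0" using sp'(1) by auto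
  then have "1 < \<bar>\<mu>'\<bar>" using low[of e'] by (simp add: sp'(2))
  then have "repeller f z" using repellerI[OF T n_pos Tz sp'(4)] sp'(3) by blast
  moreover have "z \<in> U" using z1(1) s(2) by auto
  ultimately show ?thesis by blast
qed

end

section \<open>The unstable set of a periodic point\<close>

context cone_map begin

lemma X_near:
  assumes "open V" "X t b \<in> V"
  obtains e where "e > 0" "\<And>t' b'. \<bar>t' - t\<bar> < e \<Longrightarrow> \<bar>b' - b\<bar> < e \<Longrightarrow> X t' b' \<in> V"
proof -
  have "open (inv H\<beta> -` V)" by (rule open_vimage[OF assms(1) inv_H\<beta>_cont])
  moreover have "(t, b) \<in> inv H\<beta> -` V" using assms(2) by (simp add: X_def)
  ultimately obtain A B' where AB: "open A" "open B'" "t \<in> A" "b \<in> B'" "A \<times> B' \<subseteq> inv H\<beta> -` V"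
    unfolding open_prod_def by (metis mem_Sigma_iff)
  obtain e1 where e1: "e1 > 0" "ball t e1 \<subseteq> A" using openE[OF AB(1,3)] by blast
  obtain e2 where e2: "e2 > 0" "ball b e2 \<subseteq> B'" using openE[OF AB(2,4)] by blast
  show ?thesis
  proof (rule that[of "min e1 e2"])
    fix t' b' assume "\<bar>t' - t\<bar> < min e1 e2" "\<bar>b' - b\<bar> < min e1 e2"
    then have "t' \<in> ball t e1" "b' \<in> ball b e2" by (auto simp: dist_real_def)
    then have "(t', b') \<in> inv H\<beta> -` V" using AB(5) e1(2) e2(2) by blast
    then show "X t' b' \<in> V" by (simp add: X_def)
  qed (use e1 e2 in auto)
qed

lemma fibre_norm: "H x = H y \<Longrightarrow> norm (x - y) \<le> (norm w / \<kappa> + norm k1) * \<bar>\<beta> x - \<beta> y\<bar>"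
proof (cases "x = y")
  case False
  assume "H x = H y"
  then have "\<not> CC (x - y)" using H_CC_eq False by blast
  then show ?thesis using notCC_norm[of "x - y"] by (simp add: CC_def \<beta>_simps)
qed auto

lemma deck_fibre_Lipschitz:
  assumes "deck n S"
  obtains C where "C > 0" "\<And>x y. H x = H y \<Longrightarrow> \<bar>\<beta> (S x) - \<beta> (S y)\<bar> \<le> C * \<bar>\<beta> x - \<beta> y\<bar>"
proof -
  obtain C2 where C2: "C2 > 0" "\<And>v. \<bar>\<beta> v\<bar> \<le> norm v * C2" using \<beta>.pos_bounded by auto
  define C3 where "C3 = norm w / \<kappa> + norm k1"
  have C3: "C3 > 0" using k1(3) \<kappa> by (auto simp: C3_def intro!: add_nonneg_pos simp: \<beta>.zero)
  show ?thesis
  proof (rule that[of "K1 ^ n * C3 * C2"])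
    show "0 < K1 ^ n * C3 * C2" using C3 C2 K1 by simp
    fix x y assume H: "H x = H y"
    have "\<bar>\<beta> (S x) - \<beta> (S y)\<bar> \<le> norm (S x - S y) * C2" using C2(2)[of "S x - S y"] by (simp add: \<beta>_simps)
    also have "\<dots> \<le> K1 ^ n * norm (x - y) * C2"
      using deck_fibre[OF assms H] C2 by (intro mult_right_mono) auto
    also have "\<dots> \<le> K1 ^ n * (C3 * \<bar>\<beta> x - \<beta> y\<bar>) * C2"
      using fibre_norm[OF H] C2 K1 unfolding C3_def by (intro mult_right_mono mult_left_mono) auto
    finally show "\<bar>\<beta> (S x) - \<beta> (S y)\<bar> \<le> K1 ^ n * C3 * C2 * \<bar>\<beta> x - \<beta> y\<bar>" by (simp add: mult_ac)
  qed
qed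

lemma \<phi>_H: "\<bar>\<phi> x - \<phi> y\<bar> \<le> \<bar>H x - H y\<bar> + 2 * B"
  using H_bound[of x] H_bound[of y] by linarith

definition C0 :: real where "C0 = norm w + \<kappa> * norm k1"

lemma C0_nonneg: "0 \<le> C0" using \<kappa> by (simp add: C0_def)

text \<open>Cone expansion read backwards: if the \<open>H\<close>-values after \<open>n\<close>
  steps are at bounded distance, then points in cone position were within order
  \<open>1 / K ^ n\<close> of each other.\<close>

lemma CC_deck_norm:
  assumes "deck n S" "CC (x - y)"
  shows "norm (x - y) \<le> C0 * (\<bar>H (S x) - H (S y)\<bar> + 2 * B) / K ^ n"
proof -
  have "K ^ n * \<bar>\<phi> (x - y)\<bar> \<le> \<bar>H (S x) - H (S y)\<bar> + 2 * B"
    using deck_CC[OF assms] \<phi>_H[of "S x" "S y"] by (simp add: \<phi>_simps)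
  then have "\<bar>\<phi> (x - y)\<bar> \<le> (\<bar>H (S x) - H (S y)\<bar> + 2 * B) / K ^ n" using K by (simp add: field_simps)
  then have "C0 * \<bar>\<phi> (x - y)\<bar> \<le> C0 * ((\<bar>H (S x) - H (S y)\<bar> + 2 * B) / K ^ n)" using C0_nonneg by (intro mult_left_mono)
  then show ?thesis using CC_norm[OF assms(2)] by (simp add: C0_def)
qed

context
  fixes n S P
  assumes S: "deck n S" and n: "n \<ge> 1" and fix_P: "S P = P"
begin

text \<open>Encodes the global unstable curve of \<open>P\<close> by sequences: a point lies on it
  if it is \<open>y 0\<close> for a backward orbit \<open>y\<close> under \<open>S\<close> that
  stays in the cone with vertex \<open>P\<close>.\<close>

definition Wu_seq :: "(nat \<Rightarrow> real^2) \<Rightarrow> bool" where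
  "Wu_seq y \<longleftrightarrow> (\<forall>i. S (y (Suc i)) = y i \<and> CC (y i - P))"

lemma S_pow_P: "(S ^^ i) P = P"
  by (induction i) (auto simp: fix_P)

lemma Wu_seq_pow: "Wu_seq y \<Longrightarrow> (S ^^ i) (y (i + j)) = y j"
  by (induction i) (auto simp: Wu_seq_def funpow_swap1)

lemma K_n: "1 < K ^ n" "0 < (K1 / K) ^ n" "(K1 / K) ^ n < 1"
  using n K K1 by (auto simp: one_less_power power_strict_decreasing power_less_one_iff)

lemma Wu_seq_norm: "Wu_seq y \<Longrightarrow> norm (y i - P) \<le> C0 * (\<bar>H (y 0) - H P\<bar> + 2 * B) / K ^ (n * i)"
  using CC_deck_norm[OF deck_pow[OF S, of i], of "y i" P] Wu_seq_pow[of y i 0]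
  by (simp add: S_pow_P Wu_seq_def)

lemma Wu_seq_lim: assumes "Wu_seq y" shows "y \<longlonglongrightarrow> P"
proof -
  have lim: "(\<lambda>i. C0 * (\<bar>H (y 0) - H P\<bar> + 2 * B) * (1 / K ^ n) ^ i) \<longlonglongrightarrow> C0 * (\<bar>H (y 0) - H P\<bar> + 2 * B) * 0"
    using K_n by (intro tendsto_intros LIMSEQ_power_zero) auto
  have bd: "norm (y i - P) \<le> C0 * (\<bar>H (y 0) - H P\<bar> + 2 * B) * (1 / K ^ n) ^ i" for i
    using Wu_seq_norm[OF assms, of i] by (simp add: power_mult power_one_over divide_inverse power_inverse)
  have "(\<lambda>i. y i - P) \<longlonglongrightarrow> 0"
    by (rule Lim_null_comparison[OF always_eventually[OF allI[OF bd]]]) (use lim in simp)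
  then show ?thesis by (simp add: LIM_zero_iff)
qed

text \<open>Domination \<^term>\<open>K1 < K\<close> makes the unstable set a single curve in the cone direction.\<close>

lemma Wu_seq_CC:
  assumes y: "Wu_seq y" and y': "Wu_seq y'"
  shows "CC (y 0 - y' 0)"
proof (rule ccontr)
  assume c: "\<not> CC (y 0 - y' 0)"
  define A where "A = C0 * (\<bar>H (y 0) - H P\<bar> + 2 * B) + C0 * (\<bar>H (y' 0) - H P\<bar> + 2 * B)"
  have "norm (y 0 - y' 0) \<le> A * ((K1 / K) ^ n) ^ i" for i
  proof -
    have "norm (y 0 - y' 0) \<le> K1 ^ (n * i) * norm (y i - y' i)"
      using deck_notCC[OF deck_pow[OF S], of i "y i" "y' i"] c Wu_seq_pow[OF y, of i 0] Wu_seq_pow[OF y', of i 0] by simp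
    also have "norm (y i - y' i) \<le> norm (y i - P) + norm (y' i - P)"
      using norm_triangle_ineq4[of "y i - P" "y' i - P"] by simp
    also have "\<dots> \<le> A / K ^ (n * i)" using Wu_seq_norm[OF y, of i] Wu_seq_norm[OF y', of i] by (simp add: A_def add_divide_distrib)
    finally have "norm (y 0 - y' 0) \<le> K1 ^ (n * i) * (A / K ^ (n * i))" using K1 by (simp add: mult_left_mono)
    then show ?thesis by (simp add: power_mult[symmetric] power_divide mult_ac)
  qed
  moreover have "(\<lambda>i. A * ((K1 / K) ^ n) ^ i) \<longlonglongrightarrow> A * 0"
    using K_n by (intro tendsto_intros LIMSEQ_power_zero) auto
  ultimately have "norm (y 0 - y' 0) \<le> A * 0" by (intro LIMSEQ_le_const) auto
  then show False using c by simp
qed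

text \<open>Graph transform, starting from the line through \<open>P\<close> in direction
  \<open>w\<close>: \<open>Y i j\<close> pushes a point of it forward \<open>j\<close> times, chosen
  so that \<open>i\<close> further steps reach the fibre over \<open>t\<close>. Successive
  approximations come from points of a common fibre at distance of order
  \<open>1 / K ^ (n * j)\<close>, which \<open>S ^^ j\<close> stretches at most by
  \<open>K1 ^ (n * j)\<close>; hence they converge.\<close>

lemma Wu_seq_exists: "\<exists>y. Wu_seq y \<and> H (y 0) = t"
proof -
  define l where "l k = X (H P + (t - H P) / m ^ (n * k)) (\<beta> P)" for k
  define Y where "Y i j = (S ^^ j) (l (i + j))" for i j
  have l: "CC (l k - P)" "H ((S ^^ k) (l k)) = t" for k
    using deck_H'[OF deck_pow[OF S] S_pow_P, of k "l k"] m_pow by (auto simp: l_def CC_w \<beta>_simps)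
  have Y_CC: "CC (Y i j - P)" for i j
    using deck_CC[OF deck_pow[OF S, of j] l(1)[of "i + j"]] by (simp add: Y_def S_pow_P)
  have Y_S: "S (Y (Suc i) j) = Y i (Suc j)" for i j by (simp add: Y_def)
  have Y_H: "H ((S ^^ i) (Y i j)) = t" for i j
    using l(2)[of "i + j"] by (simp add: Y_def funpow_add[symmetric] flip: comp_apply[of "S ^^ i" "S ^^ j"])
  define A where "A = C0 * (\<bar>t - H P\<bar> + 2 * B)"
  have A: "A \<ge> 0" using C0_nonneg B_nonneg by (simp add: A_def)
  have near: "norm (q - P) \<le> A / K ^ (n * k)" if "CC (q - P)" "H ((S ^^ k) q) = t" for q k
    using CC_deck_norm[OF deck_pow[OF S] that(1), of k] that(2) by (simp add: S_pow_P A_def)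
  have step: "norm (Y i (Suc j) - Y i j) \<le> 2 * A * ((K1 / K) ^ n) ^ j" for i j
  proof -
    let ?p = "S (l (Suc (i + j)))" and ?q = "l (i + j)"
    have p: "CC (?p - P)" using deck_CC[OF S l(1)[of "Suc (i + j)"]] by (simp add: fix_P)
    have pH: "H ((S ^^ (i + j)) ?p) = t" using l(2)[of "Suc (i + j)"] by (simp add: funpow_swap1)
    have "H ?p = H ?q"
      using deck_H[OF deck_pow[OF S, of "i + j"], of ?p ?q] pH l(2)[of "i + j"] m_nz by simp
    then have "norm ((S ^^ j) ?p - (S ^^ j) ?q) \<le> K1 ^ (n * j) * norm (?p - ?q)"
      by (rule deck_fibre[OF deck_pow[OF S]])
    also have "norm (?p - ?q) \<le> norm (?p - P) + norm (?q - P)"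
      using norm_triangle_ineq4[of "?p - P" "?q - P"] by simp
    also have "\<dots> \<le> A / K ^ (n * (i + j)) + A / K ^ (n * (i + j))"
      by (intro add_mono near p pH l)
    also have "\<dots> \<le> 2 * A / K ^ (n * j)"
    proof -
      have "K ^ (n * j) \<le> K ^ (n * (i + j))" using K by (intro power_increasing) auto
      then have "A / K ^ (n * (i + j)) \<le> A / K ^ (n * j)" using A K by (intro divide_left_mono) auto
      then show ?thesis by simp
    qed
    finally have "norm ((S ^^ j) ?p - (S ^^ j) ?q) \<le> K1 ^ (n * j) * (2 * A / K ^ (n * j))" using K1 by (simp add: mult_left_mono)
    then show ?thesis by (simp add: Y_def power_mult[symmetric] power_divide funpow_swap1 mult_ac)
  qed
  have "\<exists>L. Y i \<longlonglongrightarrow> L" for i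
  proof -
    have "summable (\<lambda>j. Y i (Suc j) - Y i j)"
      by (rule summable_comparison_test'[of "\<lambda>j. 2 * A * ((K1 / K) ^ n) ^ j" 0])
        (use step K_n in \<open>auto intro!: summable_mult summable_geometric\<close>)
    from tendsto_add[OF summable_LIMSEQ[OF this] tendsto_const[of "Y i 0"]] show ?thesis
      unfolding sum_lessThan_telescope by auto
  qed
  then obtain y where y: "\<And>i. Y i \<longlonglongrightarrow> y i" by metis
  have "Wu_seq y" unfolding Wu_seq_def
  proof (intro allI conjI)
    fix i
    have "(\<lambda>j. S (Y (Suc i) j)) \<longlonglongrightarrow> S (y (Suc i))"
      by (rule continuous_on_tendsto_compose[OF deck_cont[OF S, of UNIV] y]) auto
    then show "S (y (Suc i)) = y i"
      unfolding Y_S using LIMSEQ_Suc[OF y[of i]] LIMSEQ_unique by blast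
    have "\<bar>\<beta> (y i - P)\<bar> \<le> \<kappa> * \<bar>\<phi> (y i - P)\<bar>"
    proof (rule LIMSEQ_le)
      show "(\<lambda>j. \<bar>\<beta> (Y i j - P)\<bar>) \<longlonglongrightarrow> \<bar>\<beta> (y i - P)\<bar>" by (intro tendsto_intros \<beta>.tendsto y)
      show "(\<lambda>j. \<kappa> * \<bar>\<phi> (Y i j - P)\<bar>) \<longlonglongrightarrow> \<kappa> * \<bar>\<phi> (y i - P)\<bar>" by (intro tendsto_intros \<phi>.tendsto y)
      show "\<exists>N. \<forall>j\<ge>N. \<bar>\<beta> (Y i j - P)\<bar> \<le> \<kappa> * \<bar>\<phi> (Y i j - P)\<bar>" using Y_CC unfolding CC_def by blast
    qed
    then show "CC (y i - P)" by (simp add: CC_def)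
  qed
  moreover have "H (y 0) = t"
  proof -
    have "(\<lambda>j. H (Y 0 j)) \<longlonglongrightarrow> H (y 0)"
      by (rule continuous_on_tendsto_compose[OF H_cont[of UNIV] y]) auto
    moreover have "H (Y 0 j) = t" for j using Y_H[of 0 j] by simp
    ultimately show ?thesis by (simp add: LIMSEQ_const_iff)
  qed
  ultimately show ?thesis by blast
qed

end

end

context cone_map_qp begin

text \<open>Pull \<open>a\<close> back next to the quasiperiodic fibre, where the unstable curve is dense. In \<open>i\<close> steps
  errors along fibres grow at most by \<open>K1 ^ i\<close>, but the distance to that fibre was only \<open>K ^ - i\<close>.\<close>

lemma Wu_dense:
  assumes S: "deck n S" and n: "n \<ge> 1" and fix_P: "S P = P" and e: "e > 0"
  shows "\<exists>y k R. Wu_seq S P y \<and> deck k R \<and> H (R (y 0)) = H a \<and> norm (R (y 0) - a) < e"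
proof -
  obtain g G where G: "g \<ge> 1" "deck g G" "\<And>x j. H ((G ^^ j) x) = c + m ^ (g * j) * (H x - c)" using G_ex by blast
  \<comment> \<open>Up to the factor \<open>1 / K ^ N\<close>, \<open>A\<close> bounds each of the
    two cone segments joining the fibre of a preimage \<open>a'\<close> of \<open>a\<close> to the
    fibre over \<open>c\<close>. The 1 in \<open>2 * A + 1\<close> pays for the approximation inside
    the latter fibre.\<close>
  define A where "A = C0 * (\<bar>H a - c\<bar> + 2 * B)"
  obtain i where i: "(2 * A + 1) * (K1 / K) ^ i < e"
  proof -
    have "(\<lambda>i. (2 * A + 1) * (K1 / K) ^ i) \<longlonglongrightarrow> (2 * A + 1) * 0"
      using K1 K by (intro tendsto_intros LIMSEQ_power_zero) auto
    then have "\<forall>\<^sub>F i in sequentially. (2 * A + 1) * (K1 / K) ^ i < e" using e by (auto intro: order_tendstoD)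
    then show ?thesis using that by (meson eventually_sequentially order_refl)
  qed
  define N where "N = g * i"
  define F where "F = G ^^ i"
  have F: "deck N F" "\<And>x. H (F x) = c + m ^ N * (H x - c)" using deck_pow[OF G(2), of i] G(3) by (auto simp: N_def F_def)
  have Ai: "(2 * A + 1) * (K1 / K) ^ N < e"
  proof -
    have "(K1 / K) ^ N \<le> (K1 / K) ^ i" unfolding N_def using G(1) K1 K by (intro power_decreasing) auto
    then have "(2 * A + 1) * (K1 / K) ^ N \<le> (2 * A + 1) * (K1 / K) ^ i"
      using C0_nonneg B_nonneg by (intro mult_left_mono) (auto simp: A_def)
    then show ?thesis using i by simp
  qed
  obtain a' where a': "F a' = a" using deck_surj[OF F(1)] by blast
  define b where "b = X c (\<beta> a')"
  obtain q where q: "Wu_seq S P q" "H (q 0) = c" using Wu_seq_exists[OF S n fix_P] by blast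
  have Kpos: "K ^ N > 0" using K by simp
  obtain k R where R: "deck k R" "H (R (q 0)) = c" "norm (R (q 0) - b) < 1 / K ^ N"
    using fwd[OF q(2), of b "1 / K ^ N"] Kpos by (auto simp: b_def)
  \<comment> \<open>\<open>R\<close> multiplies differences of \<open>H\<close> by
    \<open>m ^ k\<close>, so this value puts \<open>R (y 0)\<close> on the fibre of
    \<open>a'\<close>.\<close>
  obtain y where y: "Wu_seq S P y" "H (y 0) = c + (H a' - c) / m ^ k" using Wu_seq_exists[OF S n fix_P] by blast
  define s where "s = R (y 0)"
  have sH: "H s = H a'" using deck_H'[OF R(1) refl, of "y 0" "q 0"] R(2) q(2) y(2) m_nz by (simp add: s_def)
  have FH: "H (F s) = H a" "H (F a') = H a" "H (F (R (q 0))) = c" "H (F b) = c"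
    using F(2) sH a' R(2) by (auto simp: b_def)
  have "CC (y 0 - q 0)" by (rule Wu_seq_CC[OF S n fix_P y(1) q(1)])
  then have "CC (s - R (q 0))" unfolding s_def using deck_CC[OF R(1)] by blast
  from CC_deck_norm[OF F(1) this] have 1: "norm (s - R (q 0)) \<le> A / K ^ N" by (simp add: FH A_def)
  have "CC (a' - b)" by (rule CC_w) (simp add: b_def \<beta>_simps)
  from CC_deck_norm[OF F(1) this] have 2: "norm (a' - b) \<le> A / K ^ N" by (simp add: FH A_def)
  have "norm (s - a') = norm ((s - R (q 0)) + (R (q 0) - b) - (a' - b))" by simp
  also have "\<dots> \<le> norm (s - R (q 0)) + norm (R (q 0) - b) + norm (a' - b)"
    by (rule order_trans[OF norm_triangle_ineq4 add_right_mono[OF norm_triangle_ineq]])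
  also have "\<dots> \<le> A / K ^ N + 1 / K ^ N + A / K ^ N" using 1 2 R(3) by linarith
  also have "\<dots> = (2 * A + 1) / K ^ N" by (simp add: add_divide_distrib)
  finally have 3: "norm (s - a') \<le> (2 * A + 1) / K ^ N" .
  have "norm (F s - a) \<le> K1 ^ N * norm (s - a')" using deck_fibre[OF F(1) sH] a' by simp
  also have "\<dots> \<le> K1 ^ N * ((2 * A + 1) / K ^ N)" using 3 K1 by (intro mult_left_mono) auto
  also have "\<dots> = (2 * A + 1) * (K1 / K) ^ N" by (simp add: power_divide)
  finally have "norm (F s - a) < e" using Ai by simp
  moreover have "deck (N + k) (F \<circ> R)" by (rule deck_comp[OF F(1) R(1)])
  ultimately show ?thesis using y(1) FH(1) unfolding s_def by (metis comp_apply)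
qed

section \<open>Density of saddles\<close>


lemma one_minus_m_pow: "k \<ge> 1 \<Longrightarrow> 2 ^ k / 2 \<le> \<bar>1 - m ^ k\<bar>"
proof -
  assume "k \<ge> 1"
  then have "(2::real) \<le> 2 ^ k" using power_increasing[of 1 k "2::real"] by simp
  then show ?thesis using m_pow(2)[of k] by linarith
qed

text \<open>A homoclinic orbit of the saddle through \<^term>\<open>U\<close> is shadowed by periodic orbits that stay
  near the saddle for \<^term>\<open>N\<close> periods. On the periodic fibre \<open>t0 + \<tau> N\<close> the return map contracts a
  fixed interval.\<close>

lemma saddles_dense:
  assumes P: "saddle f P" and U: "open U" "U \<noteq> {}"
  shows "\<exists>x\<in>U. saddle f x"
proof -
  obtain n S where S: "deck n S" "n \<ge> 1" "S P = P"
    "\<exists>l. eigenvalue2 (matrix (DL n P)) l \<and> cmod l < 1"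
    using P unfolding saddle_def periodic_DL by blast
  obtain \<mu> lam where sp: "1 < \<bar>lam\<bar>"
    "\<And>l. eigenvalue2 (matrix (DL n P)) l \<longleftrightarrow> l = of_real \<mu> \<or> l = of_real lam"
    "\<And>r. r > 0 \<Longrightarrow> \<exists>d>0. \<forall>x\<in>ball P d. \<forall>y\<in>ball P d. H x = H y \<longrightarrow> \<bar>\<beta> (S x) - \<beta> (S y) - \<mu> * (\<beta> x - \<beta> y)\<bar> \<le> r * \<bar>\<beta> x - \<beta> y\<bar>"
    by (rule periodic_splitting[OF S(1-3)]) blast
  have \<mu>: "\<bar>\<mu>\<bar> < 1" using S(4) sp(1) unfolding sp(2) by auto
  \<comment> \<open>A rate strictly between \<open>\<bar>\<mu>\<bar>\<close> and 1; the margin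
    absorbs the nonlinearity of \<open>S\<close> near \<open>P\<close>.\<close>
  define lm where "lm = (1 + \<bar>\<mu>\<bar>) / 2"
  have lm: "0 < lm" "lm < 1" using \<mu> by (auto simp: lm_def)
  obtain d where d: "d > 0" "\<And>x y. x \<in> ball P d \<Longrightarrow> y \<in> ball P d \<Longrightarrow> H x = H y \<Longrightarrow> \<bar>\<beta> (S x) - \<beta> (S y)\<bar> \<le> lm * \<bar>\<beta> x - \<beta> y\<bar>"
  proof -
    obtain d where d: "d > 0" "\<And>x y. x \<in> ball P d \<Longrightarrow> y \<in> ball P d \<Longrightarrow> H x = H y \<Longrightarrow>
        \<bar>\<beta> (S x) - \<beta> (S y) - \<mu> * (\<beta> x - \<beta> y)\<bar> \<le> (1 - \<bar>\<mu>\<bar>) / 2 * \<bar>\<beta> x - \<beta> y\<bar>"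
      using sp(3)[of "(1 - \<bar>\<mu>\<bar>) / 2"] \<mu> by auto
    show ?thesis
    proof (rule that[OF d(1)])
      fix x y assume xy: "x \<in> ball P d" "y \<in> ball P d" "H x = H y"
      have "\<bar>\<beta> (S x) - \<beta> (S y)\<bar> \<le> (1 - \<bar>\<mu>\<bar>) / 2 * \<bar>\<beta> x - \<beta> y\<bar> + \<bar>\<mu> * (\<beta> x - \<beta> y)\<bar>" using d(2)[OF xy] by linarith
      also have "\<dots> = lm * \<bar>\<beta> x - \<beta> y\<bar>" unfolding abs_mult by (simp add: lm_def field_simps)
      finally show "\<bar>\<beta> (S x) - \<beta> (S y)\<bar> \<le> lm * \<bar>\<beta> x - \<beta> y\<bar>" .
    qed
  qed
  define tP bP where "tP = H P" and "bP = \<beta> P"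
  have XP: "X tP bP = P" by (rule X_eq) (auto simp: tP_def bP_def)
  obtain e0 where e0: "e0 > 0" "\<And>t b. \<bar>t - tP\<bar> < e0 \<Longrightarrow> \<bar>b - bP\<bar> < e0 \<Longrightarrow> X t b \<in> ball P d"
    using X_near[OF open_ball, of tP bP P d] d(1) XP by auto
  define e where "e = e0 / 2"
  have e: "e > 0" "e < e0" using e0(1) by (auto simp: e_def)
  \<comment> \<open>On a nearby fibre the point with \<open>\<beta> = bP\<close> need not keep this
    coordinate under \<open>S\<close>. A displacement below \<open>(1 - lm) * e\<close> is what
    contraction by \<open>lm\<close> leaves room for in an interval of radius
    \<open>e\<close>.\<close>
  have "open ((\<lambda>x. \<beta> (S x)) -` ball bP ((1 - lm) * e))"
    by (intro open_vimage continuous_on_compose2[OF \<beta>_cont[of UNIV]] deck_cont[OF S(1)]) auto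
  moreover have "X tP bP \<in> (\<lambda>x. \<beta> (S x)) -` ball bP ((1 - lm) * e)"
    using e lm XP S(3) by (simp add: bP_def)
  ultimately obtain e' where e': "e' > 0" "\<And>t b. \<bar>t - tP\<bar> < e' \<Longrightarrow> \<bar>b - bP\<bar> < e' \<Longrightarrow> X t b \<in> (\<lambda>x. \<beta> (S x)) -` ball bP ((1 - lm) * e)"
    using X_near by blast
  define e1 where "e1 = min e (e' / 2)"
  have e1: "e1 > 0" "e1 \<le> e" "e1 < e'" using e e'(1) by (auto simp: e1_def)
  define Q where "Q = {x. \<bar>H x - tP\<bar> \<le> e1 \<and> \<bar>\<beta> x - bP\<bar> \<le> e}"
  have Q_ball: "x \<in> ball P d" if "x \<in> Q" for x
    using e0(2)[of "H x" "\<beta> x"] that e e1 X_eq[OF refl refl, of x] by (auto simp: Q_def)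
  have Q_step: "\<bar>\<beta> (S x) - bP\<bar> \<le> e" if x: "x \<in> Q" for x
  proof -
    let ?o = "X (H x) bP"
    have o: "?o \<in> Q" using x e by (auto simp: Q_def)
    have "\<bar>\<beta> (S x) - \<beta> (S ?o)\<bar> \<le> lm * \<bar>\<beta> x - bP\<bar>" using d(2)[OF Q_ball[OF x] Q_ball[OF o]] by simp
    also have "\<dots> \<le> lm * e" using x lm by (intro mult_left_mono) (auto simp: Q_def)
    finally have "\<bar>\<beta> (S x) - \<beta> (S ?o)\<bar> \<le> lm * e" .
    moreover have "\<bar>\<beta> (S ?o) - bP\<bar> < (1 - lm) * e"
      using e'(2)[of "H x" bP] x e1 e'(1) by (auto simp: Q_def dist_real_def abs_minus_commute)
    moreover have "lm * e + (1 - lm) * e = e" by (simp add: algebra_simps)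
    ultimately show ?thesis by linarith
  qed
  have S_H: "H ((S ^^ i) x) = tP + m ^ (n * i) * (H x - tP)" for i x
    using deck_H'[OF deck_pow[OF S(1)] S_pow_P[OF S(1-3)], of i x] by (simp add: tP_def)
  have Q_orbit: "(S ^^ j) x \<in> Q" if x: "\<bar>\<beta> x - bP\<bar> \<le> e" "\<bar>H ((S ^^ i) x) - tP\<bar> \<le> e1" and "j \<le> i" for x i j
  proof -
    \<comment> \<open>The distance of \<open>H\<close> from \<open>tP\<close> does not decrease with
      time, so its value at time \<open>i\<close> bounds all earlier ones.\<close>
    have tj: "\<bar>H ((S ^^ j) x) - tP\<bar> \<le> e1" if "j \<le> i" for j
    proof -
      have "\<bar>m ^ (n * j)\<bar> \<le> \<bar>m ^ (n * i)\<bar>" unfolding power_abs using m(2) that by (intro power_increasing) auto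
      then have "\<bar>m ^ (n * j)\<bar> * \<bar>H x - tP\<bar> \<le> \<bar>m ^ (n * i)\<bar> * \<bar>H x - tP\<bar>" by (intro mult_right_mono) auto
      then show ?thesis using x(2) by (simp add: S_H abs_mult)
    qed
    show ?thesis using \<open>j \<le> i\<close>
    proof (induction j)
      case 0 then show ?case using x(1) tj[of 0] by (simp add: Q_def)
    next
      case (Suc j)
      then have "(S ^^ j) x \<in> Q" by simp
      from Q_step[OF this] show ?case using tj[of "Suc j"] Suc.prems by (simp add: Q_def)
    qed
  qed
  have Q_contract: "\<bar>\<beta> ((S ^^ i) x) - \<beta> ((S ^^ i) y)\<bar> \<le> lm ^ i * \<bar>\<beta> x - \<beta> y\<bar>"
    if x: "\<bar>\<beta> x - bP\<bar> \<le> e" and y: "\<bar>\<beta> y - bP\<bar> \<le> e" and H: "H x = H y" "\<bar>H ((S ^^ i) x) - tP\<bar> \<le> e1" for x y i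
  proof -
    have Hi: "H ((S ^^ j) x) = H ((S ^^ j) y)" for j using H(1) by (simp add: S_H)
    have "j \<le> i \<Longrightarrow> \<bar>\<beta> ((S ^^ j) x) - \<beta> ((S ^^ j) y)\<bar> \<le> lm ^ j * \<bar>\<beta> x - \<beta> y\<bar>" for j
    proof (induction j)
      case (Suc j)
      have "(S ^^ j) x \<in> ball P d" "(S ^^ j) y \<in> ball P d"
        using Q_ball Q_orbit[OF x H(2), of j] Q_orbit[OF y H(2)[unfolded Hi], of j] Suc.prems by auto
      from d(2)[OF this Hi] have "\<bar>\<beta> ((S ^^ Suc j) x) - \<beta> ((S ^^ Suc j) y)\<bar> \<le> lm * \<bar>\<beta> ((S ^^ j) x) - \<beta> ((S ^^ j) y)\<bar>" by simp
      also have "\<dots> \<le> lm * (lm ^ j * \<bar>\<beta> x - \<beta> y\<bar>)" using Suc lm by (intro mult_left_mono) auto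
      finally show ?case by (simp add: mult.assoc)
    qed auto
    then show ?thesis by simp
  qed

  obtain n1 \<Psi>1 u where \<Psi>1: "deck n1 \<Psi>1" "u \<in> U" "\<Psi>1 u = P" using cover[OF U] by blast
  define t0 where "t0 = H u"
  \<comment> \<open>Points of \<open>V\<close> are moreover carried by \<open>\<Psi>1\<close> into
    the range of \<open>\<beta>\<close> in which the contraction near \<open>P\<close>
    operates.\<close>
  define V where "V = U \<inter> (\<lambda>x. \<beta> (\<Psi>1 x)) -` ball bP e"
  have V: "open V" "u \<in> V" unfolding V_def
    using \<Psi>1 e by (auto simp: bP_def intro!: open_Int U open_vimage continuous_on_compose2[OF \<beta>_cont[of UNIV]] deck_cont)
  obtain v where v: "v > 0" "ball u v \<subseteq> V" using openE[OF V] by blast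
  \<comment> \<open>The homoclinic orbit: \<open>R (y 0)\<close> comes from \<open>P\<close> along
    the unstable curve and lies on the fibre of \<open>u\<close>, so close to \<open>u\<close> that
    \<open>\<Psi>1\<close> sends it onto the fibre of \<open>P\<close>, into the interval contracted
    by \<open>S\<close>.\<close>
  obtain y k R where y: "Wu_seq S P y" "deck k R" "H (R (y 0)) = t0" "norm (R (y 0) - u) < v"
    using Wu_dense[OF S(1-3) v(1), of u] unfolding t0_def by blast
  have "y \<longlonglongrightarrow> P" by (rule Wu_seq_lim[OF S(1-3) y(1)])
  have "\<forall>\<^sub>F i in sequentially. \<bar>H (y i) - tP\<bar> < e1 \<and> \<bar>\<beta> (y i) - bP\<bar> < e"
  proof -
    have "(\<lambda>i. H (y i)) \<longlonglongrightarrow> tP" unfolding tP_def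
      by (rule continuous_on_tendsto_compose[OF H_cont[of UNIV] \<open>y \<longlonglongrightarrow> P\<close>]) auto
    moreover have "(\<lambda>i. \<beta> (y i)) \<longlonglongrightarrow> bP" unfolding bP_def by (rule \<beta>.tendsto[OF \<open>y \<longlonglongrightarrow> P\<close>])
    ultimately show ?thesis
      using tendstoD[of _ tP sequentially e1] tendstoD[of _ bP sequentially e] e1 e
      by (auto simp: dist_real_def intro: eventually_conj)
  qed
  then obtain i0 where i0: "\<And>i. i \<ge> i0 \<Longrightarrow> \<bar>H (y i) - tP\<bar> < e1 \<and> \<bar>\<beta> (y i) - bP\<bar> < e"
    unfolding eventually_sequentially by blast
  define r where "r = y i0"
  define n2 \<Psi>2 where "n2 = k + n * i0" and "\<Psi>2 = R \<circ> (S ^^ i0)"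
  have \<Psi>2: "deck n2 \<Psi>2" unfolding n2_def \<Psi>2_def by (rule deck_comp[OF y(2) deck_pow[OF S(1)]])
  have "\<Psi>2 r = R (y 0)" using Wu_seq_pow[OF S(1-3) y(1), of i0 0] by (simp add: \<Psi>2_def r_def)
  then have x1: "H (\<Psi>2 r) = t0" "\<Psi>2 r \<in> V" using y(3,4) v(2) by (auto simp: dist_norm norm_minus_commute)
  define tr b1 where "tr = H r" and "b1 = \<beta> (\<Psi>2 r)"
  have tr: "\<bar>tr - tP\<bar> < e1" using i0[of i0] by (simp add: tr_def r_def)
  obtain s where s: "s > 0" "\<And>t b. \<bar>t - t0\<bar> < s \<Longrightarrow> \<bar>b - b1\<bar> < s \<Longrightarrow> X t b \<in> V"
  proof -
    have "X t0 b1 \<in> V" using X_eq[OF x1(1), of b1] x1(2) by (simp add: b1_def)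
    then show ?thesis using X_near[OF V(1)] that by metis
  qed
  define \<eta> where "\<eta> = s / 2"
  have \<eta>: "\<eta> > 0" "\<eta> < s" using s(1) by (auto simp: \<eta>_def)
  have "open ((\<lambda>x. \<beta> (\<Psi>2 x)) -` ball b1 \<eta>)"
    by (intro open_vimage continuous_on_compose2[OF \<beta>_cont[of UNIV]] deck_cont[OF \<Psi>2]) auto
  moreover have "X tr (\<beta> r) \<in> (\<lambda>x. \<beta> (\<Psi>2 x)) -` ball b1 \<eta>"
    using X_eq[OF refl refl, of r] \<eta> by (simp add: tr_def b1_def)
  ultimately obtain h where h: "h > 0" "\<And>t b. \<bar>t - tr\<bar> < h \<Longrightarrow> \<bar>b - \<beta> r\<bar> < h \<Longrightarrow> X t b \<in> (\<lambda>x. \<beta> (\<Psi>2 x)) -` ball b1 \<eta>"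
    using X_near by blast
  obtain C1 where C1: "C1 > 0" "\<And>x y. H x = H y \<Longrightarrow> \<bar>\<beta> (\<Psi>1 x) - \<beta> (\<Psi>1 y)\<bar> \<le> C1 * \<bar>\<beta> x - \<beta> y\<bar>"
    using deck_fibre_Lipschitz[OF \<Psi>1(1)] by metis
  obtain C2 where C2: "C2 > 0" "\<And>x y. H x = H y \<Longrightarrow> \<bar>\<beta> (\<Psi>2 x) - \<beta> (\<Psi>2 y)\<bar> \<le> C2 * \<bar>\<beta> x - \<beta> y\<bar>"
    using deck_fibre_Lipschitz[OF \<Psi>2] by metis

  \<comment> \<open>One loop takes the fibre \<open>t0 + \<tau>\<close> to
    \<open>tP + m ^ n1 * \<tau>\<close>, then to \<open>tP + m ^ (n * N + n1) * \<tau>\<close>, and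
    finally to \<open>t0\<close> plus \<open>m ^ n2\<close> times the difference of that value and
    \<open>tr\<close>. Equating the result with \<open>t0 + \<tau>\<close> gives this formula;
    \<open>sN N\<close> is the value before the last passage.\<close>
  define \<tau> where "\<tau> N = m ^ n2 * (tP - tr) / (1 - m ^ (n2 + n * N + n1))" for N
  define sN where "sN N = tr + \<tau> N / m ^ n2" for N
  have big: "N \<le> n2 + n * N + n1" for N using S(2) by (simp add: trans_le_add1 trans_le_add2)
  have \<tau>_bound: "\<bar>\<tau> N\<bar> \<le> 2 * \<bar>m ^ n2 * (tP - tr)\<bar> * (1 / 2) ^ N" if "N \<ge> 1" for N
  proof -
    have "(2::real) ^ N \<le> 2 ^ (n2 + n * N + n1)" using big by (intro power_increasing) auto
    then have *: "2 ^ N / 2 \<le> \<bar>1 - m ^ (n2 + n * N + n1)\<bar>"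
      using one_minus_m_pow[of "n2 + n * N + n1"] big[of N] that by linarith
    have pos: "(0::real) < 2 ^ N / 2" by simp
    have "\<bar>\<tau> N\<bar> \<le> \<bar>m ^ n2 * (tP - tr)\<bar> / (2 ^ N / 2)"
      unfolding \<tau>_def abs_divide
      by (rule divide_left_mono[OF * abs_ge_zero mult_pos_pos[OF less_le_trans[OF pos *] pos]])
    then show ?thesis by (simp add: power_one_over field_simps)
  qed
  have \<tau>_lim: "\<tau> \<longlonglongrightarrow> 0"
  proof (rule Lim_null_comparison)
    show "\<forall>\<^sub>F N in sequentially. norm (\<tau> N) \<le> 2 * \<bar>m ^ n2 * (tP - tr)\<bar> * (1 / 2) ^ N"
      using \<tau>_bound unfolding eventually_sequentially by auto
    have "(\<lambda>N. 2 * \<bar>m ^ n2 * (tP - tr)\<bar> * (1 / 2 :: real) ^ N) \<longlonglongrightarrow> 2 * \<bar>m ^ n2 * (tP - tr)\<bar> * 0"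
      by (intro tendsto_intros LIMSEQ_power_zero) auto
    then show "(\<lambda>N. 2 * \<bar>m ^ n2 * (tP - tr)\<bar> * (1 / 2 :: real) ^ N) \<longlonglongrightarrow> 0" by simp
  qed
  have sN_lim: "sN \<longlonglongrightarrow> tr"
  proof -
    have "sN \<longlonglongrightarrow> tr + 0 / m ^ n2" unfolding sN_def by (intro tendsto_intros \<tau>_lim) (simp add: m_nz)
    then show ?thesis by simp
  qed
  have sN_eq: "tP + m ^ (n * N + n1) * \<tau> N = sN N" if "N \<ge> 1" for N
  proof -
    have "(0::real) < 2 ^ (n2 + n * N + n1) / 2" by simp
    also have "\<dots> \<le> \<bar>1 - m ^ (n2 + n * N + n1)\<bar>" by (rule one_minus_m_pow) (use big[of N] that in linarith)
    finally have nz: "1 - m ^ (n2 + n * N + n1) \<noteq> 0" by simp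
    then have "\<tau> N * (1 - m ^ (n2 + n * N + n1)) = m ^ n2 * (tP - tr)" by (simp add: \<tau>_def)
    then have "\<tau> N = m ^ n2 * (tP - tr) + m ^ n2 * (m ^ (n * N + n1) * \<tau> N)"
      by (simp add: right_diff_distrib power_add mult_ac)
    then have "\<tau> N / m ^ n2 = (tP - tr) + m ^ (n * N + n1) * \<tau> N"
      using m_nz by (simp add: field_simps)
    then show ?thesis by (simp add: sN_def)
  qed

  text \<open>The image near \<^term>\<open>r\<close> of the fibre interval is compared with the point on the same fibre
    that stays next to the backward orbit of \<^term>\<open>r\<close> for a fixed number of steps.\<close>
  obtain i where i: "2 * e * lm ^ i < h / 2"
  proof -
    have "(\<lambda>i. 2 * e * lm ^ i) \<longlonglongrightarrow> 2 * e * 0" using lm by (intro tendsto_intros LIMSEQ_power_zero) auto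
    then have "\<forall>\<^sub>F i in sequentially. 2 * e * lm ^ i < h / 2" by (rule order_tendstoD(2)) (use h(1) in simp)
    then show ?thesis using that by (meson eventually_sequentially order_refl)
  qed
  define q where "q = y (i0 + i)"
  have q: "(S ^^ i) q = r" "\<bar>\<beta> q - bP\<bar> < e"
    using Wu_seq_pow[OF S(1-3) y(1), of i i0] i0[of "i0 + i"] by (auto simp: q_def r_def add.commute)
  have q_H: "tP + (tr - tP) / m ^ (n * i) = H q"
    using S_H[of i q] q(1) m_nz by (simp add: tr_def)
  define vN where "vN N = X (tP + (sN N - tP) / m ^ (n * i)) (\<beta> q)" for N
  have "vN \<longlonglongrightarrow> X (tP + (tr - tP) / m ^ (n * i)) (\<beta> q)"
    unfolding vN_def by (intro X_tendsto tendsto_intros sN_lim) (simp add: m_nz)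
  then have "vN \<longlonglongrightarrow> q" using X_eq[OF q_H[symmetric] refl] by simp
  have "(\<lambda>N. \<beta> ((S ^^ i) (vN N))) \<longlonglongrightarrow> \<beta> ((S ^^ i) q)"
    by (intro \<beta>.tendsto continuous_on_tendsto_compose[OF deck_cont[OF deck_pow[OF S(1)], of UNIV] \<open>vN \<longlonglongrightarrow> q\<close>]) auto
  then have ev1: "\<forall>\<^sub>F N in sequentially. \<bar>\<beta> ((S ^^ i) (vN N)) - \<beta> r\<bar> < h / 2"
    unfolding q(1) using h(1) by (auto simp: dist_real_def dest: tendstoD[of _ _ _ "h / 2"])
  have ev2: "\<forall>\<^sub>F N in sequentially. \<bar>sN N - tr\<bar> < min h (e1 - \<bar>tr - tP\<bar>)"
    using tendstoD[OF sN_lim, of "min h (e1 - \<bar>tr - tP\<bar>)"] h(1) tr by (simp add: dist_real_def)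
  have ev3: "\<forall>\<^sub>F N in sequentially. \<bar>\<tau> N\<bar> < s"
    using tendstoD[OF \<tau>_lim, of s] s(1) by (simp add: dist_real_def)
  have ev4: "\<forall>\<^sub>F N in sequentially. C2 * C1 * lm ^ N < 1 / 2"
  proof -
    have "(\<lambda>N. C2 * C1 * lm ^ N) \<longlonglongrightarrow> C2 * C1 * 0" using lm by (intro tendsto_intros LIMSEQ_power_zero) auto
    then show ?thesis by (rule order_tendstoD(2)) simp
  qed
  have "\<forall>\<^sub>F N in sequentially. \<bar>\<beta> ((S ^^ i) (vN N)) - \<beta> r\<bar> < h / 2 \<and> \<bar>sN N - tr\<bar> < min h (e1 - \<bar>tr - tP\<bar>) \<and>
      \<bar>\<tau> N\<bar> < s \<and> C2 * C1 * lm ^ N < 1 / 2 \<and> N \<ge> max i 1"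
    by (intro eventually_conj ev1 ev2 ev3 ev4 eventually_ge_at_top)
  then obtain N where N: "\<bar>\<beta> ((S ^^ i) (vN N)) - \<beta> r\<bar> < h / 2" "\<bar>sN N - tr\<bar> < h" "\<bar>sN N - tr\<bar> < e1 - \<bar>tr - tP\<bar>"
      "\<bar>\<tau> N\<bar> < s" "C2 * C1 * lm ^ N < 1 / 2" "N \<ge> i" "N \<ge> 1"
    unfolding eventually_sequentially by (metis (no_types, lifting) max.bounded_iff min_less_iff_conj order_refl)

  define T where "T = \<Psi>2 \<circ> ((S ^^ N) \<circ> \<Psi>1)"
  define nT where "nT = n2 + (n * N + n1)"
  have T: "deck nT T" unfolding T_def nT_def
    by (intro deck_comp \<Psi>2 deck_pow S(1) \<Psi>1(1))
  have nT: "nT \<ge> 1" using big[of N] N(7) by (simp add: nT_def)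
  define tN where "tN = t0 + \<tau> N"
  have sN_tP: "\<bar>sN N - tP\<bar> \<le> e1" using N(3) by linarith
  have fibre_V: "X tN b \<in> V" if "\<bar>b - b1\<bar> \<le> \<eta>" for b
    using s(2)[of tN b] that \<eta> N(4) by (simp add: tN_def)
  have mid: "H ((S ^^ N) (\<Psi>1 (X tN b))) = sN N" for b
  proof -
    have "H (\<Psi>1 (X tN b)) = tP + m ^ n1 * \<tau> N"
      using deck_H'[OF \<Psi>1(1,3), of "X tN b"] by (simp add: tP_def t0_def tN_def)
    then show ?thesis unfolding S_H sN_eq[OF N(7), symmetric] by (simp add: power_add mult_ac)
  qed
  have T_H: "H (T (X tN b)) = tN" for b
    using deck_H[OF \<Psi>2, of "(S ^^ N) (\<Psi>1 (X tN b))" r] mid[of b] x1(1) m_nz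
    by (simp add: T_def tN_def sN_def tr_def)
  have start: "\<bar>\<beta> (\<Psi>1 (X tN b)) - bP\<bar> \<le> e" if "\<bar>b - b1\<bar> \<le> \<eta>" for b
    using fibre_V[OF that] by (auto simp: V_def dist_real_def abs_minus_commute)
  \<comment> \<open>Only the last \<open>i\<close> of the \<open>N\<close> turns are compared with
    \<open>vN N\<close>. As \<open>i\<close> was fixed before \<open>N\<close>, continuity of
    \<open>S ^^ i\<close> controls \<open>vN N\<close>; the earlier turns merely keep the point in
    \<open>Q\<close>.\<close>
  have T_J: "\<bar>\<beta> (T (X tN b)) - b1\<bar> \<le> \<eta>" if b: "\<bar>b - b1\<bar> \<le> \<eta>" for b
  proof -
    define p where "p = \<Psi>1 (X tN b)"
    define z where "z = (S ^^ (N - i)) p"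
    have z: "(S ^^ i) z = (S ^^ N) p" using N(6) by (simp add: z_def funpow_add[symmetric] flip: comp_apply[of "S ^^ i" "S ^^ (N - i)"])
    have zQ: "z \<in> Q" unfolding z_def
      by (rule Q_orbit[of _ N]) (use start[OF b] mid[of b] sN_tP in \<open>auto simp: p_def\<close>)
    have zH: "H ((S ^^ i) z) = sN N" unfolding z p_def by (rule mid)
    have "H z = H (vN N)" using S_H[of i z] zH m_nz by (simp add: vN_def)
    then have "\<bar>\<beta> ((S ^^ i) z) - \<beta> ((S ^^ i) (vN N))\<bar> \<le> lm ^ i * \<bar>\<beta> z - \<beta> (vN N)\<bar>"
      by (intro Q_contract) (use zQ q(2) zH sN_tP in \<open>auto simp: Q_def vN_def\<close>)
    also have "\<dots> \<le> lm ^ i * (2 * e)"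
    proof (intro mult_left_mono)
      show "\<bar>\<beta> z - \<beta> (vN N)\<bar> \<le> 2 * e" using zQ q(2) unfolding Q_def vN_def mem_Collect_eq \<beta>X by linarith
    qed (use lm in auto)
    also have "lm ^ i * (2 * e) = 2 * e * lm ^ i" by simp
    finally have "\<bar>\<beta> ((S ^^ N) p) - \<beta> r\<bar> < h" using i N(1) unfolding z by linarith
    then have "X (sN N) (\<beta> ((S ^^ N) p)) \<in> (\<lambda>x. \<beta> (\<Psi>2 x)) -` ball b1 \<eta>" by (intro h(2) N(2))
    moreover have "X (sN N) (\<beta> ((S ^^ N) p)) = (S ^^ N) p" by (rule X_eq) (simp_all add: mid p_def)
    ultimately show ?thesis by (simp add: T_def p_def dist_real_def abs_minus_commute)
  qed
  have T_contract: "\<bar>\<beta> (T (X tN b)) - \<beta> (T (X tN b'))\<bar> \<le> 1 / 2 * \<bar>b - b'\<bar>" if b: "\<bar>b - b1\<bar> \<le> \<eta>" "\<bar>b' - b1\<bar> \<le> \<eta>" for b b'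
  proof -
    let ?p = "\<Psi>1 (X tN b)" and ?p' = "\<Psi>1 (X tN b')"
    have "\<bar>\<beta> ((S ^^ N) ?p) - \<beta> ((S ^^ N) ?p')\<bar> \<le> lm ^ N * \<bar>\<beta> ?p - \<beta> ?p'\<bar>"
    proof (rule Q_contract)
      show "H ?p = H ?p'" using deck_H[OF \<Psi>1(1), of "X tN b" "X tN b'"] by simp
    qed (use start b mid sN_tP in auto)
    also have "\<dots> \<le> lm ^ N * (C1 * \<bar>b - b'\<bar>)" using C1(2)[of "X tN b" "X tN b'"] lm by (intro mult_left_mono) auto
    finally have *: "\<bar>\<beta> ((S ^^ N) ?p) - \<beta> ((S ^^ N) ?p')\<bar> \<le> lm ^ N * (C1 * \<bar>b - b'\<bar>)" .
    have "\<bar>\<beta> (T (X tN b)) - \<beta> (T (X tN b'))\<bar> \<le> C2 * \<bar>\<beta> ((S ^^ N) ?p) - \<beta> ((S ^^ N) ?p')\<bar>"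
      using C2(2)[of "(S ^^ N) ?p" "(S ^^ N) ?p'"] mid by (simp add: T_def)
    also have "\<dots> \<le> C2 * (lm ^ N * (C1 * \<bar>b - b'\<bar>))" using * C2(1) by (intro mult_left_mono) auto
    also have "\<dots> = C2 * C1 * lm ^ N * \<bar>b - b'\<bar>" by simp
    also have "\<dots> \<le> 1 / 2 * \<bar>b - b'\<bar>" using N(5) by (intro mult_right_mono) auto
    finally show ?thesis .
  qed
  have "\<exists>!b\<in>cball b1 \<eta>. \<beta> (T (X tN b)) = b"
    by (rule Banach_fix[where c = "1 / 2"])
      (use \<eta> T_J T_contract in \<open>auto simp: complete_eq_closed dist_real_def abs_minus_commute\<close>)
  then obtain b where b: "\<bar>b - b1\<bar> \<le> \<eta>" "\<beta> (T (X tN b)) = b" by (auto simp: dist_real_def abs_minus_commute)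
  define z where "z = X tN b"
  have Tz: "T z = z" using X_eq[OF T_H b(2)] by (simp add: z_def)
  obtain \<mu>' lam' where sp': "1 < \<bar>lam'\<bar>"
    "\<And>l. eigenvalue2 (matrix (DL nT z)) l \<longleftrightarrow> l = of_real \<mu>' \<or> l = of_real lam'"
    "\<And>r. r > 0 \<Longrightarrow> \<exists>d>0. \<forall>x\<in>ball z d. \<forall>y\<in>ball z d. H x = H y \<longrightarrow> \<bar>\<beta> (T x) - \<beta> (T y) - \<mu>' * (\<beta> x - \<beta> y)\<bar> \<le> r * \<bar>\<beta> x - \<beta> y\<bar>"
    by (rule periodic_splitting[OF T nT Tz]) blast
  obtain d' where d': "d' > 0" "\<And>x y. x \<in> ball z d' \<Longrightarrow> y \<in> ball z d' \<Longrightarrow> H x = H y \<Longrightarrow>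
      \<bar>\<beta> (T x) - \<beta> (T y) - \<mu>' * (\<beta> x - \<beta> y)\<bar> \<le> 1 / 4 * \<bar>\<beta> x - \<beta> y\<bar>"
    using sp'(3)[of "1 / 4"] by auto
  obtain e2 where e2: "e2 > 0" "\<And>t b'. \<bar>t - tN\<bar> < e2 \<Longrightarrow> \<bar>b' - b\<bar> < e2 \<Longrightarrow> X t b' \<in> ball z d'"
    using X_near[OF open_ball, of tN b z d'] d'(1) unfolding z_def by auto
  \<comment> \<open>A second point of the contracted interval on the same fibre, displaced from
    \<open>b\<close> in the direction of \<open>b1\<close> so as to stay inside. The rate
    \<open>1 / 2\<close> of the return map and the error \<open>1 / 4\<close> then bound the fibre
    eigenvalue by \<open>3 / 4\<close>.\<close>
  define g where "g = min \<eta> e2 / 2"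
  define b' where "b' = (if b \<le> b1 then b + g else b - g)"
  have g: "g > 0" "g < e2" "g \<le> \<eta>" using \<eta>(1) e2(1) by (auto simp: g_def)
  have b': "\<bar>b' - b1\<bar> \<le> \<eta>" "\<bar>b' - b\<bar> = g" using g b(1) by (auto simp: b'_def abs_if split: if_splits)
  have "\<bar>\<beta> (T (X tN b')) - \<beta> (T z) - \<mu>' * (b' - b)\<bar> \<le> 1 / 4 * g"
    using d'(2)[OF e2(2)[of tN b'] centre_in_ball[THEN iffD2, OF d'(1)]] e2(1) b'(2) g by (simp add: z_def)
  moreover have "\<bar>\<beta> (T (X tN b')) - \<beta> (T z)\<bar> \<le> 1 / 2 * g" using T_contract[OF b'(1) b(1)] b'(2) by (simp add: z_def)
  ultimately have "\<bar>\<mu>' * (b' - b)\<bar> \<le> 3 / 4 * g" by linarith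
  then have "\<bar>\<mu>'\<bar> * g \<le> 3 / 4 * g" unfolding abs_mult b'(2) .
  then have "\<bar>\<mu>'\<bar> \<le> 3 / 4" using g(1) by simp
  then have "saddle f z" using saddleI[OF T nT Tz sp'(2)] sp'(1) by simp
  moreover have "z \<in> U" using fibre_V[OF b(1)] by (simp add: z_def V_def)
  ultimately show ?thesis by blast
qed

end

section \<open>The main theorem\<close>

lemma shift_to_unit_box:
  fixes x :: "real^2"
  obtains k where "int_vec k" "x + k \<in> cbox 0 1"
proof (rule that[of "\<chi> i. - real_of_int \<lfloor>x $ i\<rfloor>"])
  show "int_vec (\<chi> i. - real_of_int \<lfloor>x $ i\<rfloor>)" by (auto simp: int_vec_def)
  show "x + (\<chi> i. - real_of_int \<lfloor>x $ i\<rfloor>) \<in> cbox 0 1"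
    unfolding mem_box_cart by (auto, linarith)
qed

lemma periodic_bounded:
  fixes g :: "real^2 \<Rightarrow> 'a::real_normed_vector"
  assumes "continuous_on UNIV g" "\<And>x k. int_vec k \<Longrightarrow> g (x + k) = g x"
  shows "\<exists>B. \<forall>x. norm (g x) \<le> B"
proof -
  have "compact (g ` cbox 0 1)"
    by (intro compact_continuous_image continuous_on_subset[OF assms(1)]) auto
  then obtain B where "\<forall>y\<in>g ` cbox 0 1. norm y \<le> B" using compact_imp_bounded bounded_iff by metis
  then have "norm (g x) \<le> B" for x
    using shift_to_unit_box[of x] assms(2) by (metis imageI)
  then show ?thesis by blast
qed

text \<open>The columns of \<open>M\<close> minus \<open>m\<close> times the identity are integer
  vectors annihilated by \<open>l\<close>, and one is nonzero because \<open>M\<close> also has the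
  eigenvalue 1. Turned by a right angle and divided by its gcd, it is a primitive vector parallel to
  \<open>l\<close>; Bezout supplies \<open>a\<close> and \<open>b\<close>.\<close>

lemma integer_left_eigenvector:
  fixes M :: "real^2^2" and m :: int
  assumes M: "int_mat M" and m: "\<bar>m\<bar> > 1" and v: "v \<noteq> 0" "M *v v = v"
    and l: "l \<noteq> 0" "l v* M = of_int m *\<^sub>R l"
  obtains p q a b :: int and t :: real
  where "p * a + q * b = 1" "t \<noteq> 0" "l = t *\<^sub>R vector [real_of_int p, real_of_int q]"
proof -
  have row: "l $ 1 * M $ 1 $ j + l $ 2 * M $ 2 $ j = m * l $ j" for j
    using arg_cong[OF l(2), of "\<lambda>u. u $ j"] by (simp add: vector_matrix_mult_def sum_2 mult.commute)
  obtain j where j: "M $ 1 $ j - m * (if j = 1 then 1 else 0) \<noteq> 0 \<or> M $ 2 $ j - m * (if j = 2 then 1 else 0) \<noteq> 0"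
  proof (rule ccontr)
    assume c: "\<not> thesis"
    have "M $ 1 $ j = m * (if j = 1 then 1 else 0)" "M $ 2 $ j = m * (if j = 2 then 1 else 0)" for j
    proof -
      have "\<not> (M $ 1 $ j - m * (if j = 1 then 1 else 0) \<noteq> 0 \<or> M $ 2 $ j - m * (if j = 2 then 1 else 0) \<noteq> 0)"
        using c that by blast
      then show "M $ 1 $ j = m * (if j = 1 then 1 else 0)" "M $ 2 $ j = m * (if j = 2 then 1 else 0)" by linarith+
    qed
    then have "M *v v = of_int m *\<^sub>R v"
      by (auto simp: vec_eq_iff forall_2 matrix_vector_mult_def sum_2)
    then have "(of_int m - 1) *\<^sub>R v = 0" using v(2) by (simp add: scaleR_left_diff_distrib)
    then show False using v(1) m by auto
  qed
  obtain M1 M2 :: int where M12: "M $ 1 $ j = M1" "M $ 2 $ j = M2"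
    using M unfolding int_mat_def by (meson Ints_cases)
  define r where "r = M1 - m * (if j = 1 then 1 else 0)"
  define s where "s = M2 - m * (if j = 2 then 1 else 0)"
  have rs: "r \<noteq> 0 \<or> s \<noteq> 0" using j unfolding M12 r_def s_def
    by (metis of_int_diff of_int_mult of_int_0 of_int_1 of_int_eq_0_iff)
  have orth: "l $ 1 * r + l $ 2 * s = 0"
    using row[of j] exhaust_2[of j] unfolding M12 r_def s_def by (auto simp: algebra_simps)
  define g where "g = gcd r s"
  have g: "g \<noteq> 0" using rs by (simp add: g_def)
  obtain p q where pq: "- s = p * g" "r = q * g" "coprime p q"
  proof -
    obtain s' r' where "s = s' * g" "r = r' * g" "coprime s' r'"
      using gcd_coprime_exists[of s r] g unfolding g_def gcd.commute[of r s] by blast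
    then show ?thesis using that[of "- s'" r'] by simp
  qed
  obtain a b where ab: "p * a + q * b = 1"
    using bezout_int[of p q] pq(3) by (auto simp: mult.commute)
  have qp: "q * g = r" "p * g = - s" using pq by auto
  have orth': "l $ 1 * q = l $ 2 * p"
  proof -
    have "(l $ 1 * q - l $ 2 * p) * g = l $ 1 * real_of_int (q * g) - l $ 2 * real_of_int (p * g)"
      by (simp add: algebra_simps)
    then have "(l $ 1 * q - l $ 2 * p) * g = 0" unfolding qp using orth by simp
    then show ?thesis using g by simp
  qed
  define t where "t = a * l $ 1 + b * l $ 2"
  have ab': "real_of_int p * real_of_int a + real_of_int q * real_of_int b = 1" using ab by (metis of_int_1 of_int_add of_int_mult)
  have "t * p = (p * a) * l $ 1 + b * (l $ 2 * p)" by (simp add: t_def algebra_simps)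
  also have "\<dots> = (p * a + q * b) * l $ 1" unfolding orth'[symmetric] by (simp add: algebra_simps)
  finally have 1: "t * p = l $ 1" by (simp add: ab')
  have "t * q = a * (l $ 1 * q) + q * b * l $ 2" by (simp add: t_def algebra_simps)
  also have "\<dots> = (p * a + q * b) * l $ 2" unfolding orth' by (simp add: algebra_simps)
  finally have 2: "t * q = l $ 2" by (simp add: ab')
  have "l = t *\<^sub>R vector [real_of_int p, real_of_int q]" by (simp add: vec_eq_iff forall_2 1 2)
  moreover from this l(1) have "t \<noteq> 0" by auto
  ultimately show ?thesis using that[OF ab] by blast
qed

text \<open>By periodicity base points may be taken in the unit square, and unit vectors outside the
  open cone form a compact set; so the strict inequality is attained with room to spare.\<close>

lemma strict_bound_outside_cone:
  fixes D :: "real^2 \<Rightarrow> ((real^2) \<Rightarrow>\<^sub>L (real^2))" and \<phi> \<beta> :: "real^2 \<Rightarrow> real"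
  assumes D: "continuous_on UNIV D" "\<And>x k. int_vec k \<Longrightarrow> D (x + k) = D x"
    and lin: "bounded_linear \<phi>" "bounded_linear \<beta>" and K: "K > 0"
    and out: "\<And>z v. v \<noteq> 0 \<Longrightarrow> \<not> \<bar>\<beta> v\<bar> < \<kappa> * \<bar>\<phi> v\<bar> \<Longrightarrow> norm ((D z) v) < K * norm v"
  shows "\<exists>K1. 0 < K1 \<and> K1 < K \<and> (\<forall>z v. \<not> \<bar>\<beta> v\<bar> < \<kappa> * \<bar>\<phi> v\<bar> \<longrightarrow> norm ((D z) v) \<le> K1 * norm v)"
proof -
  interpret \<phi>: bounded_linear \<phi> by fact
  interpret \<beta>: bounded_linear \<beta> by fact
  define C where "C = sphere (0::real^2) 1 \<inter> {v. \<kappa> * \<bar>\<phi> v\<bar> \<le> \<bar>\<beta> v\<bar>}"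
  have "closed {v. \<kappa> * \<bar>\<phi> v\<bar> \<le> \<bar>\<beta> v\<bar>}"
    by (intro closed_Collect_le continuous_intros \<phi>.continuous_on \<beta>.continuous_on)
  then have "compact (cbox (0::real^2) 1 \<times> C)"
    unfolding C_def by (intro compact_Times compact_Int_closed) auto
  moreover have cont: "continuous_on (cbox 0 1 \<times> C) (\<lambda>p. norm ((D (fst p)) (snd p)))"
    by (intro continuous_intros continuous_on_compose2[OF D(1)]) auto
  ultimately have "compact ((\<lambda>p. norm ((D (fst p)) (snd p))) ` (cbox 0 1 \<times> C))"
    by (rule compact_continuous_image[rotated])
  then have "\<exists>K2<K. \<forall>p\<in>cbox 0 1 \<times> C. norm ((D (fst p)) (snd p)) \<le> K2"
  proof (cases "C = {}")
    case False
    moreover have "(0::real^2) \<in> cbox 0 1" by (simp add: mem_box_cart)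
    ultimately have "(cbox (0::real^2) 1 \<times> C) \<noteq> {}" by blast
    then obtain p where p: "p \<in> cbox 0 1 \<times> C" "\<forall>q\<in>cbox 0 1 \<times> C. norm ((D (fst q)) (snd q)) \<le> norm ((D (fst p)) (snd p))"
      using continuous_attains_sup[OF \<open>compact (cbox 0 1 \<times> C)\<close> _ cont] by blast
    have "snd p \<noteq> 0" "\<not> \<bar>\<beta> (snd p)\<bar> < \<kappa> * \<bar>\<phi> (snd p)\<bar>" "norm (snd p) = 1" using p(1) by (auto simp: C_def)
    from out[OF this(1,2), of "fst p"] this(3) show ?thesis using p(2) by auto
  qed (use K in \<open>auto intro: exI[of _ 0]\<close>)
  then obtain K2 where K2: "K2 < K" "\<And>z v. z \<in> cbox 0 1 \<Longrightarrow> v \<in> C \<Longrightarrow> norm ((D z) v) \<le> K2" by auto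
  \<comment> \<open>The maximum with \<open>K / 2\<close> keeps \<open>K1\<close> positive.\<close>
  define K1 where "K1 = max K2 (K / 2)"
  have "norm ((D z) v) \<le> K1 * norm v" if v: "\<not> \<bar>\<beta> v\<bar> < \<kappa> * \<bar>\<phi> v\<bar>" for z v
  proof (cases "v = 0")
    case False
    obtain k where k: "int_vec k" "z + k \<in> cbox 0 1" using shift_to_unit_box by blast
    let ?u = "v /\<^sub>R norm v"
    have "\<kappa> * \<bar>\<phi> ?u\<bar> \<le> \<bar>\<beta> ?u\<bar>"
      using v False mult_left_mono[of "\<kappa> * \<bar>\<phi> v\<bar>" "\<bar>\<beta> v\<bar>" "inverse (norm v)"]
      by (simp add: \<phi>.scaleR \<beta>.scaleR abs_mult mult_ac)
    then have "?u \<in> C" using False by (simp add: C_def)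
    from K2(2)[OF k(2) this] have "norm ((D z) ?u) \<le> K1" using D(2)[OF k(1), of z] by (simp add: K1_def)
    then show ?thesis using False by (simp add: blinfun.scaleR_right field_simps)
  qed (simp add: blinfun.zero_right)
  then show ?thesis using K2(1) K by (intro exI[of _ K1]) (auto simp: K1_def)
qed

theorem theorem1:
  fixes M :: "real^2^2" and G :: "real^2 \<Rightarrow> real^2"
    and G' :: "real^2 \<Rightarrow> ((real^2) \<Rightarrow>\<^sub>L (real^2))"
  defines "f \<equiv> (\<lambda>x. M *v x + G x)"
      and "Df \<equiv> (\<lambda>z v. M *v v + blinfun_apply (G' z) v)"
  assumes M_int: "int_mat M"
    and G_periodic: "\<And>x k. int_vec k \<Longrightarrow> G (x + k) = G x"
    and G_deriv: "\<And>x. (G has_derivative blinfun_apply (G' x)) (at x)"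
    and G_C1: "continuous_on UNIV G'"
    and DF_inv: "\<And>z. invertible (matrix (Df z))"
    and E_M: "\<exists>m::int. \<bar>m\<bar> > 1 \<and> (\<exists>v. v \<noteq> 0 \<and> M *v v = v) \<and>
         (\<exists>vR vL K \<alpha>. vR \<noteq> 0 \<and> M *v vR = of_int m *\<^sub>R vR \<and>
             vL \<noteq> 0 \<and> vL v* M = of_int m *\<^sub>R vL \<and>
             cone_system K \<alpha> (vR /\<^sub>R norm vR) {x. vL \<bullet> x = 0} Df)"
    and E_PR: "\<exists>P. saddle f P" "\<exists>R. repeller f R"
    and E_QuasiP: "\<exists>\<Gamma> p. \<Gamma> \<subseteq> torus \<and> p \<ge> 1 \<and>
         (torus_map f ^^ p) ` \<Gamma> = \<Gamma> \<and> quasiperiodic_on (torus_map f ^^ p) \<Gamma>"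
  shows "multi_chaotic_T2 f"
proof -
  obtain m :: int and v vR vL K \<alpha> where m: "\<bar>m\<bar> > 1" and v: "v \<noteq> 0" "M *v v = v"
    and vL: "vL \<noteq> 0" "vL v* M = of_int m *\<^sub>R vL" and cs: "cone_system K \<alpha> (vR /\<^sub>R norm vR) {x. vL \<bullet> x = 0} Df"
    using E_M by blast
  obtain p q a b :: int and t :: real where pq: "p * a + q * b = 1" and t: "t \<noteq> 0"
    and vL_eq: "vL = t *\<^sub>R vector [real_of_int p, real_of_int q]"
    using integer_left_eigenvector[OF M_int m v vL] by metis
  define w0 where "w0 = vR /\<^sub>R norm vR"
  \<comment> \<open>By the Bezout identity \<open>\<phi>\<close> and \<open>\<zeta>\<close> form a
    unimodular pair, with \<open>k2\<close> and \<open>k1\<close> as the dual basis of the integer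
    lattice.\<close>
  define \<phi> where "\<phi> x = real_of_int p * x $ 1 + real_of_int q * x $ 2" for x :: "real^2"
  define \<zeta> where "\<zeta> x = real_of_int a * x $ 2 - real_of_int b * x $ 1" for x :: "real^2"
  define k1 k2 :: "real^2" where "k1 = vector [- real_of_int q, real_of_int p]" and "k2 = vector [real_of_int a, real_of_int b]"
  have pq': "real_of_int p * real_of_int a + real_of_int q * real_of_int b = 1" using pq by (metis of_int_1 of_int_add of_int_mult)
  have vL\<phi>: "vL \<bullet> x = t * \<phi> x" for x
    by (simp add: vL_eq \<phi>_def inner_vec_def sum_2 algebra_simps)
  have \<phi>_lin: "bounded_linear \<phi>" and \<zeta>_lin: "bounded_linear \<zeta>"
    unfolding \<phi>_def \<zeta>_def
    by (intro bounded_linear_add bounded_linear_sub bounded_linear_mult_right[THEN bounded_linear_compose] bounded_linear_vec_nth)+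
  interpret \<phi>: bounded_linear \<phi> by (rule \<phi>_lin)
  interpret \<zeta>: bounded_linear \<zeta> by (rule \<zeta>_lin)
  have W: "{x. vL \<bullet> x = 0} = {x. \<phi> x = 0}" using t by (simp add: vL\<phi>)
  have cs': "K > 1" "\<alpha> > 0" "\<phi> w0 \<noteq> 0"
    "\<And>z a b a' b'. \<phi> b = 0 \<Longrightarrow> \<phi> b' = 0 \<Longrightarrow> a *\<^sub>R w0 + b \<noteq> 0 \<Longrightarrow> norm b \<le> \<alpha> * \<bar>a\<bar> \<Longrightarrow>
         Df z (a *\<^sub>R w0 + b) = a' *\<^sub>R w0 + b' \<Longrightarrow> norm b' < \<alpha> * \<bar>a'\<bar> \<and> \<bar>a'\<bar> > K * \<bar>a\<bar>"
    "\<And>z a b. \<phi> b = 0 \<Longrightarrow> a *\<^sub>R w0 + b \<noteq> 0 \<Longrightarrow> \<not> (norm b < \<alpha> * \<bar>a\<bar>) \<Longrightarrow>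
         norm (Df z (a *\<^sub>R w0 + b)) < K * norm (a *\<^sub>R w0 + b)"
    using cs unfolding cone_system_def W w0_def[symmetric] mem_Collect_eq by blast+
  define w where "w = w0 /\<^sub>R \<phi> w0"
  \<comment> \<open>Removing the \<open>w\<close>-component makes \<open>\<beta>\<close> vanish on
    \<open>w\<close>; on the kernel of \<open>\<phi>\<close> it agrees with \<open>\<zeta>\<close>
    and so remains integral there.\<close>
  define \<beta> where "\<beta> x = \<zeta> (x - \<phi> x *\<^sub>R w)" for x
  have \<phi>w: "\<phi> w = 1" using cs'(3) by (simp add: w_def \<phi>.scaleR)
  have \<beta>_eq: "\<beta> x = \<zeta> x - \<phi> x * \<zeta> w" for x by (simp add: \<beta>_def \<zeta>.diff \<zeta>.scaleR)
  have \<beta>_lin: "bounded_linear \<beta>"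
    unfolding \<beta>_eq by (intro bounded_linear_sub \<zeta>_lin bounded_linear_mult_left[THEN bounded_linear_compose] \<phi>_lin)
  have ker: "u = \<zeta> u *\<^sub>R k1" if "\<phi> u = 0" for u
  proof -
    have u: "p * u $ 1 = - (q * u $ 2)" using that by (simp add: \<phi>_def)
    have "u $ 1 = (p * a + q * b) * u $ 1" using pq' by simp
    also have "\<dots> = a * (p * u $ 1) + q * b * u $ 1" by (simp add: algebra_simps)
    also have "\<dots> = - q * \<zeta> u" unfolding u by (simp add: \<zeta>_def algebra_simps)
    finally have 1: "u $ 1 = - q * \<zeta> u" .
    have "u $ 2 = (p * a + q * b) * u $ 2" using pq' by simp
    also have "\<dots> = p * a * u $ 2 - b * (- (q * u $ 2))" by (simp add: algebra_simps)
    also have "\<dots> = p * \<zeta> u" unfolding u[symmetric] by (simp add: \<zeta>_def algebra_simps)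
    finally have 2: "u $ 2 = p * \<zeta> u" .
    show ?thesis using 1 2 by (simp add: vec_eq_iff forall_2 k1_def mult.commute)
  qed
  have decomp: "x = \<phi> x *\<^sub>R w + \<beta> x *\<^sub>R k1" for x
  proof -
    have "\<phi> (x - \<phi> x *\<^sub>R w) = 0" by (simp add: \<phi>.diff \<phi>.scaleR \<phi>w)
    from ker[OF this] show ?thesis unfolding \<beta>_def[symmetric] by (simp add: algebra_simps)
  qed
  have \<phi>k1: "\<phi> k1 = 0" by (simp add: \<phi>_def k1_def)
  have \<zeta>k1: "\<zeta> k1 = 1" using pq' by (simp add: \<zeta>_def k1_def mult.commute)
  have k1_nz: "k1 \<noteq> 0" using \<zeta>k1 by (auto simp: \<zeta>.zero)
  have \<phi>M: "\<phi> (M *v x) = m * \<phi> x" for x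
  proof -
    have "vL \<bullet> (M *v x) = (vL v* M) \<bullet> x" by (simp add: dot_lmul_matrix)
    then show ?thesis unfolding vL(2) using t by (simp add: vL\<phi>)
  qed
  \<comment> \<open>The left eigenvector for \<open>m\<close> annihilates the right eigenvector
    \<open>v\<close> for 1. So \<open>v\<close> is a multiple of \<open>k1\<close>, and
    \<open>M\<close> fixes \<open>k1\<close>.\<close>
  have "\<phi> v = 0" using \<phi>M[of v] v(2) m by auto
  from ker[OF this] have "\<zeta> v *\<^sub>R k1 = v" "\<zeta> v \<noteq> 0" using v(1) by auto
  then have Mk1: "M *v k1 = k1" using v(2) by (metis matrix_vector_mult_scaleR scaleR_cancel_left)
  define D where "D z = Blinfun ((*v) M) + G' z" for z
  have D_app: "blinfun_apply (D z) = Df z" for z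
    by (simp add: fun_eq_iff D_def Df_def blinfun.add_left bounded_linear_Blinfun_apply matrix_vector_mul_bounded_linear)
  have f_deriv: "(f has_derivative (D x)) (at x)" for x
    unfolding D_app f_def Df_def
    by (intro has_derivative_add G_deriv bounded_linear_imp_has_derivative matrix_vector_mul_bounded_linear)
  have D_cont: "continuous_on UNIV D" unfolding D_def by (intro continuous_intros G_C1)
  have G'_periodic: "G' (x + k) = G' x" if k: "int_vec k" for x k
  proof -
    have "((\<lambda>y. y + k) has_derivative (\<lambda>h. h)) (at x)" by (auto intro!: derivative_eq_intros)
    from has_derivative_compose[OF this G_deriv]
    have "((\<lambda>y. G (y + k)) has_derivative blinfun_apply (G' (x + k))) (at x)" .
    then have "(G has_derivative blinfun_apply (G' (x + k))) (at x)" using G_periodic[OF k] by simp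
    then show ?thesis using has_derivative_unique[OF _ G_deriv] by (metis blinfun_apply_inject)
  qed
  obtain Bg where Bg: "\<And>x. norm (G x) \<le> Bg"
    using periodic_bounded[of G] G_periodic G_deriv has_derivative_continuous
    by (metis continuous_at_imp_continuous_on)
  obtain C\<phi> where C\<phi>: "C\<phi> > 0" "\<And>x. \<bar>\<phi> x\<bar> \<le> norm x * C\<phi>" using \<phi>.pos_bounded by auto
  \<comment> \<open>Conversion of the aperture \<open>\<alpha>\<close>: in the cone system
    \<open>x\<close> has the components \<open>a = \<phi> x / \<phi> w0\<close> and
    \<open>b = \<beta> x *\<^sub>R k1\<close>.\<close>
  define \<kappa> where "\<kappa> = \<alpha> / (\<bar>\<phi> w0\<bar> * norm k1)"
  have \<kappa>: "\<kappa> > 0" using cs'(2,3) k1_nz by (simp add: \<kappa>_def)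
  have dec0: "x = (\<phi> x / \<phi> w0) *\<^sub>R w0 + \<beta> x *\<^sub>R k1" for x
    using decomp[of x] by (simp add: w_def divide_inverse)
  have \<phi>\<beta>k1: "\<phi> (\<beta> x *\<^sub>R k1) = 0" for x by (simp add: \<phi>.scaleR \<phi>k1)
  have k1_pos: "norm k1 > 0" "\<bar>\<phi> w0\<bar> > 0" using k1_nz cs'(3) by auto
  have cone_le: "norm (\<beta> x *\<^sub>R k1) \<le> \<alpha> * \<bar>\<phi> x / \<phi> w0\<bar> \<longleftrightarrow> \<bar>\<beta> x\<bar> \<le> \<kappa> * \<bar>\<phi> x\<bar>"
    and cone_less: "norm (\<beta> x *\<^sub>R k1) < \<alpha> * \<bar>\<phi> x / \<phi> w0\<bar> \<longleftrightarrow> \<bar>\<beta> x\<bar> < \<kappa> * \<bar>\<phi> x\<bar>" for x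
    using k1_pos by (simp_all add: \<kappa>_def field_simps)
  have noncone: "norm ((D z) x) < K * norm x" if "x \<noteq> 0" "\<not> \<bar>\<beta> x\<bar> < \<kappa> * \<bar>\<phi> x\<bar>" for z x
    using cs'(5)[OF \<phi>\<beta>k1, of "\<phi> x / \<phi> w0" x z] that unfolding cone_less dec0[symmetric] D_app by blast
  obtain K1 where K1: "0 < K1" "K1 < K" "\<And>z v. \<not> \<bar>\<beta> v\<bar> < \<kappa> * \<bar>\<phi> v\<bar> \<Longrightarrow> norm ((D z) v) \<le> K1 * norm v"
  proof -
    have "\<exists>K1. 0 < K1 \<and> K1 < K \<and> (\<forall>z v. \<not> \<bar>\<beta> v\<bar> < \<kappa> * \<bar>\<phi> v\<bar> \<longrightarrow> norm ((D z) v) \<le> K1 * norm v)"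
      by (rule strict_bound_outside_cone[OF D_cont _ \<phi>_lin \<beta>_lin _ noncone])
        (use G'_periodic cs'(1) in \<open>auto simp: D_def\<close>)
    then show ?thesis using that by blast
  qed
  interpret cone_map f D M \<phi> \<beta> w k1 k2 "real_of_int m" \<kappa> K K1 "C\<phi> * Bg"
  proof (rule cone_map.intro)
    show "(f has_derivative (D x)) (at x)" for x by (rule f_deriv)
    show "v = 0" if "(D x) v = 0" for x v
    proof -
      obtain A where "A ** matrix (Df x) = mat 1" using DF_inv[of x] unfolding invertible_def by blast
      moreover have "matrix (Df x) *v v = Df x v"
        by (rule matrix_works) (simp add: D_app[symmetric] linear_matrix_vector_mul_eq blinfun.bounded_linear_right bounded_linear.linear)
      ultimately show ?thesis using that unfolding D_app
        by (metis matrix_vector_mul_assoc matrix_vector_mul_lid matrix_vector_mult_0_right)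
    qed
    show "f (x + k) = f x + M *v k" if "int_vec k" for x k
      using G_periodic[OF that] by (simp add: f_def matrix_vector_right_distrib)
    show "\<phi> k \<in> \<int>" if "int_vec k" for k
      using that by (auto simp: \<phi>_def int_vec_def)
    show "\<bar>\<phi> (f x) - real_of_int m * \<phi> x\<bar> \<le> C\<phi> * Bg" for x
    proof -
      have "\<bar>\<phi> (f x) - real_of_int m * \<phi> x\<bar> \<le> norm (G x) * C\<phi>" using C\<phi>(2)[of "G x"] by (simp add: f_def \<phi>.add \<phi>M)
      also have "\<dots> \<le> C\<phi> * Bg" using Bg[of x] C\<phi>(1) by (simp add: mult.commute)
      finally show ?thesis .
    qed
    show "int_vec k1" "int_vec k2" by (auto simp: k1_def k2_def int_vec_def forall_2)
    show "\<beta> k1 = 1" by (simp add: \<beta>_eq \<phi>k1 \<zeta>k1)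
    show "\<phi> k2 = 1" using pq' by (simp add: \<phi>_def k2_def)
    show "\<beta> k \<in> \<int>" if "int_vec k" "\<phi> k = 0" for k
      using that by (auto simp: \<beta>_eq \<zeta>_def int_vec_def)
    show "\<beta> w = 0" by (simp add: \<beta>_eq \<phi>w)
    show "2 \<le> \<bar>real_of_int m\<bar>" using m by (metis int_one_le_iff_zero_less zless_imp_add1_zle of_int_abs of_int_le_iff of_int_numeral one_add_one)
    show "\<bar>\<beta> ((D z) x)\<bar> < \<kappa> * \<bar>\<phi> ((D z) x)\<bar> \<and> K * \<bar>\<phi> x\<bar> < \<bar>\<phi> ((D z) x)\<bar>"
      if "x \<noteq> 0" "\<bar>\<beta> x\<bar> \<le> \<kappa> * \<bar>\<phi> x\<bar>" for z x
    proof -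
      have "norm (\<beta> (Df z x) *\<^sub>R k1) < \<alpha> * \<bar>\<phi> (Df z x) / \<phi> w0\<bar> \<and> \<bar>\<phi> (Df z x) / \<phi> w0\<bar> > K * \<bar>\<phi> x / \<phi> w0\<bar>"
      proof (rule cs'(4)[OF \<phi>\<beta>k1 \<phi>\<beta>k1])
        show "(\<phi> x / \<phi> w0) *\<^sub>R w0 + \<beta> x *\<^sub>R k1 \<noteq> 0" using that(1) dec0[of x] by simp
        show "norm (\<beta> x *\<^sub>R k1) \<le> \<alpha> * \<bar>\<phi> x / \<phi> w0\<bar>" using that(2) by (simp only: cone_le)
        show "Df z ((\<phi> x / \<phi> w0) *\<^sub>R w0 + \<beta> x *\<^sub>R k1) = (\<phi> (Df z x) / \<phi> w0) *\<^sub>R w0 + \<beta> (Df z x) *\<^sub>R k1"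
          using dec0[of x] dec0[of "Df z x"] by simp
      qed
      then show ?thesis unfolding cone_less D_app using k1_pos by (simp add: abs_divide divide_less_cancel)
    qed
  qed (fact D_cont M_int \<phi>_lin \<beta>_lin \<phi>M \<phi>k1 Mk1 \<phi>w decomp \<kappa> cs'(1) K1 Ints_of_int)+
  obtain \<Gamma> n where \<Gamma>: "\<Gamma> \<subseteq> torus" "n \<ge> 1" "(torus_map f ^^ n) ` \<Gamma> = \<Gamma>" "quasiperiodic_on (torus_map f ^^ n) \<Gamma>"
    using E_QuasiP by blast
  obtain c where c: "\<exists>n G. n \<ge> 1 \<and> deck n G \<and> (\<forall>x. H x = c \<longrightarrow> H (G x) = c)"
    "\<And>x y e. H x = c \<Longrightarrow> H y = c \<Longrightarrow> e > 0 \<Longrightarrow> \<exists>n S. deck n S \<and> H (S x) = c \<and> norm (S x - y) < e"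
    "\<And>x y e. H x = c \<Longrightarrow> H y = c \<Longrightarrow> e > 0 \<Longrightarrow> \<exists>n S z. deck n S \<and> H z = c \<and> norm (z - x) < e \<and> S z = y"
    by (rule quasiperiodic_fibre[OF \<Gamma>]) blast
  interpret cone_map_qp f D M \<phi> \<beta> w k1 k2 "real_of_int m" \<kappa> K K1 "C\<phi> * Bg" c
    by unfold_locales (fact c)+
  obtain P R where "saddle f P" "repeller f R" using E_PR by blast
  then have dense: "\<exists>x\<in>U. saddle f x" "\<exists>x\<in>U. repeller f x" if "open U" "U \<noteq> {}" for U
    using saddles_dense repellers_dense that by blast+
  show ?thesis unfolding multi_chaotic_T2_def
  proof (intro conjI torus_map_surj dense_orbit closure_torus_emb)
    fix U :: "(real^2) set" assume "open U" "U \<noteq> {}"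
    from dense[OF this] obtain x y where "x \<in> U" "saddle f x" "y \<in> U" "repeller f y" by blast
    then show "\<exists>x\<in>{x. saddle f x}. \<exists>y\<in>U. int_vec (x - y)" "\<exists>x\<in>{x. repeller f x}. \<exists>y\<in>U. int_vec (x - y)"
      by (force intro!: bexI[of _ x], force intro!: bexI[of _ y])
  qed
qed

end
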